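(* Let $S$ be a standard $\mathbb{N}^k$-graded polynomial ring over a field $\mathbf{k}$ and let $M$ be a finitely generated $\mathbb{Z}^k$-graded $S$-module. Let $I$ be a multigraded homogeneous ideal in $S$ minimally generated in degrees $\mathbf{d}_1(I), \dots, \mathbf{d}_v(I)$. Then the resolution regularity $\operatorname{\mathbf{res-reg}}(I^nM)$ is asymptotically (that is, for $n \gg 0$) a linear function of $n$ with slope vector at most $\big(d^{[1]}(I), \dots, d^{[k]}(I)\big)$ componentwise.
   Context: $\mathbb{N}$ denotes the non-negative integers and $\mathbf{e}_1,\dots,\mathbf{e}_k$ are the standard unit vectors of $\mathbb{Z}^k$. A standard $\mathbb{N}^k$-graded polynomial ring over a field $\mathbf{k}$ is a polynomial ring $S = \mathbf{k}[x_{l,j} : 1 \le l \le k,\ 1 \le j \le N_l]$ with $\deg x_{l,j} = \mathbf{e}_l$. A multigraded homogeneous ideal is an ideal generated by $\mathbb{Z}^k$-homogeneous elements. Resolution regularity: let $M$ be a finitely generated $\mathbb{Z}^k$-graded $S$-module with minimal $\mathbb{Z}^k$-graded free resolution $0 \to F_p \to \dots \to F_0 \to M \to 0$ over $S$, where $F_i = \bigoplus_j S(-c^{[1]}_{ij}, \dots, -c^{[k]}_{ij})$. For $1 \le l \le k$ put $c^{[l]}_i = \max_j c^{[l]}_{ij}$ for $i = 0,\dots,p$ and $\operatorname{res-reg}_l(M) = \max_i \{c^{[l]}_i - i\}$. Then $\operatorname{\mathbf{res-reg}}(M) = (\operatorname{res-reg}_1(M), \dots, \operatorname{res-reg}_k(M))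 \in \mathbb{Z}^k$. For a $\mathbb{Z}^k$-graded module (or ideal) $M$ minimally generated in degrees $\mathbf{d}_1(M), \dots, \mathbf{d}_v(M)$ with $\mathbf{d}_i(M) = (d_{i,1}, \dots, d_{i,k})$, set $d^{[l]}(M) = \max\{d_{i,l} : i = 1, \dots, v\}$, the maximal $l$-th coordinate among the minimal generating degrees. *)

theory Defs
  imports "HOL-Analysis.Finite_Cartesian_Product" "HOL-Library.Poly_Mapping"
begin

section \<open>Standard multigraded polynomial rings\<close>

text \<open>
  The ring \<open>S\<close> is the type of polynomials over the field \<^typ>\<open>'a\<close> in the variables \<open>x\<^sub>v\<close> for
  \<open>v\<close> in the finite type \<^typ>\<open>'v\<close>. The degree group \<open>\<int>\<^sup>k\<close> is \<^typ>\<open>int ^ 'k\<close>, so \<open>k = CARD('k)\<close>.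
  A standard multigrading is given by a map \<open>c :: 'v \<Rightarrow> 'k\<close>, where \<open>x\<^sub>v\<close> has degree
  the standard unit vector at \<open>c v\<close>. Thus the variables \<open>x\<^sub>l\<^sub>,\<^sub>1, \<dots>, x\<^sub>l\<^sub>,\<^sub>N\<close> of degree
  \<open>e\<^sub>l\<close> are the \<open>x\<^sub>v\<close> with \<open>c v = l\<close>, and \<open>N\<^sub>l = card (c -` {l})\<close>.
\<close>

type_synonym ('v, 'a) mpoly = "('v \<Rightarrow>\<^sub>0 nat) \<Rightarrow>\<^sub>0 'a"

definition mono_deg :: "('v::finite \<Rightarrow> 'k::finite) \<Rightarrow> ('v \<Rightarrow>\<^sub>0 nat) \<Rightarrow> int ^ 'k" where
  "mono_deg c m = (\<Sum>v\<in>UNIV. axis (c v) (int (Poly_Mapping.lookup m v)))"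

definition ring_part :: "('v::finite \<Rightarrow> 'k::finite) \<Rightarrow> int ^ 'k \<Rightarrow> ('v, 'a::field) mpoly set" where
  "ring_part c d = {p. \<forall>m \<in> Poly_Mapping.keys p. mono_deg c m = d}"

text \<open>The ideal generated by all the variables: the polynomials without constant term.\<close>

definition irrelevant_ideal :: "('v, 'a::field) mpoly set" where
  "irrelevant_ideal = {p. Poly_Mapping.lookup p 0 = 0}"


section \<open>Ideals and their powers\<close>

definition ideal_gen :: "('v, 'a::field) mpoly set \<Rightarrow> ('v, 'a) mpoly set" where
  "ideal_gen = module.span (*)"

fun ideal_power :: "('v, 'a::field) mpoly set \<Rightarrow> nat \<Rightarrow> ('v, 'a) mpoly set" where
  "ideal_power I 0 = UNIV"
| "ideal_power I (Suc n) = ideal_gen {f * h | f h. f \<in> I \<and> h \<in> ideal_power I n}"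

text \<open>
  The ideal \<open>I\<close> is minimally generated by homogeneous elements of degrees \<open>d 1, \<dots>, d v\<close>;
  in particular \<open>I\<close> is homogeneous. Irredundancy forces the generators to be nonzero, so their
  degrees are well determined. The zero ideal is the case \<open>v = 0\<close>.
\<close>

definition minimally_generated_in_degrees ::
  "('v::finite \<Rightarrow> 'k::finite) \<Rightarrow> ('v, 'a::field) mpoly set \<Rightarrow> nat \<Rightarrow> (nat \<Rightarrow> int ^ 'k) \<Rightarrow> bool" where
  "minimally_generated_in_degrees c I v d \<longleftrightarrow>
     (\<exists>g. (\<forall>i\<in>{1..v}. g i \<in> ring_part c (d i)) \<and>
          I = ideal_gen (g ` {1..v}) \<and>
          (\<forall>i\<in>{1..v}. g i \<notin> ideal_gen (g ` ({1..v} - {i}))))"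

definition max_gen_degree :: "nat \<Rightarrow> (nat \<Rightarrow> int ^ 'k) \<Rightarrow> 'k \<Rightarrow> int" where
  "max_gen_degree v d l = Max {d i $ l | i. i \<in> {1..v}}"


section \<open>Graded modules\<close>

text \<open>
  The module \<open>M\<close> is the whole type \<^typ>\<open>'m\<close>, with scalar multiplication \<open>s\<close> and with
  \<open>gr d\<close> as the component of degree \<open>d\<close>. The last axiom says that \<open>M\<close> is the direct sum of
  its components.
\<close>

locale graded_module = module s
  for s :: "('v::finite, 'a::field) mpoly \<Rightarrow> 'm::ab_group_add \<Rightarrow> 'm" +
  fixes c :: "'v \<Rightarrow> 'k::finite"
    and gr :: "int ^ 'k \<Rightarrow> 'm set"
  assumes gr_zero: "0 \<in> gr d"
    and gr_diff: "x \<in> gr d \<Longrightarrow> y \<in> gr d \<Longrightarrow> x - y \<in> gr d"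
    and gr_scale: "p \<in> ring_part c d \<Longrightarrow> x \<in> gr e \<Longrightarrow> s p x \<in> gr (d + e)"
    and gr_decomp: "\<exists>!y. (\<forall>d. y d \<in> gr d) \<and> finite {d. y d \<noteq> 0} \<and> x = (\<Sum>d | y d \<noteq> 0. y d)"

definition finitely_generated ::
  "(('v, 'a::field) mpoly \<Rightarrow> 'm::ab_group_add \<Rightarrow> 'm) \<Rightarrow> bool" where
  "finitely_generated s \<longleftrightarrow> (\<exists>B. finite B \<and> module.span s B = UNIV)"

text \<open>The submodule \<open>I\<^sup>n M\<close>.\<close>

definition power_submodule ::
  "(('v, 'a::field) mpoly \<Rightarrow> 'm::ab_group_add \<Rightarrow> 'm) \<Rightarrow> ('v, 'a) mpoly set \<Rightarrow> nat \<Rightarrow> 'm set" where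
  "power_submodule s I n = module.span s {s f x | f x. f \<in> ideal_power I n}"


section \<open>Graded free modules\<close>

text \<open>
  All free modules of finite rank live in one type: \<open>S\<^sup>r\<close> consists of the \<open>f :: nat \<Rightarrow>\<^sub>0 S\<close> with
  \<open>f j = 0\<close> for \<open>j \<ge> r\<close>. With shifts \<open>b j\<close> for \<open>j < r\<close>, it is the graded module
  \<open>\<Oplus>\<^sub>j S(-b j)\<close>, whose \<open>j\<close>-th basis element has degree \<open>b j\<close>.
\<close>

type_synonym ('v, 'a) free = "nat \<Rightarrow>\<^sub>0 ('v, 'a) mpoly"

definition free_scale :: "('v, 'a::field) mpoly \<Rightarrow> ('v, 'a) free \<Rightarrow> ('v, 'a) free" where
  "free_scale p f = Poly_Mapping.map ((*) p) f"

lemma lookup_free_scale: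
  "Poly_Mapping.lookup (free_scale p f) j = p * Poly_Mapping.lookup f j"
  by (auto simp: free_scale_def Poly_Mapping.map.rep_eq when_def)

lemma module_free_scale: "module free_scale"
  by unfold_locales
    (auto intro!: poly_mapping_eqI simp: lookup_free_scale lookup_add algebra_simps)

definition free_module :: "nat \<Rightarrow> ('v, 'a::field) free set" where
  "free_module r = {f. Poly_Mapping.keys f \<subseteq> {..<r}}"

definition free_part ::
  "('v::finite \<Rightarrow> 'k::finite) \<Rightarrow> nat \<Rightarrow> (nat \<Rightarrow> int ^ 'k) \<Rightarrow> int ^ 'k \<Rightarrow> ('v, 'a::field) free set" where
  "free_part c r b d =
     {f \<in> free_module r. \<forall>j<r. Poly_Mapping.lookup f j \<in> ring_part c (d - b j)}"


section \<open>Minimal graded free resolutions and resolution regularity\<close>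

text \<open>
  The following says that \<open>0 \<rightarrow> F\<^sub>p \<rightarrow> \<dots> \<rightarrow> F\<^sub>1 \<rightarrow> F\<^sub>0 \<rightarrow> N \<rightarrow> 0\<close> is a minimal graded free resolution of
  the graded submodule \<open>N\<close>. Here \<open>F\<^sub>i = \<Oplus>\<^sub>j\<^sub><\<^sub>r\<^sub>i S(-b i j)\<close>, the augmentation is \<open>\<epsilon>\<close>, and
  \<open>\<delta> i\<close> is the differential from \<open>F\<^sub>i\<^sub>+\<^sub>1\<close> to \<open>F\<^sub>i\<close>. All maps are homogeneous of degree \<open>0\<close>; they are
  taken to be linear on the whole ambient type, as in \<^const>\<open>module_hom\<close>, but only their values
  on the \<open>F\<^sub>i\<close> matter. Minimality means that the image of \<open>\<delta> i\<close> lies in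
  \<open>\<mm> F\<^sub>i\<close>, where \<open>\<mm>\<close> is the ideal generated by the variables.
\<close>

definition minimal_graded_free_resolution ::
  "(('v::finite, 'a::field) mpoly \<Rightarrow> 'm::ab_group_add \<Rightarrow> 'm) \<Rightarrow> ('v \<Rightarrow> 'k::finite) \<Rightarrow>
   (int ^ 'k \<Rightarrow> 'm set) \<Rightarrow> 'm set \<Rightarrow>
   (nat \<Rightarrow> nat) \<Rightarrow> (nat \<Rightarrow> nat \<Rightarrow> int ^ 'k) \<Rightarrow>
   (('v, 'a) free \<Rightarrow> 'm) \<Rightarrow> (nat \<Rightarrow> ('v, 'a) free \<Rightarrow> ('v, 'a) free) \<Rightarrow> bool" where
  "minimal_graded_free_resolution s c gr N r b \<epsilon> \<delta> \<longleftrightarrow>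
     (\<exists>p. \<forall>i>p. r i = 0) \<and>
     module_hom free_scale s \<epsilon> \<and>
     (\<forall>i. module_hom free_scale free_scale (\<delta> i)) \<and>
     (\<forall>d. \<epsilon> ` free_part c (r 0) (b 0) d \<subseteq> gr d) \<and>
     (\<forall>i d. \<delta> i ` free_part c (r (Suc i)) (b (Suc i)) d \<subseteq> free_part c (r i) (b i) d) \<and>
     \<epsilon> ` free_module (r 0) = N \<and>
     \<delta> 0 ` free_module (r 1) = {f \<in> free_module (r 0). \<epsilon> f = 0} \<and>
     (\<forall>i. \<delta> (Suc i) ` free_module (r (Suc (Suc i))) = {f \<in> free_module (r (Suc i)). \<delta> i f = 0}) \<and>
     (\<forall>i. \<forall>f \<in> free_module (r (Suc i)). \<forall>j. Poly_Mapping.lookup (\<delta> i f) j \<in> irrelevant_ideal)"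

text \<open>
  With \<open>c\<^sub>i\<^sup>l\<close> the maximal \<open>l\<close>-th coordinate of the shifts of \<open>F\<^sub>i\<close>, the following is the vector
  with \<open>l\<close>-th entry \<open>max\<^sub>i (c\<^sub>i\<^sup>l - i)\<close>. The maximum is over the \<open>i\<close> with \<open>F\<^sub>i \<noteq> 0\<close>, since otherwise
  \<open>c\<^sub>i\<^sup>l\<close> is the maximum of the empty set.
\<close>

definition max_shift :: "(nat \<Rightarrow> nat) \<Rightarrow> (nat \<Rightarrow> nat \<Rightarrow> int ^ 'k) \<Rightarrow> nat \<Rightarrow> 'k \<Rightarrow> int" where
  "max_shift r b i l = Max {b i j $ l | j. j < r i}"

definition shift_regularity :: "(nat \<Rightarrow> nat) \<Rightarrow> (nat \<Rightarrow> nat \<Rightarrow> int ^ 'k) \<Rightarrow> int ^ 'k" where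
  "shift_regularity r b = (\<chi> l. Max {max_shift r b i l - int i | i. r i > 0})"

text \<open>
  The resolution regularity of the graded submodule \<open>N\<close>, read off from a minimal graded free
  resolution, whose shifts are unique up to order. It is meaningful only for finitely
  generated \<open>N \<noteq> 0\<close>: for \<open>N = 0\<close> all \<open>F\<^sub>i\<close> vanish and the maximum is over the empty set.
\<close>

definition res_reg ::
  "(('v::finite, 'a::field) mpoly \<Rightarrow> 'm::ab_group_add \<Rightarrow> 'm) \<Rightarrow> ('v \<Rightarrow> 'k::finite) \<Rightarrow>
   (int ^ 'k \<Rightarrow> 'm set) \<Rightarrow> 'm set \<Rightarrow> int ^ 'k" where
  "res_reg s c gr N = (THE \<rho>. \<exists>r b \<epsilon> \<delta>.
     minimal_graded_free_resolution s c gr N r b \<epsilon> \<delta> \<and> \<rho> = shift_regularity r b)"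

end

theory Submission
  imports Defs "HOL-Library.Function_Algebras" "HOL-Library.Infinite_Set"
begin

text \<open>
  The shifts in homological degree \<open>i\<close> of a minimal resolution of \<open>N\<close> are the degrees in which
  the Koszul homology \<open>H\<^sub>i(N)\<close> of the variables with values in \<open>N\<close> is nonzero. This follows by
  dimension shifting, because graded free modules are Koszul-acyclic, and it yields both the finite
  length and the uniqueness of the shifts. Let \<open>Z\<^sub>n\<close> and \<open>B\<^sub>n\<close> be the Koszul cycles and boundaries
  of \<open>I\<^sup>n M\<close>. By Hilbert's basis theorem for the Rees module, \<open>\<Oplus>\<^sub>n Z\<^sub>n\<close> is generated by finitely many
  homogeneous elements \<open>u\<close> over \<open>S[y\<^sub>1, \<dots>, y\<^sub>v]\<close>, where \<open>y\<^sub>j\<close> acts as the generator \<open>g\<^sub>j\<close> of \<open>I\<close>. The variables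
  of \<open>S\<close> map \<open>Z\<^sub>n\<close> into \<open>B\<^sub>n\<close>, so the homology of \<open>I\<^sup>n M\<close> is spanned by classes \<open>g\<^sup>\<alpha> u\<close>. For fixed \<open>u\<close> the
  \<open>\<alpha>\<close> with nonzero class form a down-closed set of exponents, that is, a finite union of translated
  coordinate orthants. On each orthant the maximal \<open>l\<close>-th degree is a linear function of \<open>n\<close> whose slope
  is the \<open>l\<close>-th degree of some \<open>g\<^sub>j\<close>.
\<close>

text \<open>The minimal resolutions of the modules I^n M come without canonical maps between them,
  so their shifts cannot be compared directly. Koszul chains can: for all n they live in one module,
  the functions from sets of variables to M. There the cycles and boundaries of I^n M are plain
  subsets, and each generator of I carries those of I^n M into those of I^(n+1) M. Because the
  variables act as zero on homology, only constants and monomials g^\<alpha> matter. The degree of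
  the class of g^\<alpha> u is therefore determined by u and \<alpha>, and only the question whether
  the class vanishes is left. Vanishing passes to multiples, since a generator times a boundary is a
  boundary; this is the source of the down-closed sets. The slope belongs to a single generator
  because on an orthant it is optimal to spend the whole exponent in the direction of largest l-th
  degree. One threshold for n serves everything, as there are finitely many homological degrees and
  coordinates. When I^n M is eventually zero there is nothing to take a maximum over, hence the
  disjunction in the conclusion.\<close>

abbreviation "lookup \<equiv> Poly_Mapping.lookup"
abbreviation "single \<equiv> Poly_Mapping.single"

section \<open>Eventually linear maxima over down-closed sets of exponents\<close>

definition exps :: "'j set \<Rightarrow> ('j \<Rightarrow> nat) set" where
  "exps X = {\<alpha>. \<forall>j. j \<notin> X \<longrightarrow> \<alpha> j = 0}"

text \<open>Every sequence has a monotone subsequence. If that is decreasing, it is constant from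
  the place of its minimum on, and this tail is increasing.\<close>

lemma nat_seq_incseq_subseq:
  fixes f :: "nat \<Rightarrow> nat"
  shows "\<exists>\<phi>. strict_mono \<phi> \<and> incseq (\<lambda>i. f (\<phi> i))"
proof -
  obtain \<phi> where \<phi>: "strict_mono \<phi>" "monoseq (\<lambda>n. f (\<phi> n))"
    using seq_monosub by blast
  show ?thesis
  proof (cases "incseq (\<lambda>n. f (\<phi> n))")
    case True
    with \<phi> show ?thesis by blast
  next
    case False
    hence dec: "decseq (\<lambda>n. f (\<phi> n))"
      using \<phi>(2) by (simp add: monoseq_iff)
    define n0 where "n0 = (ARG_MIN (\<lambda>n. f (\<phi> n)) n. True)"
    have min: "f (\<phi> n0) \<le> f (\<phi> n)" for n
      unfolding n0_def by (rule arg_min_nat_le) simp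
    have "f (\<phi> (n0 + i)) = f (\<phi> n0)" for i
      using dec min[of "n0 + i"] by (simp add: decseq_def le_antisym)
    hence "incseq (\<lambda>i. f (\<phi> (n0 + i)))" by (simp add: incseq_def)
    moreover have "strict_mono (\<lambda>i. \<phi> (n0 + i))"
      using \<phi>(1) by (simp add: strict_mono_def)
    ultimately show ?thesis by blast
  qed
qed

text \<open>Dickson's lemma in sequence form: subsequences are refined one coordinate at a time, and
  refinement keeps the coordinates already treated increasing.\<close>

lemma dickson_subseq:
  fixes f :: "nat \<Rightarrow> 'j \<Rightarrow> nat"
  assumes "finite X"
  shows "\<exists>\<phi>. strict_mono \<phi> \<and> (\<forall>x\<in>X. incseq (\<lambda>i. f (\<phi> i) x))"
  using assms
proof induct
  case empty
  show ?case by (rule exI[of _ id]) (simp add: strict_mono_def)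
next
  case (insert x X)
  then obtain \<phi> where \<phi>: "strict_mono \<phi>" "\<forall>x\<in>X. incseq (\<lambda>i. f (\<phi> i) x)" by blast
  obtain \<psi> where \<psi>: "strict_mono \<psi>" "incseq (\<lambda>i. f (\<phi> (\<psi> i)) x)"
    using nat_seq_incseq_subseq[of "\<lambda>i. f (\<phi> i) x"] by blast
  have "strict_mono (\<lambda>i. \<phi> (\<psi> i))"
    using \<phi>(1) \<psi>(1) by (simp add: strict_mono_def)
  moreover have "incseq (\<lambda>i. f (\<phi> (\<psi> i)) y)" if "y \<in> X" for y
    using \<phi>(2) that strict_mono_less_eq[OF \<psi>(1)] by (simp add: incseq_def)
  ultimately show ?case using \<psi>(2) by blast
qed

text \<open>This is the chain condition for monomial ideals, seen on complements. If there were
  infinitely many strict drops, choose an exponent lost at each. By Dickson's lemma an earlier lost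
  exponent lies below a later one; the later one is still present after the earlier drop, so by
  down-closure the earlier one was not lost.\<close>

lemma downclosed_decreasing_stabilizes:
  fixes D :: "nat \<Rightarrow> ('j \<Rightarrow> nat) set"
  assumes X: "finite X" and sub: "\<And>t. D t \<subseteq> exps X"
    and down: "\<And>t \<alpha> \<beta>. \<alpha> \<in> D t \<Longrightarrow> \<beta> \<le> \<alpha> \<Longrightarrow> \<beta> \<in> D t"
    and anti: "\<And>t t'. t \<le> t' \<Longrightarrow> D t' \<subseteq> D t"
  shows "\<exists>t0. \<forall>t\<ge>t0. D t = D t0"
proof -
  define T where "T = {t. D (Suc t) \<noteq> D t}"
  have "finite T"
  proof (rule ccontr)
    assume inf: "infinite T"
    define e where "e = enumerate T"
    have "\<exists>\<beta>. \<beta> \<in> D (e i) \<and> \<beta> \<notin> D (Suc (e i))" for i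
      using enumerate_in_set[OF inf, of i] anti[of "e i" "Suc (e i)"]
      unfolding T_def e_def by auto
    then obtain \<beta> where \<beta>: "\<And>i. \<beta> i \<in> D (e i)" "\<And>i. \<beta> i \<notin> D (Suc (e i))" by metis
    obtain \<phi> where \<phi>: "strict_mono \<phi>" "\<forall>x\<in>X. incseq (\<lambda>i. \<beta> (\<phi> i) x)"
      using dickson_subseq[OF X] by blast
    have "\<beta> (\<phi> 0) x \<le> \<beta> (\<phi> 1) x" for x
    proof (cases "x \<in> X")
      case True
      with \<phi>(2) show ?thesis by (simp add: incseq_def)
    next
      case False
      have "\<beta> (\<phi> 0) \<in> exps X" using \<beta>(1) sub by blast
      with False show ?thesis by (simp add: exps_def)
    qed
    hence le: "\<beta> (\<phi> 0) \<le> \<beta> (\<phi> 1)" by (simp add: le_fun_def)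
    have "\<phi> 0 < \<phi> 1" using \<phi>(1) by (simp add: strict_mono_def)
    hence "e (\<phi> 0) < e (\<phi> 1)"
      unfolding e_def using inf by (simp add: enumerate_mono)
    hence "\<beta> (\<phi> 1) \<in> D (Suc (e (\<phi> 0)))"
      using \<beta>(1)[of "\<phi> 1"] anti[of "Suc (e (\<phi> 0))" "e (\<phi> 1)"] by auto
    with le down \<beta>(2) show False by blast
  qed
  then obtain t0 where t0: "\<forall>t\<in>T. t < t0" by (meson finite_nat_set_iff_bounded)
  have "D t = D t0" if "t \<ge> t0" for t
    using that
  proof (induct rule: dec_induct)
    case (step n)
    hence "n \<notin> T" using t0 by fastforce
    thus ?case using step by (simp add: T_def)
  qed simp
  thus ?thesis by blast
qed

lemma mem_UN_orthants:
  "\<gamma> \<in> (\<Union>(\<alpha>,F)\<in>P. (+) \<alpha> ` exps F) \<longleftrightarrow> (\<exists>\<alpha> F \<beta>. (\<alpha>,F) \<in> P \<and> \<beta> \<in> exps F \<and> \<gamma> = \<alpha> + \<beta>)"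
  by (auto simp: image_iff)

lemma mem_UN_orthantsI:
  "(\<alpha>,F) \<in> P \<Longrightarrow> \<beta> \<in> exps F \<Longrightarrow> \<alpha> + \<beta> \<in> (\<Union>(\<alpha>,F)\<in>P. (+) \<alpha> ` exps F)"
  by (rule UN_I[of "(\<alpha>,F)"], assumption, simp)

text \<open>Induction on the coordinates. The slices \<open>S t\<close> of \<open>D\<close> at
  height t in the new coordinate x are down-closed and decrease with t, hence are constant from some
  \<open>t0\<close> on. Each slice below \<open>t0\<close> contributes its orthants at fixed height;
  the stable slice contributes orthants based at height \<open>t0\<close> with x as an additional
  free direction.\<close>

lemma downclosed_decomposition:
  fixes D :: "('j \<Rightarrow> nat) set"
  assumes "finite X" "D \<subseteq> exps X" "\<And>\<alpha> \<beta>. \<alpha> \<in> D \<Longrightarrow> \<beta> \<le> \<alpha> \<Longrightarrow> \<beta> \<in> D"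
  shows "\<exists>P. finite P \<and> (\<forall>(\<alpha>,F)\<in>P. F \<subseteq> X \<and> \<alpha> \<in> exps X) \<and> D = (\<Union>(\<alpha>,F)\<in>P. (+) \<alpha> ` exps F)"
  using assms
proof (induct X arbitrary: D)
  case empty
  have z: "exps {} = {0::'j \<Rightarrow> nat}" by (auto simp: exps_def)
  show ?case
  proof (cases "D = {}")
    case True
    thus ?thesis by (intro exI[of _ "{}"]) simp
  next
    case False
    hence "D = {0}" using empty(1) z by auto
    thus ?thesis by (intro exI[of _ "{(0,{})}"]) (simp add: z)
  qed
next
  case (insert x X)
  define S where "S t = {\<beta> \<in> exps X. \<beta>(x := t) \<in> D}" for t
  have Sub: "S t \<subseteq> exps X" for t by (auto simp: S_def)
  have down: "\<beta> \<in> S t" if "\<alpha> \<in> S t" "\<beta> \<le> \<alpha>" for \<alpha> \<beta> t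
  proof -
    have "\<beta>(x := t) \<le> \<alpha>(x := t)" using that(2) by (simp add: le_fun_def)
    hence "\<beta>(x := t) \<in> D" using that(1) insert(5) unfolding S_def by blast
    moreover have "\<beta> \<in> exps X"
      using that unfolding S_def exps_def le_fun_def by auto (metis le_zero_eq)
    ultimately show ?thesis by (simp add: S_def)
  qed
  have anti: "S t' \<subseteq> S t" if "t \<le> t'" for t t'
  proof
    fix \<beta> assume b: "\<beta> \<in> S t'"
    have "\<beta>(x := t) \<le> \<beta>(x := t')" using that by (simp add: le_fun_def)
    thus "\<beta> \<in> S t" using b insert(5) unfolding S_def by blast
  qed
  have "\<exists>t0. \<forall>t\<ge>t0. S t = S t0"
    by (rule downclosed_decreasing_stabilizes[OF insert(1) Sub]) (use down anti in blast)+
  then obtain t0 where t0: "\<And>t. t \<ge> t0 \<Longrightarrow> S t = S t0" by blast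
  have "\<exists>P. finite P \<and> (\<forall>(\<alpha>,F)\<in>P. F \<subseteq> X \<and> \<alpha> \<in> exps X) \<and> S t = (\<Union>(\<alpha>,F)\<in>P. (+) \<alpha> ` exps F)" for t
    by (rule insert(3)[OF Sub]) (rule down)
  then obtain P where P: "\<And>t. finite (P t)" "\<And>t. \<forall>(\<alpha>,F)\<in>P t. F \<subseteq> X \<and> \<alpha> \<in> exps X"
    "\<And>t. S t = (\<Union>(\<alpha>,F)\<in>P t. (+) \<alpha> ` exps F)" by metis
  define Q where "Q = (\<Union>t<t0. (\<lambda>(\<alpha>,F). (\<alpha>(x := t), F)) ` P t) \<union> (\<lambda>(\<alpha>,F). (\<alpha>(x := t0), insert x F)) ` P t0"
  have "finite Q" using P(1) by (simp add: Q_def)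
  moreover have "\<forall>(\<alpha>,F)\<in>Q. F \<subseteq> insert x X \<and> \<alpha> \<in> exps (insert x X)"
  proof (intro ballI)
    fix q assume "q \<in> Q"
    then obtain t \<alpha> F where q: "(\<alpha>,F) \<in> P t" "q = (\<alpha>(x := t), F) \<or> q = (\<alpha>(x := t), insert x F)"
      unfolding Q_def by auto
    have "F \<subseteq> X \<and> \<alpha> \<in> exps X" using P(2)[of t] q(1) by auto
    with q(2) show "case q of (\<alpha>,F) \<Rightarrow> F \<subseteq> insert x X \<and> \<alpha> \<in> exps (insert x X)"
      by (auto simp: exps_def)
  qed
  moreover have "D = (\<Union>(\<alpha>,F)\<in>Q. (+) \<alpha> ` exps F)"
  proof (intro equalityI subsetI)
    fix \<gamma> assume g: "\<gamma> \<in> D"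
    define t \<beta> where "t = \<gamma> x" and "\<beta> = \<gamma>(x := 0)"
    have "\<beta> \<in> exps X" using g insert(4) by (auto simp: \<beta>_def exps_def)
    moreover have "\<beta>(x := t) = \<gamma>" by (simp add: \<beta>_def t_def)
    ultimately have bS: "\<beta> \<in> S t" using g by (simp add: S_def)
    show "\<gamma> \<in> (\<Union>(\<alpha>,F)\<in>Q. (+) \<alpha> ` exps F)"
    proof (cases "t < t0")
      case True
      obtain \<alpha> F \<beta>' where *: "(\<alpha>,F) \<in> P t" "\<beta>' \<in> exps F" "\<beta> = \<alpha> + \<beta>'"
        using bS unfolding P(3)[of t] mem_UN_orthants by blast
      have "F \<subseteq> X" using *(1) P(2)[of t] by auto
      hence "\<beta>' x = 0" using *(2) insert(2) by (auto simp: exps_def)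
      moreover have "\<gamma> y = \<alpha> y + \<beta>' y" if "y \<noteq> x" for y
        using fun_cong[OF *(3), of y] that by (simp add: \<beta>_def)
      ultimately have eq: "\<gamma> = \<alpha>(x := t) + \<beta>'" by (simp add: fun_eq_iff t_def)
      have "(\<alpha>(x := t), F) \<in> Q"
        unfolding Q_def using True *(1) by (auto intro!: bexI[of _ t] image_eqI[of _ _ "(\<alpha>, F)"])
      from mem_UN_orthantsI[OF this *(2)] show ?thesis by (subst eq)
    next
      case False
      hence "\<beta> \<in> S t0" using bS t0[of t] by simp
      then obtain \<alpha> F \<beta>' where *: "(\<alpha>,F) \<in> P t0" "\<beta>' \<in> exps F" "\<beta> = \<alpha> + \<beta>'"
        unfolding P(3)[of t0] mem_UN_orthants by blast
      have "\<gamma> y = \<alpha> y + \<beta>' y" if "y \<noteq> x" for y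
        using fun_cong[OF *(3), of y] that by (simp add: \<beta>_def)
      \<comment> \<open>The height above \<open>t0\<close> is absorbed by the free direction
        x.\<close>
      hence eq: "\<gamma> = \<alpha>(x := t0) + \<beta>'(x := t - t0)"
        using False by (simp add: fun_eq_iff t_def)
      have "(\<alpha>(x := t0), insert x F) \<in> Q"
        unfolding Q_def using *(1) by (intro UnI2 image_eqI[of _ _ "(\<alpha>, F)"]) simp_all
      moreover have "\<beta>'(x := t - t0) \<in> exps (insert x F)" using *(2) by (auto simp: exps_def)
      ultimately have "\<alpha>(x := t0) + \<beta>'(x := t - t0) \<in> (\<Union>(\<alpha>,F)\<in>Q. (+) \<alpha> ` exps F)"
        by (rule mem_UN_orthantsI)
      thus ?thesis by (subst eq)
    qed
  next
    fix \<gamma> assume "\<gamma> \<in> (\<Union>(\<alpha>,F)\<in>Q. (+) \<alpha> ` exps F)"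
    then obtain \<alpha>' F' \<beta>' where q: "(\<alpha>',F') \<in> Q" "\<beta>' \<in> exps F'" "\<gamma> = \<alpha>' + \<beta>'"
      unfolding mem_UN_orthants by blast
    from q(1) consider (a) t \<alpha> where "t < t0" "(\<alpha>,F') \<in> P t" "\<alpha>' = \<alpha>(x := t)"
      | (b) \<alpha> F where "(\<alpha>,F) \<in> P t0" "\<alpha>' = \<alpha>(x := t0)" "F' = insert x F"
      unfolding Q_def by auto
    thus "\<gamma> \<in> D"
    proof cases
      case a
      have f: "F' \<subseteq> X" using a(2) P(2)[of t] by auto
      have "\<alpha> + \<beta>' \<in> S t" using a(2) q(2) unfolding P(3)[of t] mem_UN_orthants by blast
      hence "(\<alpha> + \<beta>')(x := t) \<in> D" by (simp add: S_def)
      moreover have "\<beta>' x = 0" using q(2) f insert(2) by (auto simp: exps_def)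
      hence "(\<alpha> + \<beta>')(x := t) = \<gamma>" using q(3) a(3) by (auto simp: fun_eq_iff)
      ultimately show ?thesis by simp
    next
      case b
      have f: "F \<subseteq> X" using b(1) P(2)[of t0] by auto
      have "\<beta>'(x := 0) \<in> exps F" using q(2) b(3) by (auto simp: exps_def)
      hence "\<alpha> + \<beta>'(x := 0) \<in> S t0" using b(1) unfolding P(3)[of t0] mem_UN_orthants by blast
      hence "\<alpha> + \<beta>'(x := 0) \<in> S (t0 + \<beta>' x)" using t0[of "t0 + \<beta>' x"] by simp
      hence "(\<alpha> + \<beta>'(x := 0))(x := t0 + \<beta>' x) \<in> D" by (simp add: S_def)
      moreover have "(\<alpha> + \<beta>'(x := 0))(x := t0 + \<beta>' x) = \<gamma>"
        using q(3) b(2) by (auto simp: fun_eq_iff)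
      ultimately show ?thesis by simp
    qed
  qed
  ultimately show ?case by blast
qed

section \<open>Sequences of finite sets with eventually linear maximum\<close>

text \<open>Eventual emptiness is a separate case, since \<open>Max\<close> says nothing about the
  empty set. With it the property is stable under finite unions. Here \<open>c\<close> bounds the
  slope only; the constant term is free.\<close>

definition max_eventually_linear :: "int \<Rightarrow> (nat \<Rightarrow> int set) \<Rightarrow> bool" where
  "max_eventually_linear c V \<longleftrightarrow> (\<forall>n. finite (V n)) \<and>
     ((\<forall>\<^sub>F n in sequentially. V n = {}) \<or>
      (\<exists>a b. a \<le> c \<and> (\<forall>\<^sub>F n in sequentially. V n \<noteq> {} \<and> Max (V n) = a * int n + b)))"

lemma max_eventually_linear_empty: "max_eventually_linear c (\<lambda>n. {})"
  by (simp add: max_eventually_linear_def)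

lemma linear_functions_eventually_comparable:
  fixes a b a' b' :: int
  shows "(\<forall>\<^sub>F n in sequentially. a * int n + b \<le> a' * int n + b') \<or>
         (\<forall>\<^sub>F n in sequentially. a' * int n + b' \<le> a * int n + b)"
proof -
  have *: "\<forall>\<^sub>F n in sequentially. p * int n + q \<le> p' * int n + q'" if "p < p'" for p q p' q' :: int
  proof (rule eventually_sequentiallyI)
    fix n assume "nat \<bar>q - q'\<bar> \<le> n"
    hence "q - q' \<le> int n" by linarith
    also have "\<dots> \<le> (p' - p) * int n" using that by (simp add: mult_le_cancel_right1)
    finally show "p * int n + q \<le> p' * int n + q'" by (simp add: algebra_simps)
  qed
  consider "a < a'" | "a' < a" | "a = a'" by linarith
  thus ?thesis using * by cases (auto simp: eventually_sequentially)
qed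

lemma max_eventually_linear_cong:
  assumes V: "max_eventually_linear c V" and fin: "\<And>n. finite (W n)"
    and eq: "\<forall>\<^sub>F n in sequentially. W n = V n"
  shows "max_eventually_linear c W"
proof -
  have "(\<forall>\<^sub>F n in sequentially. P (W n) n) \<longleftrightarrow> (\<forall>\<^sub>F n in sequentially. P (V n) n)" for P
    by (rule eventually_cong[OF eq]) simp
  from this[of "\<lambda>X n. X = {}"] this[of "\<lambda>X n. X \<noteq> {} \<and> Max X = a * int n + b" for a b]
  show ?thesis using V fin unfolding max_eventually_linear_def by simp
qed

text \<open>Of two linear functions one eventually dominates, so the maximum of both is eventually
  one of them and keeps its slope.\<close>

lemma max_eventually_linear_Un:
  assumes V: "max_eventually_linear c V" and W: "max_eventually_linear c W"
  shows "max_eventually_linear c (\<lambda>n. V n \<union> W n)"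
proof -
  note d = max_eventually_linear_def
  have fin: "finite (V n)" "finite (W n)" for n using V W by (auto simp: d)
  consider "\<forall>\<^sub>F n in sequentially. V n = {}" | "\<forall>\<^sub>F n in sequentially. W n = {}"
    | a b a' b' where "a \<le> c" "\<forall>\<^sub>F n in sequentially. V n \<noteq> {} \<and> Max (V n) = a * int n + b"
      "a' \<le> c" "\<forall>\<^sub>F n in sequentially. W n \<noteq> {} \<and> Max (W n) = a' * int n + b'"
    using V W unfolding d by blast
  thus ?thesis
  proof cases
    case 1
    hence e: "\<forall>\<^sub>F n in sequentially. V n \<union> W n = W n" by (rule eventually_mono) simp
    show ?thesis
      using max_eventually_linear_cong[OF W _ e] fin by simp
  next
    case 2
    hence e: "\<forall>\<^sub>F n in sequentially. V n \<union> W n = V n" by (rule eventually_mono) simp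
    show ?thesis
      using max_eventually_linear_cong[OF V _ e] fin by simp
  next
    case 3
    have "\<forall>\<^sub>F n in sequentially. V n \<union> W n \<noteq> {} \<and>
      Max (V n \<union> W n) = max (a * int n + b) (a' * int n + b')"
      using 3(2,4) by eventually_elim (simp add: Max_Un fin)
    note M = this
    have "\<forall>\<^sub>F n in sequentially. V n \<union> W n \<noteq> {} \<and> Max (V n \<union> W n) = a * int n + b"
      if "\<forall>\<^sub>F n in sequentially. a' * int n + b' \<le> a * int n + b"
      using M that by eventually_elim (simp add: max_absorb1)
    moreover have "\<forall>\<^sub>F n in sequentially. V n \<union> W n \<noteq> {} \<and> Max (V n \<union> W n) = a' * int n + b'"
      if "\<forall>\<^sub>F n in sequentially. a * int n + b \<le> a' * int n + b'"
      using M that by eventually_elim (simp add: max_absorb2)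
    ultimately have "(\<forall>\<^sub>F n in sequentially. V n \<union> W n \<noteq> {} \<and> Max (V n \<union> W n) = a * int n + b) \<or>
       (\<forall>\<^sub>F n in sequentially. V n \<union> W n \<noteq> {} \<and> Max (V n \<union> W n) = a' * int n + b')"
      using linear_functions_eventually_comparable[of a' b' a b] by blast
    thus ?thesis using 3(1,3) fin unfolding d by blast
  qed
qed

lemma max_eventually_linear_UN:
  assumes "finite A" "\<And>x. x \<in> A \<Longrightarrow> max_eventually_linear c (V x)"
  shows "max_eventually_linear c (\<lambda>n. \<Union>x\<in>A. V x n)"
  using assms
  by induct (simp_all add: max_eventually_linear_empty max_eventually_linear_Un)

lemma max_eventually_linear_orthant:
  fixes w :: "'j \<Rightarrow> int"
  assumes F: "finite F" and w: "\<And>j. j \<in> F \<Longrightarrow> w j \<le> c"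
  shows "max_eventually_linear c (\<lambda>n. {e + (\<Sum>j\<in>F. w j * int (\<beta> j)) | \<beta>. \<beta> \<in> exps F \<and> m + sum \<beta> F = n})"
    (is "max_eventually_linear c ?V")
proof -
  have fin: "finite (?V n)" for n
  proof -
    have "finite (\<Pi>\<^sub>E j\<in>F. {..n})" using F by (simp add: finite_PiE)
    moreover have "?V n \<subseteq> (\<lambda>\<beta>. e + (\<Sum>j\<in>F. w j * int (\<beta> j))) ` (\<Pi>\<^sub>E j\<in>F. {..n})"
    proof
      fix y assume "y \<in> ?V n"
      then obtain \<beta> where b: "y = e + (\<Sum>j\<in>F. w j * int (\<beta> j))" "m + sum \<beta> F = n" by blast
      have "\<beta> j \<le> n" if "j \<in> F" for j
        using member_le_sum[OF that, of \<beta>] F b(2) by simp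
      hence "restrict \<beta> F \<in> (\<Pi>\<^sub>E j\<in>F. {..n})" by auto
      moreover have "y = e + (\<Sum>j\<in>F. w j * int (restrict \<beta> F j))" using b(1) by simp
      ultimately show "y \<in> (\<lambda>\<beta>. e + (\<Sum>j\<in>F. w j * int (\<beta> j))) ` (\<Pi>\<^sub>E j\<in>F. {..n})" by blast
    qed
    ultimately show ?thesis using finite_subset by blast
  qed
  show ?thesis
  proof (cases "F = {}")
    case True
    \<comment> \<open>With no free direction the constraint reads m = n, which fails beyond
      m.\<close>
    have "\<forall>\<^sub>F n in sequentially. ?V n = {}"
      by (rule eventually_sequentiallyI[of "Suc m"]) (simp add: True)
    thus ?thesis using fin by (simp add: max_eventually_linear_def)
  next
    case False
    obtain i where i: "i \<in> F" "\<And>j. j \<in> F \<Longrightarrow> w j \<le> w i"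
    proof -
      have "Max (w ` F) \<in> w ` F" using F False by simp
      then obtain i where "i \<in> F" "w i = Max (w ` F)" by auto
      thus ?thesis using that F by auto
    qed
    have "?V n \<noteq> {} \<and> Max (?V n) = w i * int n + (e - w i * int m)" if n: "n \<ge> m" for n
    proof -
      \<comment> \<open>The maximum is attained by spending all of n - m in the direction
        \<open>i\<close> of largest weight, which is where the slope \<open>w i\<close> comes
        from.\<close>
      define \<beta> where "\<beta> = (\<lambda>j. if j = i then n - m else 0)"
      have 1: "\<beta> \<in> exps F" using i(1) by (simp add: exps_def \<beta>_def)
      have 2: "m + sum \<beta> F = n" using F i(1) n by (simp add: \<beta>_def)
      have "(\<Sum>j\<in>F. w j * int (\<beta> j)) = (\<Sum>j\<in>F. if j = i then w i * int (n - m) else 0)"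
        by (rule sum.cong) (auto simp: \<beta>_def)
      also have "\<dots> = w i * (int n - int m)" using F i(1) n by (simp add: of_nat_diff)
      finally have "w i * int n + (e - w i * int m) \<in> ?V n"
        using 1 2 by (auto intro!: exI[of _ \<beta>] simp: algebra_simps)
      moreover have "y \<le> w i * int n + (e - w i * int m)" if y: "y \<in> ?V n" for y
      proof -
        obtain \<gamma> where g: "y = e + (\<Sum>j\<in>F. w j * int (\<gamma> j))" "m + sum \<gamma> F = n" using y by blast
        have "(\<Sum>j\<in>F. w j * int (\<gamma> j)) \<le> (\<Sum>j\<in>F. w i * int (\<gamma> j))"
          using i(2) by (intro sum_mono mult_right_mono) auto
        also have "\<dots> = w i * (int n - int m)"
        proof -
          have "int n = int m + int (sum \<gamma> F)" using g(2) by (simp flip: of_nat_add del: of_nat_sum)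
          thus ?thesis by (simp add: sum_distrib_left)
        qed
        finally show ?thesis using g(1) by (simp add: algebra_simps)
      qed
      ultimately show ?thesis using Max_eqI[OF fin] by blast
    qed
    hence "\<forall>\<^sub>F n in sequentially. ?V n \<noteq> {} \<and> Max (?V n) = w i * int n + (e - w i * int m)"
      by (rule eventually_sequentiallyI)
    thus ?thesis using fin w[OF i(1)] unfolding max_eventually_linear_def by blast
  qed
qed

theorem max_eventually_linear_downclosed:
  fixes w :: "'j \<Rightarrow> int"
  assumes X: "finite X" and D: "D \<subseteq> exps X" "\<And>\<alpha> \<beta>. \<alpha> \<in> D \<Longrightarrow> \<beta> \<le> \<alpha> \<Longrightarrow> \<beta> \<in> D"
    and w: "\<And>j. j \<in> X \<Longrightarrow> w j \<le> c"
  shows "max_eventually_linear c (\<lambda>n. {e + (\<Sum>j\<in>X. w j * int (\<alpha> j)) | \<alpha>. \<alpha> \<in> D \<and> m + sum \<alpha> X = n})"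
proof -
  have "\<exists>P. finite P \<and> (\<forall>(\<alpha>,F)\<in>P. F \<subseteq> X \<and> \<alpha> \<in> exps X) \<and> D = (\<Union>(\<alpha>,F)\<in>P. (+) \<alpha> ` exps F)"
    by (rule downclosed_decomposition[OF X D(1)]) (rule D(2))
  then obtain P where P: "finite P" "\<forall>(\<alpha>,F)\<in>P. F \<subseteq> X \<and> \<alpha> \<in> exps X"
      "D = (\<Union>(\<alpha>,F)\<in>P. (+) \<alpha> ` exps F)" by (elim exE conjE)
  define V where "V = (\<lambda>(\<alpha>,F) n. {e + (\<Sum>j\<in>X. w j * int (\<alpha> j)) + (\<Sum>j\<in>F. w j * int (\<beta> j)) | \<beta>.
      \<beta> \<in> exps F \<and> m + sum \<alpha> X + sum \<beta> F = n})"
  have sumF: "(\<Sum>j\<in>X. h j (\<beta> j)) = (\<Sum>j\<in>F. h j (\<beta> j))"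
    if "F \<subseteq> X" "\<beta> \<in> exps F" "\<And>j. h j 0 = 0" for F \<beta> and h :: "'j \<Rightarrow> nat \<Rightarrow> 'b::comm_monoid_add"
    using that by (intro sum.mono_neutral_right[OF X]) (auto simp: exps_def)
  have eqs: "e + (\<Sum>j\<in>X. w j * int ((\<alpha> + \<beta>) j)) = e + (\<Sum>j\<in>X. w j * int (\<alpha> j)) + (\<Sum>j\<in>F. w j * int (\<beta> j))"
    "m + sum (\<alpha> + \<beta>) X = m + sum \<alpha> X + sum \<beta> F" if "(\<alpha>,F) \<in> P" "\<beta> \<in> exps F" for \<alpha> \<beta> F
  proof -
    have f: "F \<subseteq> X" using P(2) that(1) by auto
    show "e + (\<Sum>j\<in>X. w j * int ((\<alpha> + \<beta>) j)) = e + (\<Sum>j\<in>X. w j * int (\<alpha> j)) + (\<Sum>j\<in>F. w j * int (\<beta> j))"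
      "m + sum (\<alpha> + \<beta>) X = m + sum \<alpha> X + sum \<beta> F"
      using sumF[OF f that(2), of "\<lambda>j n. w j * int n"] sumF[OF f that(2), of "\<lambda>j n. n"]
      by (simp_all add: algebra_simps sum.distrib)
  qed
  have "{e + (\<Sum>j\<in>X. w j * int (\<alpha> j)) | \<alpha>. \<alpha> \<in> D \<and> m + sum \<alpha> X = n} = (\<Union>p\<in>P. V p n)" (is "?L = _") for n
  proof (intro set_eqI iffI)
    fix y assume "y \<in> ?L"
    then obtain \<alpha> F \<beta> where *: "(\<alpha>,F) \<in> P" "\<beta> \<in> exps F" "m + sum (\<alpha> + \<beta>) X = n"
      "y = e + (\<Sum>j\<in>X. w j * int ((\<alpha> + \<beta>) j))"
      unfolding P(3) mem_UN_orthants by blast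
    thus "y \<in> (\<Union>p\<in>P. V p n)"
      unfolding eqs[OF *(1,2)] by (intro UN_I[of "(\<alpha>,F)"]) (auto simp: V_def)
  next
    fix y assume "y \<in> (\<Union>p\<in>P. V p n)"
    then obtain \<alpha> F \<beta> where *: "(\<alpha>,F) \<in> P" "\<beta> \<in> exps F" "m + sum \<alpha> X + sum \<beta> F = n"
      "y = e + (\<Sum>j\<in>X. w j * int (\<alpha> j)) + (\<Sum>j\<in>F. w j * int (\<beta> j))"
      by (auto simp: V_def)
    thus "y \<in> ?L" unfolding eqs[OF *(1,2), symmetric] P(3) mem_UN_orthants by blast
  qed
  moreover have "max_eventually_linear c (V p)" if "p \<in> P" for p
  proof -
    obtain \<alpha> F where pf: "p = (\<alpha>,F)" by force
    have f: "F \<subseteq> X" using P(2) that pf by auto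
    have "finite F" "\<And>j. j \<in> F \<Longrightarrow> w j \<le> c" using f finite_subset[OF f X] w by auto
    from max_eventually_linear_orthant[OF this] show ?thesis unfolding pf V_def prod.case .
  qed
  ultimately show ?thesis using max_eventually_linear_UN[OF P(1), of c V] by simp
qed

section \<open>Noetherian modules\<close>

text \<open>A module is described by a set of additive operators in place of a ring action. Scalars
  can then be adjoined one operator at a time, and the polynomial ring acting on the Rees module
  never has to be constructed.\<close>

definition op_closed :: "('n::ab_group_add \<Rightarrow> 'n) set \<Rightarrow> 'n set \<Rightarrow> bool" where
  "op_closed F N \<longleftrightarrow> 0 \<in> N \<and> (\<forall>x\<in>N. \<forall>y\<in>N. x - y \<in> N) \<and> (\<forall>f\<in>F. \<forall>x\<in>N. f x \<in> N)"

text \<open>That \<open>G\<close> generates \<open>Z\<close> is expressed by minimality: every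
  closed set that contains \<open>G\<close> contains \<open>Z\<close>.\<close>

definition op_noetherian :: "('n::ab_group_add \<Rightarrow> 'n) set \<Rightarrow> 'n set \<Rightarrow> bool" where
  "op_noetherian F N \<longleftrightarrow> (\<forall>Z. op_closed F Z \<and> Z \<subseteq> N \<longrightarrow>
     (\<exists>G. finite G \<and> G \<subseteq> Z \<and> (\<forall>Y. op_closed F Y \<and> G \<subseteq> Y \<longrightarrow> Z \<subseteq> Y)))"

lemma op_closed_zero: "op_closed F N \<Longrightarrow> 0 \<in> N"
  and op_closed_diff: "op_closed F N \<Longrightarrow> x \<in> N \<Longrightarrow> y \<in> N \<Longrightarrow> x - y \<in> N"
  and op_closed_op: "op_closed F N \<Longrightarrow> f \<in> F \<Longrightarrow> x \<in> N \<Longrightarrow> f x \<in> N"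
  by (auto simp: op_closed_def)

lemma op_closed_add:
  assumes "op_closed F N" "x \<in> N" "y \<in> N" shows "x + y \<in> N"
proof -
  have "0 - y \<in> N" using assms op_closed_zero op_closed_diff by blast
  hence "x - (0 - y) \<in> N" using assms op_closed_diff by blast
  thus ?thesis by simp
qed

lemma op_closed_sum:
  "op_closed F N \<Longrightarrow> (\<And>i. i \<in> A \<Longrightarrow> x i \<in> N) \<Longrightarrow> sum x A \<in> N"
  by (induct A rule: infinite_finite_induct) (auto simp: op_closed_zero op_closed_add)

lemma op_closed_Int: "op_closed F N \<Longrightarrow> op_closed F N' \<Longrightarrow> op_closed F (N \<inter> N')"
  by (simp add: op_closed_def)

lemma op_closed_mono: "op_closed F N \<Longrightarrow> F' \<subseteq> F \<Longrightarrow> op_closed F' N"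
  unfolding op_closed_def by blast

lemma op_noetherianE:
  assumes "op_noetherian F N" "op_closed F Z" "Z \<subseteq> N"
  obtains G where "finite G" "G \<subseteq> Z" "\<And>Y. op_closed F Y \<Longrightarrow> G \<subseteq> Y \<Longrightarrow> Z \<subseteq> Y"
proof -
  have "\<exists>G. finite G \<and> G \<subseteq> Z \<and> (\<forall>Y. op_closed F Y \<and> G \<subseteq> Y \<longrightarrow> Z \<subseteq> Y)"
    using assms unfolding op_noetherian_def by simp
  thus thesis using that by metis
qed

lemma op_noetherian_chain:
  assumes N: "op_noetherian F N" and Z: "\<And>k::nat. op_closed F (Z k)" "\<And>k. Z k \<subseteq> N"
    and mono: "\<And>k. Z k \<subseteq> Z (Suc k)"
  shows "\<exists>K. \<forall>k. Z k \<subseteq> Z K"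
proof -
  have le: "Z i \<subseteq> Z j" if "i \<le> j" for i j
    using that lift_Suc_mono_le[of Z, OF mono] by blast
  have join: "\<exists>m. x \<in> Z m \<and> y \<in> Z m" if "x \<in> Z i" "y \<in> Z j" for x y i j
    using that le[of i "max i j"] le[of j "max i j"] by auto
  define U where "U = (\<Union>k. Z k)"
  have "op_closed F U"
    unfolding op_closed_def U_def
  proof (intro conjI ballI)
    show "0 \<in> (\<Union>k. Z k)" using op_closed_zero[OF Z(1)] by blast
    show "x - y \<in> (\<Union>k. Z k)" if "x \<in> (\<Union>k. Z k)" "y \<in> (\<Union>k. Z k)" for x y
    proof -
      from that obtain i j where "x \<in> Z i" "y \<in> Z j" by auto
      then obtain m where "x \<in> Z m" "y \<in> Z m" using join by blast
      thus ?thesis using op_closed_diff[OF Z(1)] by blast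
    qed
    show "f x \<in> (\<Union>k. Z k)" if "f \<in> F" "x \<in> (\<Union>k. Z k)" for f x
      using that op_closed_op[OF Z(1)] by blast
  qed
  moreover have "U \<subseteq> N" using Z(2) by (auto simp: U_def)
  ultimately obtain G where G: "finite G" "G \<subseteq> U" "\<And>Y. op_closed F Y \<Longrightarrow> G \<subseteq> Y \<Longrightarrow> U \<subseteq> Y"
    using op_noetherianE[OF N] by blast
  have "\<exists>K. G \<subseteq> Z K"
    using G(1,2)
  proof induct
    case (insert x G)
    then obtain K i where "G \<subseteq> Z K" "x \<in> Z i" by (auto simp: U_def)
    hence "insert x G \<subseteq> Z (max K i)" using le[of K "max K i"] le[of i "max K i"] by auto
    thus ?case by blast
  qed simp
  then obtain K where "G \<subseteq> Z K" by blast
  hence "U \<subseteq> Z K" using G(3) Z(1) by blast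
  thus ?thesis by (auto simp: U_def)
qed

lemma op_closed_plus:
  assumes F: "\<And>f. f \<in> F \<Longrightarrow> additive f" and N: "op_closed F N1" "op_closed F N2"
  shows "op_closed F {a + b | a b. a \<in> N1 \<and> b \<in> N2}" (is "op_closed F ?N")
  unfolding op_closed_def
proof (intro conjI ballI)
  show "0 \<in> ?N" using N op_closed_zero by force
next
  fix x y assume "x \<in> ?N" "y \<in> ?N"
  then obtain a b a' b' where ab: "x = a + b" "y = a' + b'" "a \<in> N1" "a' \<in> N1" "b \<in> N2" "b' \<in> N2"
    by blast
  have "x - y = (a - a') + (b - b')" using ab by simp
  thus "x - y \<in> ?N" using ab N op_closed_diff by blast
next
  fix f x assume f: "f \<in> F" and "x \<in> ?N"
  then obtain a b where ab: "x = a + b" "a \<in> N1" "b \<in> N2" by blast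
  have "f x = f a + f b" using additive.add[OF F[OF f]] ab(1) by simp
  thus "f x \<in> ?N" using ab N f op_closed_op by blast
qed

text \<open>
  Hilbert's basis theorem for one operator \<open>y\<close> in place of a variable: \<open>L Z k\<close> is the set of
  leading coefficients of the elements of \<open>Z\<close> of degree at most \<open>k\<close> in \<open>y\<close>.
\<close>

lemma op_noetherian_adjoin:
  assumes F: "\<And>f. f \<in> F \<Longrightarrow> additive f" and y: "additive y"
    and comm: "\<And>f x. f \<in> F \<Longrightarrow> f (y x) = y (f x)"
    and N: "op_closed F N" "op_noetherian F N"
  shows "\<exists>N'. N \<subseteq> N' \<and> op_closed (insert y F) N' \<and> op_noetherian (insert y F) N'"
proof -
  interpret y: additive y by (rule y)
  have ypow: "additive (y ^^ k)" for k
    by (induct k) (auto simp: additive_def y.add)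
  have commpow: "f ((y ^^ k) x) = (y ^^ k) (f x)" if "f \<in> F" for f k x
    using that by (induct k) (auto simp: comm)
  \<comment> \<open>\<open>M k\<close> consists of the values of polynomial expressions in
    \<open>y\<close> of degree less than k with coefficients in \<open>N\<close>. Relations may hold
    between such expressions, so degree and leading coefficient belong to an expression and not to
    its value; this is why \<open>L\<close> below asks for some suitable lower part
    \<open>b\<close>.\<close>
  define M where "M = rec_nat {0} (\<lambda>k M. {b + (y ^^ k) a | b a. b \<in> M \<and> a \<in> N})"
  have M0: "M 0 = {0}" by (simp add: M_def)
  have MS: "M (Suc k) = {b + (y ^^ k) a | b a. b \<in> M k \<and> a \<in> N}" for k by (simp add: M_def)
  have powN: "op_closed F ((y ^^ k) ` N)" for k
    unfolding op_closed_def
  proof (intro conjI ballI)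
    show "0 \<in> (y ^^ k) ` N"
      using op_closed_zero[OF N(1)] additive.zero[OF ypow] by (metis image_eqI)
    show "a - b \<in> (y ^^ k) ` N" if ab: "a \<in> (y ^^ k) ` N" "b \<in> (y ^^ k) ` N" for a b
    proof -
      obtain a' b' where "a = (y ^^ k) a'" "b = (y ^^ k) b'" "a' \<in> N" "b' \<in> N" using ab by blast
      thus ?thesis using op_closed_diff[OF N(1)] additive.diff[OF ypow, of k a' b'] by force
    qed
    show "f a \<in> (y ^^ k) ` N" if f: "f \<in> F" and a: "a \<in> (y ^^ k) ` N" for f a
    proof -
      obtain a' where "a = (y ^^ k) a'" "a' \<in> N" using a by blast
      thus ?thesis using op_closed_op[OF N(1) f] commpow[OF f] by auto
    qed
  qed
  have Mc: "op_closed F (M k)" for k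
  proof (induct k)
    case 0
    show ?case unfolding M0 using additive.zero[OF F] by (auto simp: op_closed_def)
  next
    case (Suc k)
    have "M (Suc k) = {b + a | b a. b \<in> M k \<and> a \<in> (y ^^ k) ` N}" unfolding MS by blast
    thus ?case using op_closed_plus[OF F Suc powN] by simp
  qed
  have Mmono: "M k \<subseteq> M (Suc k)" for k
  proof
    fix b assume "b \<in> M k"
    moreover have "b = b + (y ^^ k) 0" using additive.zero[OF ypow] by simp
    ultimately show "b \<in> M (Suc k)" unfolding MS using op_closed_zero[OF N(1)] by blast
  qed
  have Mle: "M i \<subseteq> M j" if "i \<le> j" for i j
    using that lift_Suc_mono_le[of M, OF Mmono] by blast
  have yM: "y b \<in> M (Suc k)" if "b \<in> M k" for k b
    using that
  proof (induct k arbitrary: b)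
    case 0
    thus ?case using op_closed_zero[OF Mc] by (simp add: M0 y.zero)
  next
    case (Suc k)
    then obtain b' a where b: "b = b' + (y ^^ k) a" "b' \<in> M k" "a \<in> N" unfolding MS by blast
    have "y b = y b' + (y ^^ Suc k) a" using b by (simp add: y.add)
    thus ?case unfolding MS[of "Suc k"] using Suc(1) b by blast
  qed
  define N' where "N' = (\<Union>k. M k)"
  have "N \<subseteq> M 1" by (simp add: MS M0)
  hence NN': "N \<subseteq> N'" by (auto simp: N'_def)
  have N'c: "op_closed (insert y F) N'"
    unfolding op_closed_def
  proof (intro conjI ballI)
    show "0 \<in> N'" using op_closed_zero[OF Mc] by (auto simp: N'_def)
  next
    fix a b assume "a \<in> N'" "b \<in> N'"
    then obtain i j where "a \<in> M i" "b \<in> M j" by (auto simp: N'_def)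
    hence "a \<in> M (max i j)" "b \<in> M (max i j)" using Mle[of i "max i j"] Mle[of j "max i j"] by auto
    thus "a - b \<in> N'" using op_closed_diff[OF Mc] by (auto simp: N'_def)
  next
    fix f a assume "f \<in> insert y F" "a \<in> N'"
    thus "f a \<in> N'" using yM op_closed_op[OF Mc] unfolding N'_def by blast
  qed
  define L where "L Z k = {a \<in> N. \<exists>b\<in>M k. b + (y ^^ k) a \<in> Z}" for Z k
  have L: "op_closed F (L Z k)" if Z: "op_closed F Z" for Z k
    unfolding op_closed_def
  proof (intro conjI ballI)
    show "0 \<in> L Z k"
      using op_closed_zero[OF N(1)] op_closed_zero[OF Mc, of k] op_closed_zero[OF Z] additive.zero[OF ypow]
      unfolding L_def by force
  next
    fix a a' assume "a \<in> L Z k" "a' \<in> L Z k"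
    then obtain b b' where b: "b \<in> M k" "b' \<in> M k" "b + (y ^^ k) a \<in> Z" "b' + (y ^^ k) a' \<in> Z"
      "a \<in> N" "a' \<in> N" unfolding L_def by blast
    have "(b + (y ^^ k) a) - (b' + (y ^^ k) a') \<in> Z" using b Z op_closed_diff by blast
    moreover have "(b + (y ^^ k) a) - (b' + (y ^^ k) a') = (b - b') + (y ^^ k) (a - a')"
      by (simp add: additive.diff[OF ypow])
    moreover have "b - b' \<in> M k" "a - a' \<in> N" using b Mc N op_closed_diff by blast+
    ultimately show "a - a' \<in> L Z k" unfolding L_def by auto
  next
    fix f a assume f: "f \<in> F" and "a \<in> L Z k"
    then obtain b where b: "b \<in> M k" "b + (y ^^ k) a \<in> Z" "a \<in> N" unfolding L_def by blast
    have "f (b + (y ^^ k) a) \<in> Z" using b f Z op_closed_op by blast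
    hence "f b + (y ^^ k) (f a) \<in> Z" using additive.add[OF F[OF f]] commpow[OF f] by simp
    moreover have "f b \<in> M k" "f a \<in> N" using b f Mc N op_closed_op by blast+
    ultimately show "f a \<in> L Z k" unfolding L_def by blast
  qed
  have Lmono: "L Z k \<subseteq> L Z (Suc k)" if Z: "op_closed (insert y F) Z" for Z k
  proof
    fix a assume "a \<in> L Z k"
    then obtain b where b: "b \<in> M k" "b + (y ^^ k) a \<in> Z" "a \<in> N" unfolding L_def by blast
    have "y (b + (y ^^ k) a) \<in> Z" using b Z op_closed_op by blast
    hence "y b + (y ^^ Suc k) a \<in> Z" by (simp add: y.add)
    thus "a \<in> L Z (Suc k)" unfolding L_def using yM b by blast
  qed
  have "op_noetherian (insert y F) N'"
    unfolding op_noetherian_def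
  proof (intro allI impI, elim conjE)
    fix Z assume Z: "op_closed (insert y F) Z" "Z \<subseteq> N'"
    have ZF: "op_closed F Z" using op_closed_mono[OF Z(1)] by blast
    have LN: "L Z k \<subseteq> N" for k by (auto simp: L_def)
    obtain K where K: "\<And>k. L Z k \<subseteq> L Z K"
      using op_noetherian_chain[of F N "L Z", OF N(2) L[OF ZF] LN Lmono[OF Z(1)]] by blast
    have "\<exists>G. finite G \<and> G \<subseteq> L Z k \<and> (\<forall>Y. op_closed F Y \<and> G \<subseteq> Y \<longrightarrow> L Z k \<subseteq> Y)" for k
      using N(2) L[OF ZF, of k] LN[of k] unfolding op_noetherian_def by simp
    then obtain H where H: "\<And>k. finite (H k)" "\<And>k. H k \<subseteq> L Z k"
      "\<And>k Y. op_closed F Y \<Longrightarrow> H k \<subseteq> Y \<Longrightarrow> L Z k \<subseteq> Y" by metis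
    have "\<forall>k. \<forall>a\<in>H k. \<exists>b. b \<in> M k \<and> b + (y ^^ k) a \<in> Z" using H(2) by (auto simp: L_def)
    then obtain h where h: "\<And>k a. a \<in> H k \<Longrightarrow> h k a \<in> M k \<and> h k a + (y ^^ k) a \<in> Z" by metis
    \<comment> \<open>For each k up to the stable index \<open>K\<close>, elements of
      \<open>Z\<close> are chosen whose leading coefficients generate \<open>L Z k\<close>.\<close>
    define G where "G = (\<Union>k\<le>K. (\<lambda>a. h k a + (y ^^ k) a) ` H k)"
    have "Z \<subseteq> Y" if Y: "op_closed (insert y F) Y" "G \<subseteq> Y" for Y
    proof -
      have YF: "op_closed F Y" using op_closed_mono[OF Y(1)] by blast
      have YZ: "op_closed (insert y F) (Y \<inter> Z)" "op_closed F (Y \<inter> Z)"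
        using op_closed_Int Y Z YF ZF by blast+
      have LL: "L Z k \<subseteq> L (Y \<inter> Z) k" if k: "k \<le> K" for k
      proof (rule H(3)[OF L[OF YZ(2)]])
        show "H k \<subseteq> L (Y \<inter> Z) k"
        proof
          fix a assume a: "a \<in> H k"
          have "h k a + (y ^^ k) a \<in> G" unfolding G_def using a k by blast
          thus "a \<in> L (Y \<inter> Z) k" using h[OF a] Y(2) a H(2) unfolding L_def by blast
        qed
      qed
      \<comment> \<open>Multiplication by \<open>y\<close> transports leading coefficients upwards,
        so beyond \<open>K\<close>, where \<open>L Z k\<close> has stopped growing, those obtained
        at \<open>K\<close> are enough.\<close>
      have "L (Y \<inter> Z) K \<subseteq> L (Y \<inter> Z) k" if "K \<le> k" for k
        using that lift_Suc_mono_le[of "L (Y \<inter> Z)", OF Lmono[OF YZ(1)]] by blast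
      hence LY: "L Z k \<subseteq> L (Y \<inter> Z) k" for k
    proof (cases "k \<le> K")
      case False
      hence "L Z k \<subseteq> L (Y \<inter> Z) K" "K \<le> k" using LL[of K] K[of k] by auto
      thus ?thesis using \<open>\<And>k. K \<le> k \<Longrightarrow> L (Y \<inter> Z) K \<subseteq> L (Y \<inter> Z) k\<close> by blast
    qed (rule LL)
      \<comment> \<open>Induction on the degree: subtracting an element of
        \<open>Y \<inter> Z\<close> with the same leading coefficient leaves an element of
        \<open>Z\<close> of lower degree.\<close>
      have "Z \<inter> M k \<subseteq> Y" for k
      proof (induct k)
        case 0
        show ?case using op_closed_zero[OF Y(1)] by (auto simp: M0)
      next
        case (Suc k)
        show ?case
        proof
          fix z assume z: "z \<in> Z \<inter> M (Suc k)"
          then obtain b a where ba: "z = b + (y ^^ k) a" "b \<in> M k" "a \<in> N" unfolding MS by blast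
          hence "a \<in> L Z k" using z unfolding L_def by blast
          hence "a \<in> L (Y \<inter> Z) k" using LY by blast
          then obtain b' where b': "b' \<in> M k" "b' + (y ^^ k) a \<in> Y \<inter> Z" unfolding L_def by blast
          have 1: "z - (b' + (y ^^ k) a) \<in> Z" using z b' op_closed_diff[OF Z(1)] by blast
          have "b - b' \<in> M k" using ba b' op_closed_diff[OF Mc] by blast
          moreover have "z - (b' + (y ^^ k) a) = b - b'" using ba by simp
          ultimately have "z - (b' + (y ^^ k) a) \<in> Z \<inter> M k" using 1 by (simp only: Int_iff)
          hence "z - (b' + (y ^^ k) a) \<in> Y" using Suc by blast
          hence "(z - (b' + (y ^^ k) a)) + (b' + (y ^^ k) a) \<in> Y"
            using b' op_closed_add[OF Y(1)] by blast
          thus "z \<in> Y" by simp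
        qed
      qed
      thus ?thesis using Z(2) unfolding N'_def by blast
    qed
    moreover have "finite G" "G \<subseteq> Z" using H(1) h by (auto simp: G_def)
    ultimately show "\<exists>G. finite G \<and> G \<subseteq> Z \<and> (\<forall>Y. op_closed (insert y F) Y \<and> G \<subseteq> Y \<longrightarrow> Z \<subseteq> Y)"
      by blast
  qed
  thus ?thesis using NN' N'c by blast
qed

lemma op_noetherian_adjoin_finite:
  assumes "finite Ys"
    and "\<And>f. f \<in> F \<union> Ys \<Longrightarrow> additive f"
    and "\<And>f y x. f \<in> F \<union> Ys \<Longrightarrow> y \<in> Ys \<Longrightarrow> f (y x) = y (f x)"
    and "op_closed F N" "op_noetherian F N"
  shows "\<exists>N'. N \<subseteq> N' \<and> op_closed (F \<union> Ys) N' \<and> op_noetherian (F \<union> Ys) N'"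
  using assms
proof induct
  case empty
  thus ?case by (intro exI[of _ N]) simp
next
  case (insert y Ys)
  have "\<exists>N'. N \<subseteq> N' \<and> op_closed (F \<union> Ys) N' \<and> op_noetherian (F \<union> Ys) N'"
    by (rule insert(3)) (use insert(4-7) in auto)
  then obtain N1 where N1: "N \<subseteq> N1" "op_closed (F \<union> Ys) N1" "op_noetherian (F \<union> Ys) N1" by blast
  have "\<exists>N'. N1 \<subseteq> N' \<and> op_closed (insert y (F \<union> Ys)) N' \<and> op_noetherian (insert y (F \<union> Ys)) N'"
    by (rule op_noetherian_adjoin) (use insert(4,5) N1 in auto)
  thus ?case using N1(1) by auto
qed

section \<open>Polynomial rings as operators and Hilbert's basis theorem\<close>

definition Const :: "'a::field \<Rightarrow> ('v, 'a) mpoly" where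
  "Const a = single 0 a"

definition Var :: "'v \<Rightarrow> ('v, 'a::field) mpoly" where
  "Var v = single (single v 1) 1"

lemma Const_mult: "Const (a * b) = Const a * Const b"
  by (simp add: Const_def mult_single)

lemma Const_add: "Const (a + b) = Const a + Const b"
  by (simp add: Const_def single_add)

lemma Const_one [simp]: "Const 1 = 1"
  by (simp add: Const_def)

lemma Const_zero [simp]: "Const 0 = 0"
  by (simp add: Const_def)

lemma poly_mapping_sum_singles: "p = (\<Sum>m\<in>Poly_Mapping.keys p. single m (lookup p m))"
  by (rule poly_mapping_eqI) (simp add: lookup_sum lookup_single when_def in_keys_iff)

text \<open>Constants and variables generate the ring; monomials are reached by induction on the
  total degree.\<close>

lemma mpoly_induct [case_names const var add mult]:
  fixes p :: "('v::finite, 'a::field) mpoly"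
  assumes const: "\<And>a. P (Const a)" and var: "\<And>v. P (Var v)"
    and add: "\<And>p q. P p \<Longrightarrow> P q \<Longrightarrow> P (p + q)" and mult: "\<And>p q. P p \<Longrightarrow> P q \<Longrightarrow> P (p * q)"
  shows "P p"
proof -
  have mono: "P (single m a)" for m a
  proof (induct "\<Sum>v\<in>UNIV. lookup m v" arbitrary: m a)
    case 0
    hence "m = 0" by (intro poly_mapping_eqI) simp
    thus ?case using const by (simp add: Const_def)
  next
    case (Suc n)
    have "\<exists>v. lookup m v \<noteq> 0"
    proof (rule ccontr)
      assume "\<not> ?thesis"
      hence "(\<Sum>v\<in>UNIV. lookup m v) = 0" by simp
      with Suc(2) show False by simp
    qed
    then obtain v where v: "lookup m v \<noteq> 0" by blast
    define m' where "m' = m - single v 1"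
    have m: "m = m' + single v 1"
      by (rule poly_mapping_eqI) (use v in \<open>auto simp: m'_def lookup_add lookup_minus lookup_single when_def\<close>)
    have "(\<Sum>v\<in>UNIV. lookup m v) = (\<Sum>v\<in>UNIV. lookup m' v) + 1"
      by (subst m) (simp add: lookup_add lookup_single sum.distrib when_def)
    hence "P (single m' a)" using Suc by simp
    hence "P (single m' a * Var v)" using mult var by blast
    moreover have "single m' a * Var v = single m a"
      by (simp add: Var_def mult_single m)
    ultimately show ?case by simp
  qed
  have "P (\<Sum>m\<in>A. single m (lookup p m))" if "finite A" for A
    using that
  proof induct
    case empty
    show ?case using const[of 0] by simp
  next
    case (insert m A)
    thus ?case using mono add by simp
  qed
  from this[OF finite_keys] show ?thesis by (subst poly_mapping_sum_singles)
qed

text \<open>The scalars are split into constants, over which the base case is linear algebra, and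
  variables, which are adjoined afterwards.\<close>

definition const_ops :: "(('v, 'a::field) mpoly \<Rightarrow> 'n \<Rightarrow> 'n) \<Rightarrow> ('n \<Rightarrow> 'n) set" where
  "const_ops s = range (\<lambda>a. s (Const a))"

definition var_ops :: "(('v, 'a::field) mpoly \<Rightarrow> 'n \<Rightarrow> 'n) \<Rightarrow> ('n \<Rightarrow> 'n) set" where
  "var_ops s = range (\<lambda>v. s (Var v))"

locale mpoly_module = module s for s :: "('v::finite, 'a::field) mpoly \<Rightarrow> 'n::ab_group_add \<Rightarrow> 'n"
begin

lemma additive_scale: "additive (s p)"
  by (simp add: additive_def scale_right_distrib)

lemma scale_swap: "s p (s q x) = s q (s p x)"
  by (simp add: mult.commute)

lemma op_closed_iff_subspace: "op_closed (const_ops s \<union> var_ops s) N \<longleftrightarrow> subspace N"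
proof
  assume N: "op_closed (const_ops s \<union> var_ops s) N"
  have "\<forall>x\<in>N. s p x \<in> N" for p
  proof (induct p rule: mpoly_induct)
    case (const a)
    show ?case using op_closed_op[OF N, of "s (Const a)"] by (auto simp: const_ops_def)
  next
    case (var v)
    show ?case using op_closed_op[OF N, of "s (Var v)"] by (auto simp: var_ops_def)
  next
    case (add p q)
    thus ?case using op_closed_add[OF N] by (simp add: scale_left_distrib)
  next
    case (mult p q)
    thus ?case by (simp flip: scale_scale)
  qed
  thus "subspace N" using op_closed_zero[OF N] op_closed_add[OF N] by (intro subspaceI) auto
next
  assume "subspace N"
  thus "op_closed (const_ops s \<union> var_ops s) N"
    by (auto simp: op_closed_def const_ops_def var_ops_def subspace_0 subspace_diff subspace_scale)
qed

text \<open>Over the constants alone the module is a vector space, and a subspace of a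
  finite-dimensional space has a finite basis.\<close>

lemma op_noetherian_const_span:
  assumes "finite B"
  shows "\<exists>N. B \<subseteq> N \<and> op_closed (const_ops s) N \<and> op_noetherian (const_ops s) N"
proof -
  interpret V: vector_space "\<lambda>a. s (Const a)"
    by unfold_locales (simp_all add: Const_add Const_mult scale_left_distrib scale_right_distrib)
  have closed: "op_closed (const_ops s) Y \<longleftrightarrow> V.subspace Y" for Y
  proof
    assume Y: "op_closed (const_ops s) Y"
    show "V.subspace Y"
      using op_closed_zero[OF Y] op_closed_add[OF Y] op_closed_op[OF Y]
      by (intro V.subspaceI) (auto simp: const_ops_def)
  next
    assume "V.subspace Y"
    thus "op_closed (const_ops s) Y"
      by (auto simp: op_closed_def const_ops_def V.subspace_0 V.subspace_diff V.subspace_scale)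
  qed
  have "op_noetherian (const_ops s) (V.span B)"
    unfolding op_noetherian_def closed
  proof (intro allI impI, elim conjE)
    fix Z assume Z: "V.subspace Z" "Z \<subseteq> V.span B"
    obtain G where G: "G \<subseteq> Z" "V.independent G" "Z \<subseteq> V.span G"
      using V.maximal_independent_subset by blast
    have "finite G" using V.independent_span_bound[OF assms G(2)] G(1) Z(2) by blast
    moreover have "Z \<subseteq> Y" if "V.subspace Y" "G \<subseteq> Y" for Y
      using V.span_minimal[OF that(2,1)] G(3) by blast
    ultimately show "\<exists>G. finite G \<and> G \<subseteq> Z \<and> (\<forall>Y. V.subspace Y \<and> G \<subseteq> Y \<longrightarrow> Z \<subseteq> Y)"
      using G(1) by blast
  qed
  thus ?thesis using V.span_superset V.subspace_span closed by blast
qed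

text \<open>The variables are adjoined to the finite-dimensional space spanned by \<open>B\<close>
  over the constants. The result is Noetherian and closed under all scalars, hence contains
  \<open>span B\<close>.\<close>

theorem submodule_finitely_generated:
  assumes "finite B" "N \<subseteq> span B" "subspace N"
  shows "\<exists>G. finite G \<and> span G = N"
proof -
  obtain N0 where N0: "B \<subseteq> N0" "op_closed (const_ops s) N0" "op_noetherian (const_ops s) N0"
    using op_noetherian_const_span[OF assms(1)] by blast
  have "\<exists>N'. N0 \<subseteq> N' \<and> op_closed (const_ops s \<union> var_ops s) N' \<and> op_noetherian (const_ops s \<union> var_ops s) N'"
    by (rule op_noetherian_adjoin_finite[OF _ _ _ N0(2,3)])
      (auto simp: const_ops_def var_ops_def additive_scale scale_swap mult.commute)
  then obtain N1 where N1: "N0 \<subseteq> N1" "op_closed (const_ops s \<union> var_ops s) N1"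
    "op_noetherian (const_ops s \<union> var_ops s) N1" by blast
  have "span B \<subseteq> N1" using N0(1) N1(1,2) by (intro span_minimal) (auto simp: op_closed_iff_subspace)
  hence "N \<subseteq> N1" using assms(2) by blast
  moreover have "op_closed (const_ops s \<union> var_ops s) N" using assms(3) by (simp add: op_closed_iff_subspace)
  ultimately obtain G where G: "finite G" "G \<subseteq> N"
    "\<And>Y. op_closed (const_ops s \<union> var_ops s) Y \<Longrightarrow> G \<subseteq> Y \<Longrightarrow> N \<subseteq> Y"
    using op_noetherianE[OF N1(3)] by metis
  have "N \<subseteq> span G" using G(3)[of "span G"] by (simp add: op_closed_iff_subspace span_superset)
  moreover have "span G \<subseteq> N" using G(2) assms(3) by (rule span_minimal)
  ultimately show ?thesis using G(1) by blast
qed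

end

section \<open>Graded modules\<close>

sublocale graded_module \<subseteq> mpoly_module s ..

lemma mono_deg_add:
  fixes c :: "'v::finite \<Rightarrow> 'k::finite"
  shows "mono_deg c (m + m') = mono_deg c m + mono_deg c m'"
proof -
  have "axis i (int (a + b)) = (axis i (int a) + axis i (int b) :: int ^ 'k::finite)" for i a b
    by (simp add: vec_eq_iff axis_def)
  thus ?thesis by (simp add: mono_deg_def lookup_add sum.distrib)
qed

lemma mono_deg_zero [simp]:
  fixes c :: "'v::finite \<Rightarrow> 'k::finite"
  shows "mono_deg c 0 = 0"
proof -
  have z: "axis i 0 = (0 :: int ^ 'k)" for i by (simp add: vec_eq_iff axis_def)
  show ?thesis by (simp add: mono_deg_def z)
qed

lemma mono_deg_single:
  fixes c :: "'v::finite \<Rightarrow> 'k::finite"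
  shows "mono_deg c (single v 1) = axis (c v) 1"
proof -
  have z: "axis i 0 = (0 :: int ^ 'k::finite)" for i by (simp add: vec_eq_iff axis_def)
  have "mono_deg c (single v 1) = (\<Sum>w\<in>UNIV. if w = v then axis (c v) 1 else 0)"
    unfolding mono_deg_def by (rule sum.cong) (auto simp: lookup_single when_def z)
  thus ?thesis by simp
qed

lemma mono_deg_eq_zeroD:
  fixes c :: "'v::finite \<Rightarrow> 'k::finite"
  assumes "mono_deg c m = 0" shows "m = 0"
proof (rule poly_mapping_eqI)
  fix v
  have "0 = (\<Sum>w\<in>UNIV. axis (c w) (int (lookup m w)) $ c v)"
    using arg_cong[OF assms, of "\<lambda>x. x $ c v"] by (simp add: mono_deg_def)
  hence "\<forall>w\<in>UNIV. axis (c w) (int (lookup m w)) $ c v = 0"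
    by (subst sum_nonneg_eq_0_iff[symmetric]) (auto simp: axis_def)
  hence "axis (c v) (int (lookup m v)) $ c v = 0" by blast
  thus "lookup m v = lookup 0 v" by (simp add: axis_def)
qed

lemma ring_part_zero: "0 \<in> ring_part c d"
  by (simp add: ring_part_def)

lemma ring_part_diff: "p \<in> ring_part c d \<Longrightarrow> q \<in> ring_part c d \<Longrightarrow> p - q \<in> ring_part c d"
  using keys_diff[of p q] unfolding ring_part_def by blast

lemma ring_part_mult:
  assumes "p \<in> ring_part c d" "q \<in> ring_part c e" shows "p * q \<in> ring_part c (d + e)"
  using keys_mult[of p q] assms unfolding ring_part_def by (auto simp: mono_deg_add)

lemma ring_part_Const: "Const a \<in> ring_part c 0"
  by (auto simp: ring_part_def Const_def)

lemma ring_part_Var: "Var v \<in> ring_part c (axis (c v) 1)"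
  using mono_deg_single[of c v] by (simp add: ring_part_def Var_def)

text \<open>In a standard grading only the exponent 0 has degree 0. Thus a homogeneous coefficient
  outside the irrelevant ideal is a unit of the field, the fact behind every use of minimality
  below.\<close>

lemma ring_part_const_coeff:
  assumes "p \<in> ring_part c d" "lookup p 0 \<noteq> 0"
  shows "d = 0 \<and> p = Const (lookup p 0)"
proof
  have "0 \<in> Poly_Mapping.keys p" using assms(2) by (simp add: in_keys_iff)
  thus d: "d = 0" using assms(1) by (auto simp: ring_part_def)
  show "p = Const (lookup p 0)"
  proof (rule poly_mapping_eqI)
    fix m
    show "lookup p m = lookup (Const (lookup p 0)) m"
    proof (cases "m = 0")
      case False
      hence "m \<notin> Poly_Mapping.keys p" using assms(1) d mono_deg_eq_zeroD by (auto simp: ring_part_def)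
      thus ?thesis using False by (simp add: Const_def lookup_single in_keys_iff)
    qed (simp add: Const_def)
  qed
qed

section \<open>Homogeneous components and graded submodules\<close>

text \<open>The projection to degree \<open>d\<close>, made to depend on the grading alone so that
  one symbol serves the given module, the free modules and the Koszul chains.\<close>

definition hcomp :: "('d \<Rightarrow> 'm::ab_group_add set) \<Rightarrow> 'd \<Rightarrow> 'm \<Rightarrow> 'm" where
  "hcomp gr d x = (THE y. (\<forall>d. y d \<in> gr d) \<and> finite {d. y d \<noteq> 0} \<and> x = (\<Sum>d | y d \<noteq> 0. y d)) d"

text \<open>Uniqueness of the decomposition comes from additive projections: \<open>P d\<close>,
  applied to any decomposition of \<open>x\<close> into homogeneous terms, picks out its term of
  degree \<open>d\<close>.\<close>

lemma graded_moduleI: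
  assumes m: "module s"
    and z: "\<And>d. 0 \<in> gr d" and diff: "\<And>d x y. x \<in> gr d \<Longrightarrow> y \<in> gr d \<Longrightarrow> x - y \<in> gr d"
    and scale: "\<And>p d x e. p \<in> ring_part c d \<Longrightarrow> x \<in> gr e \<Longrightarrow> s p x \<in> gr (d + e)"
    and P: "\<And>d x. P d x \<in> gr d" "\<And>x. finite {d. P d x \<noteq> 0}" "\<And>x. x = (\<Sum>d | P d x \<noteq> 0. P d x)"
    and Padd: "\<And>d x y. P d (x + y) = P d x + P d y"
    and Phom: "\<And>d e x. x \<in> gr e \<Longrightarrow> P d x = (if d = e then x else 0)"
  shows "graded_module s c gr"
proof (intro graded_module.intro graded_module_axioms.intro m z diff scale)
  fix x
  show "\<exists>!y. (\<forall>d. y d \<in> gr d) \<and> finite {d. y d \<noteq> 0} \<and> x = (\<Sum>d | y d \<noteq> 0. y d)"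
  proof (rule ex1I)
    show "(\<forall>d. P d x \<in> gr d) \<and> finite {d. P d x \<noteq> 0} \<and> x = (\<Sum>d | P d x \<noteq> 0. P d x)"
      using P by blast
  next
    fix y assume y: "(\<forall>d. y d \<in> gr d) \<and> finite {d. y d \<noteq> 0} \<and> x = (\<Sum>d | y d \<noteq> 0. y d)"
    show "y = (\<lambda>d. P d x)"
    proof
      fix d
      have "additive (P d)" by (simp add: additive_def Padd)
      hence "P d x = (\<Sum>e | y e \<noteq> 0. P d (y e))" using additive.sum y by metis
      also have "\<dots> = (\<Sum>e | y e \<noteq> 0. if d = e then y e else 0)"
        using y Phom by (intro sum.cong) auto
      also have "\<dots> = y d" using y by simp
      finally show "y d = P d x" by simp
    qed
  qed
qed

context graded_module
begin

lemma gr_uminus: "x \<in> gr d \<Longrightarrow> - x \<in> gr d"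
  using gr_diff[OF gr_zero] by fastforce

lemma gr_add: "x \<in> gr d \<Longrightarrow> y \<in> gr d \<Longrightarrow> x + y \<in> gr d"
  using gr_diff[of x d "- y"] gr_uminus by simp

lemma gr_sum: "(\<And>i. i \<in> A \<Longrightarrow> f i \<in> gr d) \<Longrightarrow> sum f A \<in> gr d"
  by (induct A rule: infinite_finite_induct) (auto simp: gr_zero gr_add)

lemma hcomp_props:
  "(\<forall>d. hcomp gr d x \<in> gr d) \<and> finite {d. hcomp gr d x \<noteq> 0} \<and> x = (\<Sum>d | hcomp gr d x \<noteq> 0. hcomp gr d x)"
  using theI'[OF gr_decomp[of x]] unfolding hcomp_def .

lemma hcomp_in: "hcomp gr d x \<in> gr d"
  and finite_hcomp: "finite {d. hcomp gr d x \<noteq> 0}"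
  and sum_hcomp: "(\<Sum>d | hcomp gr d x \<noteq> 0. hcomp gr d x) = x"
  using hcomp_props[of x] by auto

lemma hcomp_unique:
  assumes "\<And>d. y d \<in> gr d" "finite A" "\<And>d. d \<notin> A \<Longrightarrow> y d = 0" "x = sum y A"
  shows "hcomp gr d x = y d"
proof -
  have sub: "{d. y d \<noteq> 0} \<subseteq> A" using assms(3) by auto
  hence "finite {d. y d \<noteq> 0}" using assms(2) finite_subset by blast
  moreover have "x = (\<Sum>d | y d \<noteq> 0. y d)"
    unfolding assms(4) using sub by (intro sum.mono_neutral_right assms(2)) auto
  ultimately have "(\<forall>d. y d \<in> gr d) \<and> finite {d. y d \<noteq> 0} \<and> x = (\<Sum>d | y d \<noteq> 0. y d)"
    using assms(1) by blast
  from the1_equality[OF gr_decomp[of x], OF this] show ?thesis unfolding hcomp_def by simp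
qed

lemma sum_hcomp_superset:
  assumes "finite A" "{d. hcomp gr d x \<noteq> 0} \<subseteq> A" shows "(\<Sum>d\<in>A. hcomp gr d x) = x"
proof -
  have "(\<Sum>d\<in>A. hcomp gr d x) = (\<Sum>d | hcomp gr d x \<noteq> 0. hcomp gr d x)"
    using assms by (intro sum.mono_neutral_right) auto
  thus ?thesis by (simp add: sum_hcomp)
qed

lemma hcomp_diff: "hcomp gr d (x - y) = hcomp gr d x - hcomp gr d y"
proof -
  let ?A = "{d. hcomp gr d x \<noteq> 0} \<union> {d. hcomp gr d y \<noteq> 0}"
  have "finite ?A" using finite_hcomp by blast
  show ?thesis
  proof (rule hcomp_unique[of "\<lambda>d. hcomp gr d x - hcomp gr d y" ?A])
    show "x - y = (\<Sum>d\<in>?A. hcomp gr d x - hcomp gr d y)"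
      using sum_hcomp_superset[OF \<open>finite ?A\<close>, of x] sum_hcomp_superset[OF \<open>finite ?A\<close>, of y]
      by (simp add: sum_subtractf)
  qed (use \<open>finite ?A\<close> in \<open>auto intro!: gr_diff hcomp_in\<close>)
qed

lemma hcomp_zero [simp]: "hcomp gr d 0 = 0"
  using hcomp_diff[of d 0 0] by simp

lemma hcomp_add: "hcomp gr d (x + y) = hcomp gr d x + hcomp gr d y"
proof -
  have "hcomp gr d (x - (0 - y)) = hcomp gr d x - (0 - hcomp gr d y)" by (simp only: hcomp_diff hcomp_zero)
  thus ?thesis by simp
qed

lemma hcomp_homogeneous: "x \<in> gr e \<Longrightarrow> hcomp gr d x = (if d = e then x else 0)"
  by (rule hcomp_unique[of "\<lambda>d. if d = e then x else 0" "{e}"]) (auto simp: gr_zero)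

lemma hcomp_scale:
  assumes p: "p \<in> ring_part c e" shows "hcomp gr d (s p x) = s p (hcomp gr (d - e) x)"
proof -
  let ?A = "(\<lambda>d. d + e) ` {d. hcomp gr d x \<noteq> 0}"
  show ?thesis
  proof (rule hcomp_unique[of "\<lambda>d. s p (hcomp gr (d - e) x)" ?A])
    show "s p (hcomp gr (d - e) x) \<in> gr d" for d
      using gr_scale[OF p hcomp_in, of "d - e" x] by simp
    show "finite ?A" using finite_hcomp by blast
    show "s p (hcomp gr (d - e) x) = 0" if "d \<notin> ?A" for d
    proof -
      have "hcomp gr (d - e) x = 0" using that by (metis (mono_tags, lifting) diff_add_cancel image_eqI mem_Collect_eq)
      thus ?thesis by simp
    qed
    have "(\<Sum>d\<in>?A. s p (hcomp gr (d - e) x)) = (\<Sum>d | hcomp gr d x \<noteq> 0. s p (hcomp gr d x))"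
      by (subst sum.reindex) (auto simp: inj_on_def)
    thus "s p x = (\<Sum>d\<in>?A. s p (hcomp gr (d - e) x))"
      by (simp add: sum_hcomp flip: scale_sum_right)
  qed
qed

definition graded_submodule :: "'m set \<Rightarrow> bool" where
  "graded_submodule N \<longleftrightarrow> subspace N \<and> (\<forall>x\<in>N. \<forall>d. hcomp gr d x \<in> N)"

text \<open>Finite generators are replaced by their finitely many nonzero components, which stay in
  \<open>N\<close> because \<open>N\<close> is graded.\<close>

lemma graded_submodule_finitely_generated:
  assumes N: "graded_submodule N" and fg: "finite B" "N \<subseteq> span B"
  shows "\<exists>H. finite H \<and> span H = N \<and> (\<forall>x\<in>H. \<exists>d. x \<in> gr d)"
proof -
  have sub: "subspace N" and comp: "\<And>x d. x \<in> N \<Longrightarrow> hcomp gr d x \<in> N"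
    using N by (auto simp: graded_submodule_def)
  obtain G where G: "finite G" "span G = N" using submodule_finitely_generated[OF fg sub] by blast
  define H where "H = (\<Union>x\<in>G. (\<lambda>d. hcomp gr d x) ` {d. hcomp gr d x \<noteq> 0})"
  have "finite H" using G(1) finite_hcomp by (simp add: H_def)
  moreover have "\<forall>x\<in>H. \<exists>d. x \<in> gr d" using hcomp_in by (auto simp: H_def)
  moreover have "H \<subseteq> N" using comp G(2) span_base by (auto simp: H_def)
  hence "span H \<subseteq> N" using sub span_minimal by blast
  moreover have "x \<in> span H" if "x \<in> G" for x
  proof -
    have "(\<Sum>d | hcomp gr d x \<noteq> 0. hcomp gr d x) \<in> span H"
      using that by (intro span_sum span_base) (auto simp: H_def)
    thus ?thesis by (simp add: sum_hcomp)
  qed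
  hence "N \<subseteq> span H" using G(2) span_minimal[of G "span H"] by blast
  ultimately show ?thesis by blast
qed

end

text \<open>Homogeneity of \<epsilon> is asked only on a subset \<open>N\<close> stable under
  components, because the maps of a resolution are controlled only on the free modules of finite
  rank and not on their whole ambient type.\<close>

lemma hcomp_graded_hom:
  assumes M: "graded_module s1 c gr1" and M': "graded_module s2 c gr2"
    and \<epsilon>: "additive \<epsilon>" and N: "\<And>x d. x \<in> N \<Longrightarrow> hcomp gr1 d x \<in> N"
    and deg: "\<And>x d. x \<in> N \<Longrightarrow> x \<in> gr1 d \<Longrightarrow> \<epsilon> x \<in> gr2 d" and x: "x \<in> N"
  shows "hcomp gr2 d (\<epsilon> x) = \<epsilon> (hcomp gr1 d x)"
proof -
  interpret M: graded_module s1 c gr1 by (rule M)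
  interpret M': graded_module s2 c gr2 by (rule M')
  let ?A = "{d. hcomp gr1 d x \<noteq> 0}"
  show ?thesis
  proof (rule M'.hcomp_unique[of "\<lambda>d. \<epsilon> (hcomp gr1 d x)" ?A])
    show "\<epsilon> (hcomp gr1 d x) \<in> gr2 d" for d using deg N x M.hcomp_in by blast
    show "finite ?A" by (rule M.finite_hcomp)
    show "\<epsilon> (hcomp gr1 d x) = 0" if "d \<notin> ?A" for d using that additive.zero[OF \<epsilon>] by simp
    show "\<epsilon> x = (\<Sum>d\<in>?A. \<epsilon> (hcomp gr1 d x))"
      by (simp add: M.sum_hcomp flip: additive.sum[OF \<epsilon>])
  qed
qed

section \<open>Gradings on free modules and on modules of functions\<close>

text \<open>The grading of the ambient type, with a shift for every index and no bound on the rank: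
  the locale \<open>graded_module\<close> concerns whole types, and the module of rank r becomes a
  graded submodule.\<close>

definition free_grading ::
  "('v::finite \<Rightarrow> 'k::finite) \<Rightarrow> (nat \<Rightarrow> int ^ 'k) \<Rightarrow> int ^ 'k \<Rightarrow> ('v, 'a::field) free set" where
  "free_grading c b d = {f. \<forall>j. lookup f j \<in> ring_part c (d - b j)}"

lemma free_part_eq: "free_part c r b d = free_module r \<inter> free_grading c b d"
proof (intro set_eqI)
  fix f :: "('a, 'b) free"
  have "lookup f j \<in> ring_part c (d - b j)" if "f \<in> free_module r" "\<not> j < r" for j
  proof -
    have "j \<notin> Poly_Mapping.keys f" using that by (auto simp: free_module_def)
    thus ?thesis by (simp add: in_keys_iff ring_part_zero)
  qed
  thus "f \<in> free_part c r b d \<longleftrightarrow> f \<in> free_module r \<inter> free_grading c b d"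
    unfolding free_part_def free_grading_def by blast
qed

text \<open>The component of degree d keeps exactly the terms x^m e_j with
  \<open>mono_deg c m + b j = d\<close>; the second claim records this on coefficients.\<close>

lemma graded_module_free:
  fixes c :: "'v::finite \<Rightarrow> 'k::finite"
  shows "graded_module (free_scale :: ('v, 'a::field) mpoly \<Rightarrow> _) c (free_grading c b)" (is ?gm)
    and "lookup (lookup (hcomp (free_grading c b) d f) j) m =
      (lookup (lookup (f :: ('v, 'a) free) j) m when mono_deg c m + b j = d)"
proof -
  define part where "part e p = Poly_Mapping.mapp (\<lambda>m a. a when mono_deg c m = e) p"
    for e and p :: "('v, 'a) mpoly"
  have lp: "lookup (part e p) m = (lookup p m when mono_deg c m = e)" for e p m
    by (auto simp: part_def lookup_mapp when_def in_keys_iff)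
  define P where "P d f = Poly_Mapping.mapp (\<lambda>j p. part (d - b j) p) f" for d and f :: "('v, 'a) free"
  have lP: "lookup (P d f) j = part (d - b j) (lookup f j)" for d f j
  proof (cases "j \<in> Poly_Mapping.keys f")
    case False
    moreover have "part e 0 = 0" for e by (rule poly_mapping_eqI) (simp add: lp)
    ultimately show ?thesis by (simp add: P_def lookup_mapp in_keys_iff)
  qed (simp add: P_def lookup_mapp)
  have llP: "lookup (lookup (P d f) j) m =
      (lookup (lookup f j) m when mono_deg c m + b j = d)" for d f j m
    by (auto simp: lP lp when_def algebra_simps)
  have free_eqI: "f = g" if "\<And>j m. lookup (lookup f j) m = lookup (lookup g j) m"
    for f g :: "('v, 'a) free"
    by (intro poly_mapping_eqI that)
  have memI: "f \<in> free_grading c b d \<longleftrightarrow>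
     (\<forall>j m. lookup (lookup f j) m \<noteq> 0 \<longrightarrow> mono_deg c m + b j = d)" for f :: "('v, 'a) free" and d
    unfolding free_grading_def ring_part_def by (auto simp: in_keys_iff algebra_simps)
  have supp: "{d. P d f \<noteq> 0} \<subseteq>
      (\<lambda>(j,m). mono_deg c m + b j) ` (SIGMA j:Poly_Mapping.keys f. Poly_Mapping.keys (lookup f j))" for f
  proof
    fix d assume "d \<in> {d. P d f \<noteq> 0}"
    then obtain j m where "lookup (lookup (P d f) j) m \<noteq> 0"
      using free_eqI[of "P d f" 0] by auto
    hence *: "lookup (lookup f j) m \<noteq> 0" "mono_deg c m + b j = d"
      by (auto simp: llP when_def split: if_splits)
    hence "lookup f j \<noteq> 0" by auto
    with * show "d \<in> (\<lambda>(j,m). mono_deg c m + b j) ` (SIGMA j:Poly_Mapping.keys f. Poly_Mapping.keys (lookup f j))"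
      by (intro image_eqI[of _ _ "(j,m)"]) (auto simp: in_keys_iff)
  qed
  have fin: "finite {d. P d f \<noteq> 0}" for f
    by (rule finite_subset[OF supp]) simp
  have PP: "P d x \<in> free_grading c b d" for d x by (auto simp: memI llP when_def)
  have Psum: "x = (\<Sum>d | P d x \<noteq> 0. P d x)" for x
  proof (rule free_eqI)
    fix j m
    let ?d = "mono_deg c m + b j"
    have "lookup (lookup (\<Sum>d | P d x \<noteq> 0. P d x) j) m =
        (\<Sum>d | P d x \<noteq> 0. if ?d = d then lookup (lookup x j) m else 0)"
      by (simp add: lookup_sum llP when_def)
    also have "\<dots> = (if P ?d x \<noteq> 0 then lookup (lookup x j) m else 0)"
      using fin by simp
    also have "\<dots> = lookup (lookup x j) m"
    proof (cases "P ?d x = 0")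
      case True
      hence "lookup (lookup (P ?d x) j) m = 0" by simp
      thus ?thesis unfolding llP using True by simp
    qed simp
    finally show "lookup (lookup x j) m =
      lookup (lookup (\<Sum>d | P d x \<noteq> 0. P d x) j) m" by simp
  qed
  show gm: ?gm
  proof (rule graded_moduleI[where P = P])
    show "module (free_scale :: ('v, 'a) mpoly \<Rightarrow> _)" by (rule module_free_scale)
    show "(0 :: ('v, 'a) free) \<in> free_grading c b d" for d by (simp add: memI)
    show "x - y \<in> free_grading c b d" if "x \<in> free_grading c b d" "y \<in> free_grading c b d" for d and x y :: "('v, 'a) free"
      using that unfolding free_grading_def by (auto simp: lookup_minus intro: ring_part_diff)
    show "free_scale p x \<in> free_grading c b (d + e)" if "p \<in> ring_part c d" "x \<in> free_grading c b e"
      for p d e and x :: "('v, 'a) free"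
      using that ring_part_mult[of p c d] unfolding free_grading_def
      by (auto simp: lookup_free_scale add_diff_eq[symmetric])
    show "P d x \<in> free_grading c b d" for d x by (rule PP)
    show "finite {d. P d x \<noteq> 0}" for x by (rule fin)
    show "x = (\<Sum>d | P d x \<noteq> 0. P d x)" for x by (rule Psum)
    show "P d (x + y) = P d x + P d y" for d x y
      by (rule free_eqI) (simp add: llP lookup_add when_add_distrib)
    show "P d x = (if d = e then x else 0)" if "x \<in> free_grading c b e" for d e x
      using that by (intro free_eqI) (auto simp: llP memI when_def)
  qed
  interpret F: graded_module "free_scale :: ('v, 'a) mpoly \<Rightarrow> _" c "free_grading c b" by (rule gm)
  have "hcomp (free_grading c b) d f = P d f"
    by (rule F.hcomp_unique[of "\<lambda>d. P d f" "{d. P d f \<noteq> 0}"]) (use PP fin Psum in auto)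
  thus "lookup (lookup (hcomp (free_grading c b) d f) j) m =
      (lookup (lookup f j) m when mono_deg c m + b j = d)"
    by (simp only: llP)
qed

lemma sum_fun_apply: "(\<Sum>i\<in>I. f i) x = (\<Sum>i\<in>I. f i x)"
  by (induct I rule: infinite_finite_induct) simp_all

text \<open>A finite direct sum of copies of the module, the copy at \<open>A\<close> shifted by
  \<open>D A\<close>. Components are taken entrywise, and finiteness of the index type leaves only
  finitely many nonzero ones.\<close>

lemma graded_module_functions:
  fixes D :: "'b::finite \<Rightarrow> int ^ 'k::finite"
  assumes "graded_module s c gr"
  shows "graded_module (\<lambda>p f A. s p (f A)) c (\<lambda>d. {f. \<forall>A. f A \<in> gr (d - D A)})" (is "graded_module ?s c ?gr")
    and "hcomp (\<lambda>d. {f. \<forall>A. f A \<in> gr (d - D A)}) d f = (\<lambda>A. hcomp gr (d - D A) (f A))"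
proof -
  interpret graded_module s c gr by (rule assms)
  define P where "P d f = (\<lambda>A. hcomp gr (d - D A) (f A))" for d and f
  have supp: "{d. P d f \<noteq> 0} \<subseteq> (\<Union>A. (\<lambda>e. e + D A) ` {e. hcomp gr e (f A) \<noteq> 0})" for f
  proof
    fix d assume "d \<in> {d. P d f \<noteq> 0}"
    then obtain A where "hcomp gr (d - D A) (f A) \<noteq> 0" by (auto simp: P_def fun_eq_iff)
    thus "d \<in> (\<Union>A. (\<lambda>e. e + D A) ` {e. hcomp gr e (f A) \<noteq> 0})"
      by (intro UN_I[of A] image_eqI[of _ _ "d - D A"]) auto
  qed
  have fin: "finite {d. P d f \<noteq> 0}" for f
    by (rule finite_subset[OF supp]) (simp add: finite_hcomp)
  have PP: "P d x \<in> {f. \<forall>A. f A \<in> gr (d - D A)}" for d x by (simp add: P_def hcomp_in)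
  have Psum: "x = (\<Sum>d | P d x \<noteq> 0. P d x)" for x
  proof
    fix A
    have sub: "{e. hcomp gr e (x A) \<noteq> 0} \<subseteq> (\<lambda>d. d - D A) ` {d. P d x \<noteq> 0}"
    proof
      fix e assume "e \<in> {e. hcomp gr e (x A) \<noteq> 0}"
      hence "P (e + D A) x A \<noteq> 0" by (simp add: P_def)
      hence "P (e + D A) x \<noteq> 0" by (metis zero_fun_apply)
      thus "e \<in> (\<lambda>d. d - D A) ` {d. P d x \<noteq> 0}"
        by (intro image_eqI[of _ _ "e + D A"]) auto
    qed
    have "(\<Sum>d | P d x \<noteq> 0. P d x) A = (\<Sum>d | P d x \<noteq> 0. hcomp gr (d - D A) (x A))"
      by (simp add: sum_fun_apply P_def)
    also have "\<dots> = (\<Sum>e\<in>(\<lambda>d. d - D A) ` {d. P d x \<noteq> 0}. hcomp gr e (x A))"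
      by (subst sum.reindex) (auto simp: inj_on_def)
    also have "\<dots> = x A" by (rule sum_hcomp_superset[OF _ sub]) (simp add: fin)
    finally show "x A = (\<Sum>d | P d x \<noteq> 0. P d x) A" by simp
  qed
  show gm: "graded_module ?s c ?gr"
  proof (rule graded_moduleI[where P = P])
    show "module (\<lambda>p f A. s p (f A))"
      by unfold_locales (auto simp: fun_eq_iff scale_right_distrib scale_left_distrib)
    show "0 \<in> {f. \<forall>A. f A \<in> gr (d - D A)}" for d by (simp add: gr_zero)
    show "x - y \<in> {f. \<forall>A. f A \<in> gr (d - D A)}"
      if "x \<in> {f. \<forall>A. f A \<in> gr (d - D A)}" "y \<in> {f. \<forall>A. f A \<in> gr (d - D A)}" for d x y
      using that by (simp add: gr_diff)
    show "(\<lambda>A. s p (x A)) \<in> {f. \<forall>A. f A \<in> gr (d + e - D A)}"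
      if "p \<in> ring_part c d" "x \<in> {f. \<forall>A. f A \<in> gr (e - D A)}" for p d x e
      using that gr_scale[of p d] by (simp add: add_diff_eq[symmetric])
    show "P d x \<in> {f. \<forall>A. f A \<in> gr (d - D A)}" for d x by (rule PP)
    show "finite {d. P d x \<noteq> 0}" for x by (rule fin)
    show "x = (\<Sum>d | P d x \<noteq> 0. P d x)" for x by (rule Psum)
    show "P d (x + y) = P d x + P d y" for d x y by (simp add: P_def hcomp_add fun_eq_iff)
    show "P d x = (if d = e then x else 0)" if "x \<in> {f. \<forall>A. f A \<in> gr (e - D A)}" for d e x
    proof
      fix A
      have "x A \<in> gr (e - D A)" using that by simp
      thus "P d x A = (if d = e then x else 0) A" by (simp add: P_def hcomp_homogeneous)
    qed
  qed
  interpret K: graded_module ?s c ?gr by (rule gm)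
  have "hcomp ?gr d f = P d f"
    by (rule K.hcomp_unique[of "\<lambda>d. P d f" "{d. P d f \<noteq> 0}"]) (use PP fin Psum in auto)
  thus "hcomp ?gr d f = (\<lambda>A. hcomp gr (d - D A) (f A))" by (simp only: P_def)
qed

section \<open>The Koszul complex\<close>

text \<open>The type of variables has no order of its own, but Koszul signs need one; an arbitrary
  injection into the naturals, fixed once, supplies it.\<close>

definition var_index :: "'v::finite \<Rightarrow> nat" where
  "var_index = (SOME f. inj f)"

lemma inj_var_index: "inj (var_index :: 'v::finite \<Rightarrow> nat)"
proof -
  obtain f :: "'v \<Rightarrow> nat" where "inj f"
    using finite_imp_inj_to_nat_seg[of "UNIV :: 'v set"] by auto
  thus ?thesis unfolding var_index_def by (rule someI[of inj])
qed

lemma var_index_eq_iff [simp]: "var_index v = var_index w \<longleftrightarrow> v = w"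
  by (simp add: inj_eq[OF inj_var_index])

text \<open>The sign of moving e_v past those elements of \<open>A\<close> that precede v. It takes
  values in any commutative ring, since it is needed both as a polynomial and as a field
  element.\<close>

definition koszul_sign :: "'v::finite \<Rightarrow> 'v set \<Rightarrow> 'b::comm_ring_1" where
  "koszul_sign v A = (- 1) ^ card {a \<in> A. var_index a < var_index v}"

lemma koszul_sign_insert:
  assumes "w \<notin> A"
  shows "koszul_sign v (insert w A) = (if var_index w < var_index v then - koszul_sign v A else koszul_sign v A)"
proof -
  have "{a \<in> insert w A. var_index a < var_index v} =
      (if var_index w < var_index v then insert w {a \<in> A. var_index a < var_index v}
       else {a \<in> A. var_index a < var_index v})" by auto
  thus ?thesis using assms by (simp add: koszul_sign_def)
qed

lemma koszul_sign_least:
  "(\<And>a. a \<in> A \<Longrightarrow> var_index v \<le> var_index a) \<Longrightarrow> koszul_sign v A = 1"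
proof -
  assume "\<And>a. a \<in> A \<Longrightarrow> var_index v \<le> var_index a"
  hence "{a \<in> A. var_index a < var_index v} = {}" by (auto simp: not_less)
  thus ?thesis unfolding koszul_sign_def by (simp only: card.empty power_0)
qed

lemma koszul_sign_square: "koszul_sign v A * koszul_sign v A = 1"
  by (simp add: koszul_sign_def flip: power_mult_distrib)

lemma koszul_sign_anticommute:
  assumes "v \<noteq> w" "v \<notin> A" "w \<notin> A"
  shows "koszul_sign v (insert w A) * koszul_sign w A = - (koszul_sign w (insert v A) * koszul_sign v A)"
proof (cases "var_index w < var_index v")
  case True
  thus ?thesis using assms by (simp add: koszul_sign_insert)
next
  case False
  hence "var_index v < var_index w" using assms(1) by (metis linorder_neqE_nat var_index_eq_iff)
  thus ?thesis using assms by (simp add: koszul_sign_insert)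
qed

text \<open>The pairs are split by the order of the variables and matched with their transposes.
  Showing only that twice the sum vanishes would not do in characteristic 2.\<close>

lemma sum_antisymmetric:
  fixes T :: "'v::finite \<Rightarrow> 'v \<Rightarrow> 'm::ab_group_add"
  assumes "\<And>v w. v \<in> B \<Longrightarrow> w \<in> B \<Longrightarrow> v \<noteq> w \<Longrightarrow> T v w = - T w v"
  shows "(\<Sum>v\<in>B. \<Sum>w\<in>B - {v}. T v w) = 0"
proof -
  let ?lt = "\<lambda>v w :: 'v. var_index v < var_index w"
  have "(\<Sum>w\<in>B - {v}. T v w) = (\<Sum>w\<in>B. if ?lt v w then T v w else 0) + (\<Sum>w\<in>B. if ?lt w v then T v w else 0)"
    if "v \<in> B" for v
  proof -
    have "(\<Sum>w\<in>B - {v}. T v w) = (\<Sum>w\<in>B. if w = v then 0 else T v w)"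
      by (rule sum.mono_neutral_cong_left) auto
    also have "\<dots> = (\<Sum>w\<in>B. (if ?lt v w then T v w else 0) + (if ?lt w v then T v w else 0))"
    proof (rule sum.cong[OF refl])
      fix w
      show "(if w = v then 0 else T v w) = (if ?lt v w then T v w else 0) + (if ?lt w v then T v w else 0)"
        using linorder_less_linear[of "var_index v" "var_index w"] by auto
    qed
    finally show ?thesis by (simp only: sum.distrib)
  qed
  hence "(\<Sum>v\<in>B. \<Sum>w\<in>B - {v}. T v w) =
      (\<Sum>v\<in>B. \<Sum>w\<in>B. if ?lt v w then T v w else 0) + (\<Sum>v\<in>B. \<Sum>w\<in>B. if ?lt w v then T v w else 0)"
    by (simp add: sum.distrib)
  also have "(\<Sum>v\<in>B. \<Sum>w\<in>B. if ?lt w v then T v w else 0) = (\<Sum>w\<in>B. \<Sum>v\<in>B. if ?lt w v then T v w else 0)"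
    by (rule sum.swap)
  also have "\<dots> = (\<Sum>w\<in>B. \<Sum>v\<in>B. - (if ?lt w v then T w v else 0))"
  proof (intro sum.cong refl)
    fix w v assume "w \<in> B" "v \<in> B"
    thus "(if ?lt w v then T v w else 0) = - (if ?lt w v then T w v else 0)"
      using assms[of v w] by auto
  qed
  also have "\<dots> = - (\<Sum>v\<in>B. \<Sum>w\<in>B. if ?lt v w then T v w else 0)"
    by (simp add: sum_negf)
  finally show ?thesis by simp
qed

text \<open>
  A Koszul chain \<open>f\<close> of degree \<open>i\<close> stands for \<open>\<Sum>\<^sub>A f A \<otimes> e\<^sub>A\<close>, where \<open>A\<close> runs over the sets of \<open>i\<close>
  variables. The signs refer to the linear order of the variables given by \<^const>\<open>var_index\<close>.
\<close>

definition koszul :: "(('v::finite, 'a::field) mpoly \<Rightarrow> 'm \<Rightarrow> 'm::ab_group_add) \<Rightarrow> ('v set \<Rightarrow> 'm) \<Rightarrow> 'v set \<Rightarrow> 'm" where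
  "koszul s f A = (\<Sum>v\<in>- A. s (koszul_sign v A * Var v) (f (insert v A)))"

text \<open>Chains of all degrees share one type of functions on sets of variables, and the degree
  is a support condition on cardinalities. So one differential \<open>koszul\<close> serves all
  degrees.\<close>

definition koszul_chains :: "'m::zero set \<Rightarrow> nat \<Rightarrow> ('v set \<Rightarrow> 'm) set" where
  "koszul_chains N i = {f. \<forall>A. f A \<in> N \<and> (card A \<noteq> i \<longrightarrow> f A = 0)}"

definition koszul_cycles where
  "koszul_cycles s N i = {f \<in> koszul_chains N i. koszul s f = 0}"

definition koszul_boundaries where
  "koszul_boundaries s N i = koszul s ` koszul_chains N (Suc i)"

text \<open>The basis element e_A carries the sum of the degrees of the variables in
  \<open>A\<close>, which makes the differential homogeneous of degree 0.\<close>

definition koszul_grading :: "('v::finite \<Rightarrow> 'k::finite) \<Rightarrow> (int ^ 'k \<Rightarrow> 'm set) \<Rightarrow> int ^ 'k \<Rightarrow> ('v set \<Rightarrow> 'm) set" where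
  "koszul_grading c gr d = {f. \<forall>A. f A \<in> gr (d - (\<Sum>v\<in>A. axis (c v) 1))}"

text \<open>Nonvanishing of H_i(N) in degree d, that is of Tor_i(N, k) in degree d, stated without
  forming a quotient.\<close>

definition koszul_homology_in_degree where
  "koszul_homology_in_degree s c gr N i d \<longleftrightarrow>
     \<not> koszul_cycles s N i \<inter> koszul_grading c gr d \<subseteq> koszul_boundaries s N i"

definition wedge :: "(('v::finite, 'a::field) mpoly \<Rightarrow> 'm \<Rightarrow> 'm::ab_group_add) \<Rightarrow> 'v \<Rightarrow> ('v set \<Rightarrow> 'm) \<Rightarrow> 'v set \<Rightarrow> 'm" where
  "wedge s w f A = (if w \<in> A then s (koszul_sign w (A - {w})) (f (A - {w})) else 0)"

lemma koszul_sign_ring_part: "koszul_sign v A \<in> ring_part c 0"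
  by (simp add: koszul_sign_def ring_part_def minus_one_power_iff)

context mpoly_module
begin

lemma koszul_add: "koszul s (f + g) = koszul s f + koszul s g"
  by (simp add: fun_eq_iff koszul_def scale_right_distrib sum.distrib)

lemma additive_koszul: "additive (koszul s)"
  by (simp add: additive_def koszul_add)

lemmas koszul_zero = additive.zero[OF additive_koszul]
  and koszul_diff = additive.diff[OF additive_koszul]

lemma koszul_scale: "koszul s (\<lambda>A. s p (f A)) = (\<lambda>A. s p (koszul s f A))"
  by (simp add: fun_eq_iff koszul_def scale_sum_right mult.commute)

lemma koszul_koszul: "koszul s (koszul s f) = 0"
proof
  fix A
  define T where "T v w = s (koszul_sign v A * Var v * (koszul_sign w (insert v A) * Var w)) (f (insert w (insert v A)))"
    for v w
  have "koszul s (koszul s f) A = (\<Sum>v\<in>- A. \<Sum>w\<in>- A - {v}. T v w)"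
    unfolding koszul_def scale_sum_right
  proof (intro sum.cong refl)
    fix v w assume "v \<in> - A"
    show "- insert v A = - A - {v}" by auto
  qed (simp add: T_def)
  also have "\<dots> = 0"
  proof (rule sum_antisymmetric)
    fix v w assume *: "v \<in> - A" "w \<in> - A" "v \<noteq> w"
    have "(koszul_sign v A * koszul_sign w (insert v A) :: ('v, 'a) mpoly) = - (koszul_sign w A * koszul_sign v (insert w A))"
      using koszul_sign_anticommute[of w v A] * by (simp add: mult.commute)
    hence "(koszul_sign v A * koszul_sign w (insert v A)) * (Var v * Var w) =
       - (koszul_sign w A * koszul_sign v (insert w A)) * (Var v * Var w :: ('v, 'a) mpoly)" by simp
    hence "koszul_sign v A * Var v * (koszul_sign w (insert v A) * Var w) =
       - (koszul_sign w A * Var w * (koszul_sign v (insert w A) * Var v) :: ('v, 'a) mpoly)"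
      by (simp add: mult_ac)
    thus "T v w = - T w v" by (simp only: T_def scale_minus_left insert_commute)
  qed
  finally show "koszul s (koszul s f) A = 0 A" by simp
qed

text \<open>Exterior multiplication by \<open>e\<^sub>w\<close> is a homotopy from multiplication by the variable \<open>w\<close> to zero.\<close>

lemma koszul_wedge: "koszul s (wedge s w f) A + wedge s w (koszul s f) A = s (Var w) (f A)"
proof (cases "w \<in> A")
  case False
  have "koszul s (wedge s w f) A = (\<Sum>v\<in>- A. if v = w then s (Var w) (f A) else 0)"
    unfolding koszul_def
  proof (rule sum.cong[OF refl])
    fix v assume v: "v \<in> - A"
    have "koszul_sign w A * Var w * koszul_sign w A = (Var w :: ('v, 'a) mpoly)"
    proof -
      have "koszul_sign w A * Var w * koszul_sign w A = (koszul_sign w A * koszul_sign w A) * (Var w :: ('v, 'a) mpoly)"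
        by (simp only: mult_ac)
      thus ?thesis by (simp add: koszul_sign_square)
    qed
    thus "s (koszul_sign v A * Var v) (wedge s w f (insert v A)) = (if v = w then s (Var w) (f A) else 0)"
      using v False by (auto simp: wedge_def)
  qed
  thus ?thesis using False by (simp add: wedge_def)
next
  case True
  define B where "B = A - {w}"
  have A: "A = insert w B" "w \<notin> B" using True by (auto simp: B_def)
  have c: "- B = insert w (- A)" using A by auto
  have "s (koszul_sign v A * Var v) (wedge s w f (insert v A)) =
      - s (koszul_sign w B) (s (koszul_sign v B * Var v) (f (insert v B)))" if v: "v \<in> - A" for v
  proof -
    have vw: "v \<noteq> w" "v \<notin> B" using v A by auto
    have "insert v A - {w} = insert v B" using vw A by auto
    hence 1: "wedge s w f (insert v A) = s (koszul_sign w (insert v B)) (f (insert v B))"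
      using A by (simp add: wedge_def)
    have "koszul_sign v A * koszul_sign w (insert v B) = - (koszul_sign w B * koszul_sign v B :: ('v, 'a) mpoly)"
    proof -
      \<comment> \<open>The square of \<open>koszul_sign w B\<close> is inserted to form the product
        to which anticommutation applies.\<close>
      have "koszul_sign v A * koszul_sign w (insert v B) =
          koszul_sign v (insert w B) * koszul_sign w B * (koszul_sign w B * koszul_sign w (insert v B) :: ('v, 'a) mpoly)"
      proof -
        have "koszul_sign v (insert w B) * koszul_sign w B * (koszul_sign w B * koszul_sign w (insert v B)) =
          koszul_sign v A * (koszul_sign w B * koszul_sign w B) * (koszul_sign w (insert v B) :: ('v, 'a) mpoly)"
          unfolding A(1) by (simp only: mult_ac)
        thus ?thesis by (simp add: koszul_sign_square)
      qed
      also have "\<dots> = - (koszul_sign w (insert v B) * koszul_sign v B) * (koszul_sign w B * koszul_sign w (insert v B))"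
        by (simp only: koszul_sign_anticommute[OF vw A(2)])
      also have "\<dots> = - (koszul_sign w B * koszul_sign v B) * (koszul_sign w (insert v B) * koszul_sign w (insert v B))"
        by (simp add: algebra_simps)
      finally show ?thesis by (simp add: koszul_sign_square)
    qed
    hence "koszul_sign v A * koszul_sign w (insert v B) * Var v = - (koszul_sign w B * koszul_sign v B) * (Var v :: ('v, 'a) mpoly)"
      by simp
    hence "koszul_sign v A * Var v * koszul_sign w (insert v B) = - (koszul_sign w B * (koszul_sign v B * Var v) :: ('v, 'a) mpoly)"
      by (simp add: mult_ac)
    thus ?thesis unfolding 1 by (simp only: scale_scale scale_minus_left)
  qed
  hence "koszul s (wedge s w f) A = - (\<Sum>v\<in>- A. s (koszul_sign w B) (s (koszul_sign v B * Var v) (f (insert v B))))"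
    unfolding koszul_def by (simp only: sum_negf cong: sum.cong)
  moreover have "wedge s w (koszul s f) A = s (koszul_sign w B) (s (koszul_sign w B * Var w) (f A)) +
      (\<Sum>v\<in>- A. s (koszul_sign w B) (s (koszul_sign v B * Var v) (f (insert v B))))"
  proof -
    have "wedge s w (koszul s f) A = s (koszul_sign w B) (koszul s f B)"
      using True by (simp add: wedge_def B_def)
    also have "koszul s f B = s (koszul_sign w B * Var w) (f A) + (\<Sum>v\<in>- A. s (koszul_sign v B * Var v) (f (insert v B)))"
      unfolding koszul_def c using A by (subst sum.insert) auto
    finally show ?thesis by (simp add: scale_right_distrib scale_sum_right del: scale_scale)
  qed
  moreover have "s (koszul_sign w B) (s (koszul_sign w B * Var w) (f A)) = s (Var w) (f A)"
  proof -
    have "koszul_sign w B * (koszul_sign w B * Var w) = (Var w :: ('v, 'a) mpoly)"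
      by (simp add: koszul_sign_square flip: mult.assoc)
    thus ?thesis by simp
  qed
  ultimately show ?thesis by simp
qed

lemma koszul_chains_koszul:
  assumes N: "subspace N" and f: "f \<in> koszul_chains N (Suc i)"
  shows "koszul s f \<in> koszul_chains N i"
proof -
  have "koszul s f A \<in> N" for A
    unfolding koszul_def using f by (intro subspace_sum[OF N] subspace_scale[OF N]) (simp add: koszul_chains_def)
  moreover have "koszul s f A = 0" if "card A \<noteq> i" for A
  proof -
    have "f (insert v A) = 0" if "v \<in> - A" for v
      using f that \<open>card A \<noteq> i\<close> by (simp add: koszul_chains_def)
    thus ?thesis by (simp add: koszul_def)
  qed
  ultimately show ?thesis by (simp add: koszul_chains_def)
qed

lemma koszul_chains_diff:
  "subspace N \<Longrightarrow> f \<in> koszul_chains N i \<Longrightarrow> g \<in> koszul_chains N i \<Longrightarrow> f - g \<in> koszul_chains N i"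
  by (simp add: koszul_chains_def subspace_diff)

lemma koszul_chains_wedge:
  assumes N: "subspace N" and f: "f \<in> koszul_chains N i"
  shows "wedge s w f \<in> koszul_chains N (Suc i)"
  unfolding koszul_chains_def
proof (intro CollectI allI conjI impI)
  fix A
  show "wedge s w f A \<in> N"
    using f subspace_scale[OF N] subspace_0[OF N] by (simp add: wedge_def koszul_chains_def)
  show "wedge s w f A = 0" if "card A \<noteq> Suc i"
  proof (cases "w \<in> A")
    case True
    hence "card A = Suc (card (A - {w}))" by (intro card.remove) simp_all
    hence "f (A - {w}) = 0" using that f by (simp add: koszul_chains_def)
    thus ?thesis by (simp add: wedge_def)
  qed (simp add: wedge_def)
qed

lemma mpoly_module_functions: "mpoly_module (\<lambda>p f A. s p (f A))"
  by unfold_locales (auto simp: fun_eq_iff scale_right_distrib scale_left_distrib)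

lemma module_hom_koszul: "module_hom (\<lambda>p f A. s p (f A)) (\<lambda>p f A. s p (f A)) (koszul s)"
  using mpoly_module.axioms[OF mpoly_module_functions]
  by (intro module_hom.intro module_hom_axioms.intro koszul_add koszul_scale)

lemma subspace_koszul_chains:
  assumes "subspace N"
  shows "module.subspace (\<lambda>p f A. s p (f A)) (koszul_chains N i)"
proof -
  interpret K: mpoly_module "\<lambda>p f A. s p (f A)" by (rule mpoly_module_functions)
  show ?thesis using assms by (simp add: koszul_chains_def subspace_def K.subspace_def)
qed

lemma subspace_koszul_cycles:
  assumes "subspace N"
  shows "module.subspace (\<lambda>p f A. s p (f A)) (koszul_cycles s N i)"
proof -
  interpret K: module_hom "\<lambda>p f A. s p (f A)" "\<lambda>p f A. s p (f A)" "koszul s" by (rule module_hom_koszul)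
  have "koszul_cycles s N i = koszul_chains N i \<inter> {f. koszul s f = 0}" by (auto simp: koszul_cycles_def)
  thus ?thesis using K.m1.subspace_inter[OF subspace_koszul_chains[OF assms] K.subspace_kernel] by simp
qed

lemma subspace_koszul_boundaries:
  assumes "subspace N"
  shows "module.subspace (\<lambda>p f A. s p (f A)) (koszul_boundaries s N i)"
  unfolding koszul_boundaries_def
  by (rule module_hom.subspace_image[OF module_hom_koszul subspace_koszul_chains[OF assms]])

text \<open>On a cycle the second term of the homotopy vanishes, so the variable times the cycle is
  the boundary of its wedge product. Hence Koszul homology is a vector space over the field.\<close>

lemma Var_koszul_cycles_boundaries:
  assumes N: "subspace N" and f: "f \<in> koszul_cycles s N i"
  shows "(\<lambda>A. s (Var w) (f A)) \<in> koszul_boundaries s N i"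
proof -
  have "wedge s w (koszul s f) A = 0" for A using f by (simp add: koszul_cycles_def wedge_def)
  hence "koszul s (wedge s w f) A = s (Var w) (f A)" for A
    using koszul_wedge[of w f A] by simp
  hence eq: "koszul s (wedge s w f) = (\<lambda>A. s (Var w) (f A))" by (rule ext)
  have "wedge s w f \<in> koszul_chains N (Suc i)"
    using koszul_chains_wedge[OF N] f by (simp add: koszul_cycles_def)
  thus ?thesis unfolding koszul_boundaries_def eq[symmetric] by (rule imageI)
qed

end

context graded_module
begin

lemma graded_module_koszul: "graded_module (\<lambda>p f A. s p (f A)) c (koszul_grading c gr)"
  and hcomp_koszul: "hcomp (koszul_grading c gr) d f = (\<lambda>A. hcomp gr (d - (\<Sum>v\<in>A. axis (c v) 1)) (f A))"
  using graded_module_functions[OF graded_module_axioms, of "\<lambda>A. \<Sum>v\<in>A. axis (c v) 1"]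
  by (simp_all add: koszul_grading_def[abs_def])

lemma koszul_in_koszul_grading:
  assumes f: "f \<in> koszul_grading c gr d" shows "koszul s f \<in> koszul_grading c gr d"
  unfolding koszul_grading_def koszul_def
proof (intro CollectI allI gr_sum)
  fix A :: "'v set" and v assume v: "v \<in> - A"
  have "koszul_sign v A * Var v \<in> ring_part c (0 + axis (c v) 1)"
    by (rule ring_part_mult[OF koszul_sign_ring_part ring_part_Var])
  moreover have "f (insert v A) \<in> gr (d - (\<Sum>v\<in>insert v A. axis (c v) 1))"
    using f by (simp add: koszul_grading_def)
  ultimately have "s (koszul_sign v A * Var v) (f (insert v A)) \<in>
      gr (0 + axis (c v) 1 + (d - (\<Sum>v\<in>insert v A. axis (c v) 1)))" by (rule gr_scale)
  thus "s (koszul_sign v A * Var v) (f (insert v A)) \<in> gr (d - (\<Sum>v\<in>A. axis (c v) 1))"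
    using v by simp
qed

lemma hcomp_koszul_commute: "hcomp (koszul_grading c gr) d (koszul s f) = koszul s (hcomp (koszul_grading c gr) d f)"
  by (rule hcomp_graded_hom[OF graded_module_koszul graded_module_koszul additive_koszul, of UNIV])
    (simp_all add: koszul_in_koszul_grading)

lemma hcomp_koszul_chains:
  "graded_submodule N \<Longrightarrow> f \<in> koszul_chains N i \<Longrightarrow> hcomp (koszul_grading c gr) d f \<in> koszul_chains N i"
  by (simp add: hcomp_koszul koszul_chains_def graded_submodule_def)

lemma hcomp_koszul_cycles:
  assumes "graded_submodule N" "f \<in> koszul_cycles s N i"
  shows "hcomp (koszul_grading c gr) d f \<in> koszul_cycles s N i"
proof -
  have "hcomp (koszul_grading c gr) d (0 :: 'v set \<Rightarrow> 'm) = 0"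
    by (simp add: hcomp_koszul fun_eq_iff)
  thus ?thesis
    using assms hcomp_koszul_chains by (simp add: koszul_cycles_def flip: hcomp_koszul_commute)
qed

lemma hcomp_koszul_boundaries:
  assumes "graded_submodule N" "f \<in> koszul_boundaries s N i"
  shows "hcomp (koszul_grading c gr) d f \<in> koszul_boundaries s N i"
proof -
  obtain h where h: "f = koszul s h" "h \<in> koszul_chains N (Suc i)"
    using assms(2) unfolding koszul_boundaries_def by blast
  show ?thesis unfolding h(1) hcomp_koszul_commute koszul_boundaries_def
    by (rule imageI[OF hcomp_koszul_chains[OF assms(1) h(2)]])
qed

lemma graded_submodule_koszul_cycles:
  "graded_submodule N \<Longrightarrow> graded_module.graded_submodule (\<lambda>p f A. s p (f A)) (koszul_grading c gr) (koszul_cycles s N i)"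
proof -
  interpret K: graded_module "\<lambda>p f A. s p (f A)" c "koszul_grading c gr" by (rule graded_module_koszul)
  assume N: "graded_submodule N"
  hence "K.subspace (koszul_cycles s N i)" by (simp only: graded_submodule_def subspace_koszul_cycles)
  thus "K.graded_submodule (koszul_cycles s N i)"
    unfolding K.graded_submodule_def using hcomp_koszul_cycles[OF N] by blast
qed

lemma graded_submodule_koszul_boundaries:
  "graded_submodule N \<Longrightarrow> graded_module.graded_submodule (\<lambda>p f A. s p (f A)) (koszul_grading c gr) (koszul_boundaries s N i)"
proof -
  interpret K: graded_module "\<lambda>p f A. s p (f A)" c "koszul_grading c gr" by (rule graded_module_koszul)
  assume N: "graded_submodule N"
  hence "K.subspace (koszul_boundaries s N i)" by (simp only: graded_submodule_def subspace_koszul_boundaries)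
  thus "K.graded_submodule (koszul_boundaries s N i)"
    unfolding K.graded_submodule_def using hcomp_koszul_boundaries[OF N] by blast
qed

end

section \<open>Homomorphisms and dimension shifting\<close>

lemma koszul_hom:
  assumes "module_hom s0 s \<epsilon>"
  shows "koszul s (\<lambda>A. \<epsilon> (f A)) = (\<lambda>A. \<epsilon> (koszul s0 f A))"
proof -
  interpret \<epsilon>: module_hom s0 s \<epsilon> by (rule assms)
  show ?thesis by (simp add: fun_eq_iff koszul_def \<epsilon>.sum \<epsilon>.scale)
qed

lemma koszul_chains_hom:
  assumes "module_hom s0 s \<epsilon>" "f \<in> koszul_chains F j"
  shows "(\<lambda>A. \<epsilon> (f A)) \<in> koszul_chains (\<epsilon> ` F) j"
  using assms(2) module_hom.zero[OF assms(1)] by (auto simp: koszul_chains_def)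

lemma koszul_chains_lift:
  assumes hom: "module_hom s0 s \<epsilon>" and F: "0 \<in> F" and g: "g \<in> koszul_chains (\<epsilon> ` F) j"
  shows "\<exists>h. h \<in> koszul_chains F j \<and> (\<lambda>A. \<epsilon> (h A)) = g"
proof -
  have "g A \<in> \<epsilon> ` F" for A using g by (simp add: koszul_chains_def)
  hence "\<forall>A. \<exists>x. x \<in> F \<and> \<epsilon> x = g A" by (metis imageE)
  then obtain h0 where h0: "\<And>A. h0 A \<in> F \<and> \<epsilon> (h0 A) = g A" by metis
  define h where "h A = (if card A = j then h0 A else 0)" for A
  have "h \<in> koszul_chains F j" using h0 F by (simp add: koszul_chains_def h_def)
  moreover have "(\<lambda>A. \<epsilon> (h A)) = g"
    using h0 g module_hom.zero[OF hom] by (auto simp: h_def fun_eq_iff koszul_chains_def)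
  ultimately show ?thesis by blast
qed

text \<open>The connecting map in degree d of the long exact sequence for 0 -> ker \<epsilon> -> F
  -> \<epsilon>(F) -> 0. The vanishing of H_(i+1)(F), assumed in \<open>acyclic\<close>, makes it
  injective; the vanishing of H_i(ker \<epsilon>) -> H_i(F), assumed in \<open>zero\<close>, makes
  it surjective.\<close>

lemma koszul_homology_shift:
  assumes M0: "graded_module s0 c gr0" and M: "graded_module s c gr"
    and F: "graded_module.graded_submodule s0 gr0 F" and hom: "module_hom s0 s \<epsilon>"
    and deg: "\<And>d. \<epsilon> ` (F \<inter> gr0 d) \<subseteq> gr d"
    and acyclic: "koszul_cycles s0 F (Suc i) \<subseteq> koszul_boundaries s0 F (Suc i)"
    and zero: "koszul_cycles s0 {f \<in> F. \<epsilon> f = 0} i \<subseteq> koszul_boundaries s0 F i"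
  shows "koszul_homology_in_degree s c gr (\<epsilon> ` F) (Suc i) d \<longleftrightarrow>
    koszul_homology_in_degree s0 c gr0 {f \<in> F. \<epsilon> f = 0} i d"
proof -
  interpret M0: graded_module s0 c gr0 by (rule M0)
  interpret M: graded_module s c gr by (rule M)
  interpret \<epsilon>: module_hom s0 s \<epsilon> by (rule hom)
  have subF: "M0.subspace F" and compF: "\<And>x d. x \<in> F \<Longrightarrow> hcomp gr0 d x \<in> F"
    using F by (auto simp: M0.graded_submodule_def)
  define N1 where "N1 = {f \<in> F. \<epsilon> f = 0}"
  define E where "E f = (\<lambda>A. \<epsilon> (f A))" for f :: "'a set \<Rightarrow> 'c"
  have Ek: "koszul s (E f) = E (koszul s0 f)" for f
    unfolding E_def by (rule koszul_hom[OF hom])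
  have Ediff: "E (f - g) = E f - E g" for f g by (simp add: E_def fun_eq_iff \<epsilon>.diff)
  have Echain: "E f \<in> koszul_chains (\<epsilon> ` F) j" if "f \<in> koszul_chains F j" for f j
    unfolding E_def by (rule koszul_chains_hom[OF hom that])
  have lift: "\<exists>h. h \<in> koszul_chains F j \<and> E h = g" if g: "g \<in> koszul_chains (\<epsilon> ` F) j" for g j
    unfolding E_def by (rule koszul_chains_lift[OF hom M0.subspace_0[OF subF] g])
  let ?P = "hcomp (koszul_grading c gr0) d" and ?Q = "hcomp (koszul_grading c gr) d"
  have Ecomp: "?Q (E f) = E (?P f)" if f: "f \<in> koszul_chains F j" for f j
  proof
    fix A
    have fA: "f A \<in> F" using f by (simp add: koszul_chains_def)
    show "?Q (E f) A = E (?P f) A"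
      unfolding M.hcomp_koszul M0.hcomp_koszul E_def
      by (rule hcomp_graded_hom[OF M0 M _ compF _ fA])
        (use deg in \<open>auto simp: additive_def \<epsilon>.add\<close>)
  qed
  interpret K0: graded_module "\<lambda>p f A. s0 p (f A)" c "koszul_grading c gr0" by (rule M0.graded_module_koszul)
  interpret K: graded_module "\<lambda>p f A. s p (f A)" c "koszul_grading c gr" by (rule M.graded_module_koszul)
  have homog: "?P f = f" if "f \<in> koszul_grading c gr0 d" for f using K0.hcomp_homogeneous[OF that] by simp
  have homog': "?Q f = f" if "f \<in> koszul_grading c gr d" for f using K.hcomp_homogeneous[OF that] by simp
  have Egr: "E f \<in> koszul_grading c gr d" if "f \<in> koszul_chains F j" "f \<in> koszul_grading c gr0 d" for f j
    using Ecomp[OF that(1)] homog[OF that(2)] K.hcomp_in[of d "E f"] by simp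
  note compch = M0.hcomp_koszul_chains[OF F]
  show ?thesis
    unfolding koszul_homology_in_degree_def N1_def[symmetric]
  proof (rule iffI)
    assume "\<not> koszul_cycles s (\<epsilon> ` F) (Suc i) \<inter> koszul_grading c gr d \<subseteq> koszul_boundaries s (\<epsilon> ` F) (Suc i)"
    then obtain z where z: "z \<in> koszul_chains (\<epsilon> ` F) (Suc i)" "koszul s z = 0" "z \<in> koszul_grading c gr d"
      "z \<notin> koszul_boundaries s (\<epsilon> ` F) (Suc i)" unfolding koszul_cycles_def by blast
    obtain h' where h': "h' \<in> koszul_chains F (Suc i)" "E h' = z" using lift[OF z(1)] by blast
    \<comment> \<open>The component of degree d still lifts the homogeneous \<open>z\<close>, and
      its boundary is homogeneous of degree d.\<close>
    define h where "h = ?P h'"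
    have h: "h \<in> koszul_chains F (Suc i)" unfolding h_def by (rule compch[OF h'(1)])
    have hgr: "h \<in> koszul_grading c gr0 d" unfolding h_def by (rule K0.hcomp_in)
    have Eh: "E h = z" using Ecomp[OF h'(1)] h'(2) homog'[OF z(3)] by (simp add: h_def)
    have kh: "koszul s0 h \<in> koszul_chains N1 i"
    proof -
      have "koszul s0 h \<in> koszul_chains F i" by (rule M0.koszul_chains_koszul[OF subF h])
      moreover have "E (koszul s0 h) = 0" using Ek[of h] Eh z(2) by simp
      hence "\<epsilon> (koszul s0 h A) = 0" for A by (simp add: E_def fun_eq_iff)
      ultimately show ?thesis by (simp add: koszul_chains_def N1_def)
    qed
    have "koszul s0 h \<notin> koszul_boundaries s0 N1 i"
    proof
      assume "koszul s0 h \<in> koszul_boundaries s0 N1 i"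
      then obtain w where w: "w \<in> koszul_chains N1 (Suc i)" "koszul s0 h = koszul s0 w"
        unfolding koszul_boundaries_def by blast
      have wF: "w \<in> koszul_chains F (Suc i)" using w(1) by (simp add: koszul_chains_def N1_def)
      have Ew: "E w = 0" using w(1) by (auto simp: koszul_chains_def N1_def E_def fun_eq_iff)
      \<comment> \<open>Were the connecting image bounded by \<open>w\<close> inside the kernel, h -
        w would be a cycle of F over \<open>z\<close>, and a chain bounding it would map to one
        bounding \<open>z\<close>.\<close>
      have "h - w \<in> koszul_cycles s0 F (Suc i)"
        using M0.koszul_chains_diff[OF subF h wF] w(2) by (simp add: koszul_cycles_def M0.koszul_diff)
      then obtain u where u: "u \<in> koszul_chains F (Suc (Suc i))" "h - w = koszul s0 u"
        using acyclic unfolding koszul_boundaries_def by blast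
      have "z = E (h - w)" using Eh Ew by (simp add: Ediff)
      also have "\<dots> = koszul s (E u)" by (simp add: u(2) Ek)
      finally have "z \<in> koszul_boundaries s (\<epsilon> ` F) (Suc i)"
        unfolding koszul_boundaries_def using Echain[OF u(1)] by blast
      with z(4) show False ..
    qed
    moreover have "koszul s0 h \<in> koszul_cycles s0 N1 i"
      using kh by (simp add: koszul_cycles_def M0.koszul_koszul)
    moreover have "koszul s0 h \<in> koszul_grading c gr0 d" by (rule M0.koszul_in_koszul_grading[OF hgr])
    ultimately show "\<not> koszul_cycles s0 N1 i \<inter> koszul_grading c gr0 d \<subseteq> koszul_boundaries s0 N1 i" by blast
  next
    assume "\<not> koszul_cycles s0 N1 i \<inter> koszul_grading c gr0 d \<subseteq> koszul_boundaries s0 N1 i"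
    then obtain z where z: "z \<in> koszul_cycles s0 N1 i" "z \<in> koszul_grading c gr0 d"
      "z \<notin> koszul_boundaries s0 N1 i" by blast
    obtain h' where h': "h' \<in> koszul_chains F (Suc i)" "z = koszul s0 h'"
      using z(1) zero unfolding koszul_boundaries_def N1_def by blast
    define h where "h = ?P h'"
    have h: "h \<in> koszul_chains F (Suc i)" unfolding h_def by (rule compch[OF h'(1)])
    have hgr: "h \<in> koszul_grading c gr0 d" unfolding h_def by (rule K0.hcomp_in)
    have kh: "koszul s0 h = z"
      unfolding h_def using M0.hcomp_koszul_commute[of d h'] h'(2) homog[OF z(2)] by simp
    have Ez: "E z = 0" using z(1) by (auto simp: koszul_cycles_def koszul_chains_def N1_def E_def fun_eq_iff)
    have "E h \<notin> koszul_boundaries s (\<epsilon> ` F) (Suc i)"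
    proof
      assume "E h \<in> koszul_boundaries s (\<epsilon> ` F) (Suc i)"
      then obtain w where w: "w \<in> koszul_chains (\<epsilon> ` F) (Suc (Suc i))" "E h = koszul s w"
        unfolding koszul_boundaries_def by blast
      obtain w' where w': "w' \<in> koszul_chains F (Suc (Suc i))" "E w' = w" using lift[OF w(1)] by blast
      \<comment> \<open>Removing a lifted boundary from \<open>h\<close> leaves its own boundary
        \<open>z\<close> unchanged and moves it into the kernel.\<close>
      define x where "x = h - koszul s0 w'"
      have "x \<in> koszul_chains F (Suc i)"
        unfolding x_def by (rule M0.koszul_chains_diff[OF subF h M0.koszul_chains_koszul[OF subF w'(1)]])
      moreover have "E x = 0" unfolding x_def Ediff Ek[symmetric] w'(2) using w(2) by simp
      hence "\<epsilon> (x A) = 0" for A by (simp add: E_def fun_eq_iff)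
      ultimately have "x \<in> koszul_chains N1 (Suc i)" by (simp add: koszul_chains_def N1_def)
      moreover have "koszul s0 x = z" by (simp add: x_def M0.koszul_diff M0.koszul_koszul kh)
      ultimately have "z \<in> koszul_boundaries s0 N1 i" unfolding koszul_boundaries_def by blast
      with z(3) show False ..
    qed
    moreover have "E h \<in> koszul_cycles s (\<epsilon> ` F) (Suc i)"
      using Echain[OF h] by (simp add: koszul_cycles_def Ek kh Ez)
    moreover have "E h \<in> koszul_grading c gr d" by (rule Egr[OF h hgr])
    ultimately show "\<not> koszul_cycles s (\<epsilon> ` F) (Suc i) \<inter> koszul_grading c gr d \<subseteq> koszul_boundaries s (\<epsilon> ` F) (Suc i)"
      by blast
  qed
qed

section \<open>Acyclicity of graded free modules\<close>

lemma lookup_Var_mult: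
  fixes p :: "('v, 'a::field) mpoly"
  shows "lookup (Var v * p) m =
    (lookup p (m - single v 1) when lookup m v \<noteq> 0)"
proof -
  let ?u = "single v (1::nat)"
  have "lookup (Var v * p) m = (\<Sum>q. lookup p q when m = ?u + q)"
    by (simp add: Var_def lookup_mult lookup_single when_mult)
  also have "\<dots> = (lookup p (m - ?u) when lookup m v \<noteq> 0)"
  proof (cases "lookup m v = 0")
    case True
    have "m \<noteq> ?u + q" for q
    proof
      assume "m = ?u + q"
      hence "lookup m v = 1 + lookup q v" by (simp add: lookup_add)
      with True show False by simp
    qed
    thus ?thesis using True by simp
  next
    case False
    have "m = ?u + q \<longleftrightarrow> m - ?u = q" for q
    proof
      assume "m - ?u = q"
      show "m = ?u + q"
        by (rule poly_mapping_eqI)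
          (use False \<open>m - ?u = q\<close>[symmetric] in \<open>auto simp: lookup_add lookup_minus lookup_single when_def\<close>)
    qed simp
    thus ?thesis using False by simp
  qed
  finally show ?thesis .
qed

lemma lookup_koszul_sign_mult:
  "lookup (koszul_sign v A * p) m = koszul_sign v A * lookup (p :: ('v::finite, 'a::field) mpoly) m"
  by (simp add: koszul_sign_def minus_one_power_iff)

lemma lookup_mult_zero:
  fixes p q :: "('v, 'a::field) mpoly"
  shows "lookup (p * q) 0 = lookup p 0 * lookup q 0"
proof -
  have *: "0 = l + k \<longleftrightarrow> 0 = l \<and> 0 = k" for l k :: "'v \<Rightarrow>\<^sub>0 nat"
    by (auto simp: poly_mapping_eq_iff lookup_add fun_eq_iff)
  have "(\<Sum>k. lookup q k when 0 = l + k) = (lookup q 0 when 0 = l)" for l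
    by (cases "0 = l") (simp_all add: *)
  thus ?thesis by (simp add: lookup_mult mult_when)
qed

lemma irrelevant_ideal_Var: "Var v \<in> irrelevant_ideal"
proof -
  have "single v (1::nat) \<noteq> 0" by (metis lookup_single_eq lookup_zero one_neq_zero)
  thus ?thesis by (simp add: irrelevant_ideal_def Var_def lookup_single)
qed

lemma subspace_free_module: "module.subspace free_scale (free_module r)"
proof -
  interpret module free_scale by (rule module_free_scale)
  have mem: "f \<in> free_module r \<longleftrightarrow> (\<forall>j\<ge>r. lookup f j = 0)" for f :: "('a, 'b) free"
    by (auto simp: free_module_def in_keys_iff subset_iff not_less[symmetric])
  show ?thesis by (rule subspaceI) (auto simp: mem lookup_add lookup_free_scale)
qed

lemma hcomp_free_module:
  fixes f :: "('v::finite, 'a::field) free"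
  assumes f: "f \<in> free_module r"
  shows "hcomp (free_grading c b) d f \<in> free_module r"
proof -
  have mem: "f \<in> free_module r \<longleftrightarrow> (\<forall>j\<ge>r. lookup f j = 0)" for f :: "('v, 'a) free"
    by (auto simp: free_module_def in_keys_iff subset_iff not_less[symmetric])
  show ?thesis
    unfolding mem
  proof (intro allI impI)
    fix j assume "r \<le> j"
    thus "lookup (hcomp (free_grading c b) d f) j = 0"
      using f by (intro poly_mapping_eqI) (simp add: graded_module_free(2) mem)
  qed
qed

lemma graded_submodule_free_module:
  "graded_module.graded_submodule (free_scale :: ('v::finite, 'a::field) mpoly \<Rightarrow> _) (free_grading c b) (free_module r)"
proof -
  interpret F: graded_module "free_scale :: ('v, 'a) mpoly \<Rightarrow> _" c "free_grading c b" by (rule graded_module_free)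
  show ?thesis by (simp add: F.graded_submodule_def subspace_free_module hcomp_free_module)
qed

lemma hcomp_free_hom:
  fixes s :: "('v::finite, 'a::field) mpoly \<Rightarrow> 'm::ab_group_add \<Rightarrow> 'm"
  assumes M: "graded_module s c gr" and hom: "module_hom free_scale s \<epsilon>"
    and deg: "\<And>d. \<epsilon> ` free_part c r b d \<subseteq> gr d" and f: "f \<in> free_module r"
  shows "\<epsilon> (hcomp (free_grading c b) d f) = hcomp gr d (\<epsilon> f)"
  by (rule hcomp_graded_hom[symmetric, OF graded_module_free(1) M _ hcomp_free_module _ f])
    (use deg module_hom.add[OF hom] in \<open>auto simp: additive_def free_part_eq\<close>)

text \<open>Division by the variable \<open>w\<close>, restricted to quotient monomials that satisfy
  \<open>R\<close>. The support is finite because each quotient monomial arises from a monomial of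
  \<open>f\<close>. This is the building block of the contraction.\<close>

lemma free_div_var_exists:
  fixes f :: "('v, 'a::field) free"
  shows "\<exists>h. \<forall>j m. lookup (lookup h j) m =
    (lookup (lookup f j) (m + single w 1) when R m)"
proof -
  define Q where "Q p = Abs_poly_mapping (\<lambda>m. lookup p (m + single w 1) when R m)"
    for p :: "('v, 'a) mpoly"
  have lQ: "lookup (Q p) m = (lookup p (m + single w 1) when R m)" for p m
  proof -
    have "{m. (lookup p (m + single w 1) when R m) \<noteq> 0} \<subseteq>
        (\<lambda>m. m - single w 1) ` Poly_Mapping.keys p"
    proof
      fix m assume "m \<in> {m. (lookup p (m + single w 1) when R m) \<noteq> 0}"
      hence "m + single w 1 \<in> Poly_Mapping.keys p" by (auto simp: in_keys_iff)
      thus "m \<in> (\<lambda>m. m - single w 1) ` Poly_Mapping.keys p" by force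
    qed
    hence "finite {m. (lookup p (m + single w 1) when R m) \<noteq> 0}"
      by (rule finite_subset) simp
    thus ?thesis unfolding Q_def by simp
  qed
  have Q0: "Q 0 = 0" by (rule poly_mapping_eqI) (simp add: lQ)
  have "lookup (Poly_Mapping.mapp (\<lambda>j. Q) f) j = Q (lookup f j)" for j
    by (auto simp: lookup_mapp when_def in_keys_iff Q0)
  thus ?thesis by (intro exI[of _ "Poly_Mapping.mapp (\<lambda>j. Q) f"]) (simp add: lQ)
qed

text \<open>
  A contraction can be given in each degree of the fine grading by exponents separately: the
  basis element \<open>x\<^sup>m e\<^sub>A\<close> is sent to \<open>(x\<^sup>m / x\<^sub>w) e\<^sub>w \<and> e\<^sub>A\<close>, where \<open>w\<close> is the least variable that
  divides \<open>x\<^sup>m\<close> or lies in \<open>A\<close>, and to zero if \<open>w \<in> A\<close>.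
\<close>

lemma free_koszul_acyclic:
  fixes z :: "'v::finite set \<Rightarrow> ('v, 'a::field) free"
  assumes z: "z \<in> koszul_cycles free_scale (free_module r) i"
    and z0: "\<And>j. lookup (z {}) j \<in> irrelevant_ideal"
  shows "z \<in> koszul_boundaries free_scale (free_module r) i"
proof -
  define \<Phi> where "\<Phi> A j m = lookup (lookup (z A) j) m" for A j m
  let ?X = "\<lambda>v. single v (1::nat)"
  have koszul_lookup: "lookup (lookup (koszul free_scale f A) j) m =
      (\<Sum>v\<in>- A. koszul_sign v A *
        (lookup (lookup (f (insert v A)) j) (m - ?X v) when lookup m v \<noteq> 0))"
    for f :: "'v set \<Rightarrow> ('v, 'a) free" and A j m
    by (simp add: koszul_def lookup_sum lookup_free_scale mult.assoc lookup_koszul_sign_mult lookup_Var_mult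
        del: One_nat_def)
  define least where "least A = (ARG_MIN var_index a. a \<in> A)" for A :: "'v set"
  have least: "least A = w" if "w \<in> A" "\<And>u. u \<in> A \<Longrightarrow> var_index w \<le> var_index u" for A w
  proof -
    have "least A \<in> A" unfolding least_def by (rule arg_min_natI[where P = "\<lambda>a. a \<in> A", OF that(1)])
    moreover have "var_index (least A) \<le> var_index w"
      unfolding least_def by (rule arg_min_nat_le[where P = "\<lambda>a. a \<in> A", OF that(1)])
    ultimately have "var_index (least A) = var_index w" using that(2) by (meson le_antisym)
    thus ?thesis by simp
  qed
  \<comment> \<open>The contraction on coefficients: with w the least element of \<open>A\<close>,
    the coefficient at x^m e_A is taken from the term with exponent m + e_w and set A - {w}. The
    condition on m says that no variable below w divides x^m, so w is the least variable of the
    source term too.\<close>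
  have "\<forall>A. \<exists>h. \<forall>j m. lookup (lookup h j) m =
      (\<Phi> (A - {least A}) j (m + ?X (least A)) when (\<forall>v. var_index v < var_index (least A) \<longrightarrow> lookup m v = 0))"
    unfolding \<Phi>_def by (intro allI free_div_var_exists)
  then obtain h0 where h0: "\<And>A j m. lookup (lookup (h0 A) j) m =
      (\<Phi> (A - {least A}) j (m + ?X (least A)) when (\<forall>v. var_index v < var_index (least A) \<longrightarrow> lookup m v = 0))"
    by metis
  define h where "h A = (if A = {} then 0 else h0 A)" for A
  \<comment> \<open>The same formula with w the least variable in \<open>A\<close> or
    \<open>m\<close>. If w divides x^m but is not in \<open>A\<close>, it precedes the least element
    of \<open>A\<close>, and the value is zero.\<close>
  have hval: "lookup (lookup (h A) j) m = (if w \<in> A then \<Phi> (A - {w}) j (m + ?X w) else 0)"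
    if w: "w \<in> A \<or> lookup m w \<noteq> 0"
      and min: "\<And>u. u \<in> A \<or> lookup m u \<noteq> 0 \<Longrightarrow> var_index w \<le> var_index u" for A j m w
  proof (cases "w \<in> A")
    case True
    have "least A = w" using True min by (intro least) auto
    moreover have "\<forall>v. var_index v < var_index w \<longrightarrow> lookup m v = 0"
      using min by (meson not_less)
    ultimately show ?thesis using True by (auto simp: h_def h0)
  next
    case False
    show ?thesis
    proof (cases "A = {}")
      case ne: False
      have "least A \<in> A" unfolding least_def using ne by (metis arg_min_natI ex_in_conv)
      hence lt: "var_index w < var_index (least A)" using min[of "least A"] False
        by (metis le_neq_implies_less var_index_eq_iff)
      have mw: "lookup m w \<noteq> 0" using w False by simp
      have "\<not> (\<forall>v. var_index v < var_index (least A) \<longrightarrow> lookup m v = 0)"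
      proof
        assume "\<forall>v. var_index v < var_index (least A) \<longrightarrow> lookup m v = 0"
        with lt have "lookup m w = 0" by (elim allE[of _ w]) simp
        with mw show False ..
      qed
      hence "lookup (lookup (h0 A) j) m = 0" unfolding h0 when_def by (rule if_not_P)
      thus ?thesis using False ne by (simp add: h_def)
    qed (simp add: h_def)
  qed
  have zchain: "z \<in> koszul_chains (free_module r) i" and zcyc: "koszul free_scale z = 0"
    using z by (auto simp: koszul_cycles_def)
  have "koszul free_scale h A = z A" for A
  proof (intro poly_mapping_eqI)
    fix j and m :: "'v \<Rightarrow>\<^sub>0 nat"
    let ?U = "{u. u \<in> A \<or> lookup m u \<noteq> 0}"
    have kh: "lookup (lookup (koszul free_scale h A) j) m =
      (\<Sum>v\<in>- A. koszul_sign v A *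
        (lookup (lookup (h (insert v A)) j) (m - ?X v) when lookup m v \<noteq> 0))"
      by (rule koszul_lookup)
    show "lookup (lookup (koszul free_scale h A) j) m = lookup (lookup (z A) j) m"
    proof (cases "?U = {}")
      \<comment> \<open>The term without any variable is the one place where the homotopy gives
        nothing; there the hypothesis on the constant terms of \<open>z {}\<close> is used.\<close>
      case True
      hence A: "A = {}" and m: "m = 0" by (auto simp: poly_mapping_eq_iff fun_eq_iff)
      show ?thesis unfolding kh using z0[of j] by (simp add: A m irrelevant_ideal_def)
    next
      case False
      define w where "w = least ?U"
      have wU: "w \<in> ?U" unfolding w_def least_def
        using False arg_min_natI[of "\<lambda>a. a \<in> ?U"] by blast
      have wmin: "var_index w \<le> var_index u" if "u \<in> ?U" for u
        unfolding w_def least_def by (rule arg_min_nat_le[where P = "\<lambda>a. a \<in> ?U", OF that])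
      have hv: "lookup (lookup (h (insert v A)) j) (m - ?X v) =
          (if w \<in> insert v A then \<Phi> (insert v A - {w}) j (m - ?X v + ?X w) else 0)"
        if v: "v \<in> - A" "lookup m v \<noteq> 0" for v
      proof -
        have U: "u \<in> insert v A \<or> lookup (m - ?X v) u \<noteq> 0 \<longleftrightarrow> u \<in> ?U" for u
          using v by (auto simp: lookup_minus lookup_single when_def)
        show ?thesis by (rule hval) (use wU wmin in \<open>simp_all only: U\<close>)
      qed
      show ?thesis
      proof (cases "w \<in> A")
        case True
        define B where "B = A - {w}"
        have A: "A = insert w B" "w \<notin> B" using True by (auto simp: B_def)
        have c: "- B = insert w (- A)" using A by auto
        have sw: "koszul_sign w B = (1 :: 'a)"
          using wmin A by (intro koszul_sign_least) auto
        have lt: "var_index w < var_index v" if "v \<in> - A" "lookup m v \<noteq> 0" for v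
        proof -
          have "v \<noteq> w" "var_index w \<le> var_index v" using that True wmin[of v] by auto
          thus ?thesis by (metis le_neq_implies_less var_index_eq_iff)
        qed
        \<comment> \<open>The cycle condition at the set \<open>B\<close> and the exponent m + e_w.
          The summand for w is the wanted coefficient, and the remaining ones are the summands of
          the boundary of \<open>h\<close> with opposite sign.\<close>
        have "0 = (\<Sum>v\<in>- B. koszul_sign v B * (\<Phi> (insert v B) j (m + ?X w - ?X v) when lookup (m + ?X w) v \<noteq> 0))"
          using koszul_lookup[of z B j "m + ?X w"] zcyc by (simp add: \<Phi>_def)
        also have "\<dots> = koszul_sign w B * (\<Phi> (insert w B) j (m + ?X w - ?X w) when lookup (m + ?X w) w \<noteq> 0) +
          (\<Sum>v\<in>- A. koszul_sign v B * (\<Phi> (insert v B) j (m + ?X w - ?X v) when lookup (m + ?X w) v \<noteq> 0))"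
          unfolding c using A by (subst sum.insert) auto
        also have "koszul_sign w B * (\<Phi> (insert w B) j (m + ?X w - ?X w) when lookup (m + ?X w) w \<noteq> 0) = \<Phi> A j m"
          by (simp add: sw A lookup_add)
        also have "(\<Sum>v\<in>- A. koszul_sign v B * (\<Phi> (insert v B) j (m + ?X w - ?X v) when lookup (m + ?X w) v \<noteq> 0)) =
          (\<Sum>v\<in>- A. - (koszul_sign v A *
        (lookup (lookup (h (insert v A)) j) (m - ?X v) when lookup m v \<noteq> 0)))"
        proof (rule sum.cong[OF refl])
          fix v assume v: "v \<in> - A"
          have vw: "v \<noteq> w" using v True by auto
          have lm: "lookup (m + ?X w) v = lookup m v"
            using vw by (simp add: lookup_add lookup_single)
          show "koszul_sign v B * (\<Phi> (insert v B) j (m + ?X w - ?X v) when lookup (m + ?X w) v \<noteq> 0) =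
             - (koszul_sign v A * (lookup (lookup (h (insert v A)) j) (m - ?X v) when lookup m v \<noteq> 0))"
          proof (cases "lookup m v = 0")
            case False
            have 1: "insert v A - {w} = insert v B" using vw A by auto
            have 2: "m - ?X v + ?X w = m + ?X w - ?X v"
              by (rule poly_mapping_eqI) (use vw in \<open>auto simp: lookup_add lookup_minus lookup_single when_def\<close>)
            have 3: "koszul_sign v A = (- koszul_sign v B :: 'a)"
              unfolding A(1) using koszul_sign_insert[OF A(2), of v] lt[OF v False] by simp
            show ?thesis unfolding lm 3 using False True by (simp only: hv[OF v False] 1 2 insert_iff) simp
          qed (simp add: lm del: One_nat_def)
        qed
        also have "\<dots> = - lookup (lookup (koszul free_scale h A) j) m"
          unfolding kh by (rule sum_negf)
        finally show ?thesis by (simp add: \<Phi>_def)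
      next
        case False
        hence mw: "lookup m w \<noteq> 0" using wU by blast
        \<comment> \<open>For v other than w, the variable w still divides the monomial and lies
          outside \<open>insert v A\<close>, so \<open>h\<close> vanishes there.\<close>
        have "lookup (lookup (koszul free_scale h A) j) m =
          (\<Sum>v\<in>- A. if v = w then \<Phi> A j m else 0)"
          unfolding kh
        proof (rule sum.cong[OF refl])
          fix v assume v: "v \<in> - A"
          show "koszul_sign v A * (lookup (lookup (h (insert v A)) j) (m - ?X v) when lookup m v \<noteq> 0) =
             (if v = w then \<Phi> A j m else 0)"
          proof (cases "v = w")
            case True
            have s1: "koszul_sign w A = (1 :: 'a)" using wmin by (intro koszul_sign_least) auto
            have i1: "m - ?X w + ?X w = m"
              by (rule poly_mapping_eqI) (use mw in \<open>auto simp: lookup_add lookup_minus lookup_single when_def\<close>)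
            have i2: "insert w A - {w} = A" using False by auto
            have "lookup (lookup (h (insert w A)) j) (m - ?X w) = \<Phi> A j m"
              using hv[of w] False mw by (simp only: i1 i2 Compl_iff insert_iff simp_thms if_True)
            thus ?thesis using mw by (simp only: True s1 if_True mult_1 not_False_eq_True when_simps simp_thms)
          next
            case vw: False
            show ?thesis
            proof (cases "lookup m v = 0")
              case f2: False
              have "w \<notin> insert v A" using vw False by auto
              hence "lookup (lookup (h (insert v A)) j) (m - ?X v) = 0"
                using hv[OF v f2] by (simp only: if_False)
              thus ?thesis using vw by (simp only: when_def if_False mult_zero_right if_cancel)
            qed (simp add: vw)
          qed
        qed
        also have "\<dots> = \<Phi> A j m" using False by simp
        finally show ?thesis by (simp add: \<Phi>_def)
      qed
    qed
  qed
  hence "koszul free_scale h = z" by (rule ext)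
  moreover have "h \<in> koszul_chains (free_module r) (Suc i)"
    unfolding koszul_chains_def
  proof (intro CollectI allI conjI impI)
    fix A
    have l0: "h A = 0" if "A = {}" using that by (simp add: h_def)
    have least_in: "least A \<in> A" if "A \<noteq> {}" unfolding least_def using that by (metis arg_min_natI ex_in_conv)
    have eq0: "lookup (h A) j = 0" if "lookup (z (A - {least A})) j = 0" for j
      using that by (intro poly_mapping_eqI) (simp add: h_def h0 \<Phi>_def)
    have "z (A - {least A}) \<in> free_module r" using zchain by (simp add: koszul_chains_def)
    thus "h A \<in> free_module r" using eq0 unfolding free_module_def by (auto simp: in_keys_iff subset_iff)
    assume card: "card A \<noteq> Suc i"
    show "h A = 0"
    proof (cases "A = {}")
      case False
      have "card A = Suc (card (A - {least A}))" using least_in[OF False] by (intro card.remove) simp_all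
      hence "z (A - {least A}) = 0" using card zchain by (simp add: koszul_chains_def)
      thus ?thesis using eq0 by (intro poly_mapping_eqI[of "h A" 0]) simp
    qed (rule l0)
  qed
  ultimately show ?thesis unfolding koszul_boundaries_def by blast
qed

section \<open>Minimal resolutions and Koszul homology\<close>

text \<open>For the kernel K, the map H_i(K) -> H_i(F) is zero: F is acyclic in positive degrees,
  and in degree 0 minimality puts K into the irrelevant ideal times F. Dimension shifting then
  applies.\<close>

lemma koszul_homology_syzygy:
  fixes s :: "('v::finite, 'a::field) mpoly \<Rightarrow> 'm::ab_group_add \<Rightarrow> 'm"
  assumes M: "graded_module s c gr" and hom: "module_hom free_scale s \<epsilon>"
    and deg: "\<And>d. \<epsilon> ` free_part c r b d \<subseteq> gr d"
    and min: "\<And>f j. f \<in> free_module r \<Longrightarrow> \<epsilon> f = 0 \<Longrightarrow> lookup f j \<in> irrelevant_ideal"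
  shows "koszul_homology_in_degree s c gr (\<epsilon> ` free_module r) (Suc i) d \<longleftrightarrow>
    koszul_homology_in_degree free_scale c (free_grading c b) {f \<in> free_module r. \<epsilon> f = 0} i d"
proof (rule koszul_homology_shift[OF graded_module_free(1) M graded_submodule_free_module hom])
  show "\<epsilon> ` (free_module r \<inter> free_grading c b d) \<subseteq> gr d" for d
    using deg by (simp add: free_part_eq)
  show "koszul_cycles free_scale (free_module r :: ('v, 'a) free set) (Suc i) \<subseteq> koszul_boundaries free_scale (free_module r) (Suc i)"
  proof
    fix z :: "'v set \<Rightarrow> ('v, 'a) free" assume z: "z \<in> koszul_cycles free_scale (free_module r) (Suc i)"
    hence "z {} = 0" by (simp add: koszul_cycles_def koszul_chains_def)
    thus "z \<in> koszul_boundaries free_scale (free_module r) (Suc i)"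
      by (intro free_koszul_acyclic[OF z]) (simp add: irrelevant_ideal_def)
  qed
  show "koszul_cycles free_scale {f \<in> free_module r. \<epsilon> f = 0} i \<subseteq> koszul_boundaries free_scale (free_module r) i"
  proof
    fix z :: "'v set \<Rightarrow> ('v, 'a) free" assume z: "z \<in> koszul_cycles free_scale {f \<in> free_module r. \<epsilon> f = 0} i"
    have "z \<in> koszul_cycles free_scale (free_module r) i" "z {} \<in> free_module r" "\<epsilon> (z {}) = 0"
      using z by (auto simp: koszul_cycles_def koszul_chains_def)
    thus "z \<in> koszul_boundaries free_scale (free_module r) i"
      using min by (intro free_koszul_acyclic) auto
  qed
qed

text \<open>H_0(N) is N modulo the variables. By minimality the images of the basis of F form a
  basis of it over the field, so its degrees are the shifts.\<close>

lemma koszul_homology_zero: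
  fixes s :: "('v::finite, 'a::field) mpoly \<Rightarrow> 'm::ab_group_add \<Rightarrow> 'm"
  assumes M: "graded_module s c gr" and hom: "module_hom free_scale s \<epsilon>"
    and deg: "\<And>d. \<epsilon> ` free_part c r b d \<subseteq> gr d"
    and min: "\<And>f j. f \<in> free_module r \<Longrightarrow> \<epsilon> f = 0 \<Longrightarrow> lookup f j \<in> irrelevant_ideal"
  shows "koszul_homology_in_degree s c gr (\<epsilon> ` free_module r) 0 d \<longleftrightarrow> (\<exists>j<r. b j = d)"
proof -
  interpret M: graded_module s c gr by (rule M)
  interpret F: graded_module "free_scale :: ('v, 'a) mpoly \<Rightarrow> _" c "free_grading c b" by (rule graded_module_free(1))
  interpret \<epsilon>: module_hom free_scale s \<epsilon> by (rule hom)
  let ?F = "free_module r :: ('v, 'a) free set"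
  note subF = subspace_free_module[of r, where 'a = 'v and 'b = 'a]
  have conc: "(\<lambda>A. if A = {} then x else 0) \<in> koszul_cycles s' N 0" if "x \<in> N" "0 \<in> N" "module s'"
    for x N and s' :: "('v, 'a) mpoly \<Rightarrow> 'n::ab_group_add \<Rightarrow> 'n"
  proof -
    interpret module s' by (rule that(3))
    show ?thesis using that by (auto simp: koszul_cycles_def koszul_chains_def koszul_def fun_eq_iff)
  qed
  show ?thesis
  proof (rule iffI)
    assume "\<exists>j<r. b j = d"
    then obtain j where j: "j < r" "b j = d" by blast
    define e where "e = (single j 1 :: ('v, 'a) free)"
    have eF: "e \<in> ?F" using j(1) by (simp add: e_def free_module_def)
    have "(1 :: ('v, 'a) mpoly) \<in> ring_part c 0" using ring_part_Const[of 1] by simp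
    hence "e \<in> free_grading c b d" using j(2) by (auto simp: e_def free_grading_def lookup_single when_def ring_part_zero)
    hence egr: "\<epsilon> e \<in> gr d" using deg[of d] eF by (auto simp: free_part_eq)
    define z where "z = (\<lambda>A :: 'v set. if A = {} then \<epsilon> e else 0)"
    have "z \<in> koszul_cycles s (\<epsilon> ` ?F) 0"
      unfolding z_def using eF M.subspace_0[OF \<epsilon>.subspace_image[OF subF]] by (intro conc M.module_axioms) auto
    moreover have "z \<in> koszul_grading c gr d" using egr M.gr_zero by (simp add: z_def koszul_grading_def)
    moreover have "z \<notin> koszul_boundaries s (\<epsilon> ` ?F) 0"
    proof
      assume "z \<in> koszul_boundaries s (\<epsilon> ` ?F) 0"
      then obtain w where w: "w \<in> koszul_chains (\<epsilon> ` ?F) 1" "z = koszul s w"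
        by (auto simp: koszul_boundaries_def)
      obtain h where h: "h \<in> koszul_chains ?F 1" "(\<lambda>A. \<epsilon> (h A)) = w"
        using koszul_chains_lift[OF hom F.subspace_0[OF subF] w(1)] by blast
      have "z = (\<lambda>A. \<epsilon> (koszul free_scale h A))" using w(2) koszul_hom[OF hom, of h] h(2) by simp
      hence "\<epsilon> e = \<epsilon> (koszul free_scale h {})" unfolding z_def by (metis (full_types))
      hence z0: "\<epsilon> (e - koszul free_scale h {}) = 0" by (simp add: \<epsilon>.diff)
      have "koszul free_scale h \<in> koszul_chains ?F 0" using F.koszul_chains_koszul[OF subF, of h 0] h(1) by simp
      hence "e - koszul free_scale h {} \<in> ?F" using F.subspace_diff[OF subF eF] by (simp add: koszul_chains_def)
      \<comment> \<open>This relation has no constant term at j by minimality and the Koszul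
        boundary has none either, whereas the basis element has constant term 1.\<close>
      hence "lookup (lookup (e - koszul free_scale h {}) j) 0 = 0"
        using min z0 by (simp add: irrelevant_ideal_def)
      moreover have "lookup (lookup (koszul free_scale h {}) j) 0 = 0"
      proof -
        have "lookup (Var v :: ('v, 'a) mpoly) 0 = 0" for v
          using irrelevant_ideal_Var[of v, where 'b = 'a] by (simp add: irrelevant_ideal_def)
        thus ?thesis by (simp add: koszul_def lookup_sum lookup_free_scale lookup_mult_zero)
      qed
      ultimately show False by (simp add: lookup_minus e_def)
    qed
    ultimately show "koszul_homology_in_degree s c gr (\<epsilon> ` ?F) 0 d"
      unfolding koszul_homology_in_degree_def by blast
  next
    assume H: "koszul_homology_in_degree s c gr (\<epsilon> ` ?F) 0 d"
    show "\<exists>j<r. b j = d"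
    proof (rule ccontr)
      assume no: "\<not> ?thesis"
      have "z \<in> koszul_boundaries s (\<epsilon> ` ?F) 0" if z: "z \<in> koszul_cycles s (\<epsilon> ` ?F) 0" "z \<in> koszul_grading c gr d" for z
      proof -
        have zN: "z {} \<in> \<epsilon> ` ?F" and z0: "\<And>A. A \<noteq> {} \<Longrightarrow> z A = 0"
          using z(1) by (auto simp: koszul_cycles_def koszul_chains_def)
        have zgr: "z {} \<in> gr d" using z(2) by (auto simp: koszul_grading_def dest: spec[of _ "{}"])
        obtain f' where f': "f' \<in> ?F" "z {} = \<epsilon> f'" using zN by blast
        define f where "f = hcomp (free_grading c b) d f'"
        have fF: "f \<in> ?F" unfolding f_def by (rule hcomp_free_module[OF f'(1)])
        have fgr: "f \<in> free_grading c b d" unfolding f_def by (rule F.hcomp_in)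
        have "\<epsilon> f = hcomp gr d (\<epsilon> f')" unfolding f_def by (rule hcomp_free_hom[OF M hom deg f'(1)])
        hence ef: "\<epsilon> f = z {}" using M.hcomp_homogeneous[OF zgr] f'(2) by simp
        \<comment> \<open>A nonzero constant term at j would force the degree of the j-th basis
          element to be d, which no shift is.\<close>
        have irr: "lookup f j \<in> irrelevant_ideal" for j
        proof (rule ccontr)
          assume "lookup f j \<notin> irrelevant_ideal"
          hence n0: "lookup (lookup f j) 0 \<noteq> 0" by (simp add: irrelevant_ideal_def)
          moreover have "lookup f j \<in> ring_part c (d - b j)" using fgr by (simp add: free_grading_def)
          ultimately have "d - b j = 0" using ring_part_const_coeff by blast
          moreover have "lookup f j \<noteq> 0" using n0 by auto
          hence "j < r" using fF by (auto simp: free_module_def in_keys_iff)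
          ultimately show False using no by auto
        qed
        define y where "y = (\<lambda>A :: 'v set. if A = {} then f else 0)"
        have "y \<in> koszul_cycles free_scale ?F 0"
          unfolding y_def by (rule conc[OF fF F.subspace_0[OF subF] module_free_scale])
        hence "y \<in> koszul_boundaries free_scale ?F 0" by (rule free_koszul_acyclic) (simp add: y_def irr)
        then obtain h where h: "h \<in> koszul_chains ?F (Suc 0)" "y = koszul free_scale h"
          by (auto simp: koszul_boundaries_def)
        have "z = (\<lambda>A. \<epsilon> (y A))" using z0 ef by (auto simp: y_def fun_eq_iff \<epsilon>.zero)
        also have "\<dots> = koszul s (\<lambda>A. \<epsilon> (h A))" unfolding h(2) by (rule koszul_hom[OF hom, symmetric])
        finally show ?thesis
          unfolding koszul_boundaries_def using koszul_chains_hom[OF hom h(1)] by blast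
      qed
      with H show False unfolding koszul_homology_in_degree_def by blast
    qed
  qed
qed

text \<open>Repeated dimension shifting carries H_i(N) to H_0 of a syzygy, where the shifts are
  visible. The resolution may be infinite here, because the statement is also applied to a
  resolution under construction in order to show that it stops.\<close>

lemma koszul_homology_resolution:
  fixes s :: "('v::finite, 'a::field) mpoly \<Rightarrow> 'm::ab_group_add \<Rightarrow> 'm"
  assumes M: "graded_module s c gr" and hom: "module_hom free_scale s \<epsilon>"
    and homs: "\<And>i. module_hom free_scale free_scale (\<delta> i)"
    and deg: "\<And>d. \<epsilon> ` free_part c (r 0) (b 0) d \<subseteq> gr d"
    and degs: "\<And>i d. \<delta> i ` free_part c (r (Suc i)) (b (Suc i)) d \<subseteq> free_part c (r i) (b i) d"
    and img: "\<epsilon> ` free_module (r 0) = N"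
    and exact0: "\<delta> 0 ` free_module (r 1) = {f \<in> free_module (r 0). \<epsilon> f = 0}"
    and exact: "\<And>i. \<delta> (Suc i) ` free_module (r (Suc (Suc i))) = {f \<in> free_module (r (Suc i)). \<delta> i f = 0}"
    and min: "\<And>i f j. f \<in> free_module (r (Suc i)) \<Longrightarrow> lookup (\<delta> i f) j \<in> irrelevant_ideal"
  shows "koszul_homology_in_degree s c gr N i d \<longleftrightarrow> (\<exists>j<r i. b i j = d)"
proof -
  \<comment> \<open>\<open>K i\<close> is the image of F_(i+1) in F_i, the syzygy of order i + 1;
    hence the extra \<open>Suc\<close> in \<open>base\<close> and \<open>all\<close>.\<close>
  define K where "K i = \<delta> i ` free_module (r (Suc i))" for i
  have minK: "lookup f j \<in> irrelevant_ideal" if "f \<in> K i" for f i j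
    using that min by (auto simp: K_def)
  have K0: "K 0 = {f \<in> free_module (r 0). \<epsilon> f = 0}" using exact0 by (simp add: K_def)
  have KS: "K (Suc i) = {f \<in> free_module (r (Suc i)). \<delta> i f = 0}" for i using exact by (simp add: K_def)
  have degs': "\<delta> i ` free_part c (r (Suc i)) (b (Suc i)) d \<subseteq> free_grading c (b i) d" for i d
    using degs[of i d] by (auto simp: free_part_eq)
  have base: "koszul_homology_in_degree free_scale c (free_grading c (b i)) (K i) 0 d \<longleftrightarrow> (\<exists>j<r (Suc i). b (Suc i) j = d)" for i
    unfolding K_def
    by (rule koszul_homology_zero[OF graded_module_free(1) homs degs']) (use minK KS in blast)
  have step: "koszul_homology_in_degree free_scale c (free_grading c (b i)) (K i) (Suc n) d \<longleftrightarrow>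
      koszul_homology_in_degree free_scale c (free_grading c (b (Suc i))) (K (Suc i)) n d" for i n
    unfolding KS unfolding K_def
    by (rule koszul_homology_syzygy[OF graded_module_free(1) homs degs']) (use minK KS in blast)
  have all: "koszul_homology_in_degree free_scale c (free_grading c (b i)) (K i) n d \<longleftrightarrow>
      (\<exists>j<r (Suc (i + n)). b (Suc (i + n)) j = d)" for i n
    by (induct n arbitrary: i) (simp_all add: base step)
  show ?thesis
  proof (cases i)
    case 0
    show ?thesis unfolding 0 img[symmetric]
      by (rule koszul_homology_zero[OF M hom deg]) (use minK K0 in blast)
  next
    case (Suc n)
    have "koszul_homology_in_degree s c gr N (Suc n) d \<longleftrightarrow>
        koszul_homology_in_degree free_scale c (free_grading c (b 0)) (K 0) n d"
      unfolding img[symmetric] K0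
      by (rule koszul_homology_syzygy[OF M hom deg]) (use minK K0 in blast)
    thus ?thesis using all[of 0 n] Suc by simp
  qed
qed

section \<open>Existence and finite length of minimal resolutions\<close>

context mpoly_module
begin

lemma zero_in_koszul_boundaries:
  assumes "subspace N" shows "0 \<in> koszul_boundaries s N i"
proof -
  have "0 \<in> koszul_chains N (Suc i)" using subspace_0[OF assms] by (simp add: koszul_chains_def)
  thus ?thesis unfolding koszul_boundaries_def using koszul_zero by (metis image_eqI)
qed

text \<open>No set of variables has so many elements. Together with the description of the shifts,
  this yields Hilbert's syzygy theorem.\<close>

lemma koszul_homology_vanishes:
  assumes "subspace N" "i > CARD('v)" shows "\<not> koszul_homology_in_degree s c gr N i d"
proof -
  have "card A \<noteq> i" for A :: "'v set" using assms(2) card_mono[of UNIV A] by simp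
  hence "koszul_cycles s N i \<subseteq> {0}" by (auto simp: koszul_cycles_def koszul_chains_def fun_eq_iff)
  thus ?thesis using zero_in_koszul_boundaries[OF assms(1), of i] unfolding koszul_homology_in_degree_def by blast
qed

lemma koszul_homology_zero_module: "\<not> koszul_homology_in_degree s c gr {0} i d"
proof -
  have "koszul_cycles s {0} i \<subseteq> {0}" by (auto simp: koszul_cycles_def koszul_chains_def fun_eq_iff)
  thus ?thesis using zero_in_koszul_boundaries[of "{0}" i] unfolding koszul_homology_in_degree_def by auto
qed

end

context graded_module
begin

text \<open>Take a homogeneous generating set of least cardinality. A relation with a coefficient
  outside the irrelevant ideal would express one generator through the others, so that it could be
  dropped.\<close>

lemma minimal_cover_exists:
  assumes N: "graded_submodule N" and fg: "finite B" "N \<subseteq> span B"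
  shows "\<exists>r b \<epsilon>. module_hom free_scale s \<epsilon> \<and> (\<forall>d. \<epsilon> ` free_part c r b d \<subseteq> gr d) \<and> \<epsilon> ` free_module r = N \<and>
    (\<forall>f\<in>free_module r. \<epsilon> f = 0 \<longrightarrow> (\<forall>j. lookup f j \<in> irrelevant_ideal))"
proof -
  define P where "P H \<longleftrightarrow> finite H \<and> span H = N \<and> (\<forall>x\<in>H. \<exists>d. x \<in> gr d)" for H
  have "\<exists>H. P H" unfolding P_def by (rule graded_submodule_finitely_generated[OF N fg])
  then obtain H where PH: "P H" and least: "\<And>H'. P H' \<Longrightarrow> card H \<le> card H'"
    using ex_has_least_nat[of P _ card] by blast
  have H: "finite H" "span H = N" "\<And>x. x \<in> H \<Longrightarrow> \<exists>d. x \<in> gr d" using PH by (auto simp: P_def)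
  define r where "r = card H"
  obtain u where u: "bij_betw u {..<r} H"
    using ex_bij_betw_nat_finite[OF H(1)] by (auto simp: r_def lessThan_atLeast0)
  have uH: "u j \<in> H" if "j < r" for j using u that by (auto simp: bij_betw_def)
  have "\<forall>j. \<exists>d. j < r \<longrightarrow> u j \<in> gr d" using uH H(3) by blast
  then obtain b where b: "\<And>j. j < r \<Longrightarrow> u j \<in> gr (b j)" by metis
  define \<epsilon> where "\<epsilon> f = (\<Sum>j<r. s (lookup f j) (u j))" for f :: "('v, 'a) free"
  have hom: "module_hom free_scale s \<epsilon>"
    by (intro module_hom.intro module_free_scale module_axioms module_hom_axioms.intro)
      (simp_all add: \<epsilon>_def lookup_add lookup_free_scale scale_left_distrib sum.distrib scale_sum_right)
  interpret F: graded_module "free_scale :: ('v, 'a) mpoly \<Rightarrow> _" c "free_grading c b" by (rule graded_module_free(1))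
  interpret \<epsilon>: module_hom free_scale s \<epsilon> by (rule hom)
  note subF = subspace_free_module[of r, where 'a = 'v and 'b = 'a]
  have deg: "\<epsilon> f \<in> gr d" if "f \<in> free_grading c b d" for f d
    unfolding \<epsilon>_def
  proof (rule gr_sum)
    fix j assume "j \<in> {..<r}"
    hence "s (lookup f j) (u j) \<in> gr (d - b j + b j)"
      using that b by (intro gr_scale) (auto simp: free_grading_def)
    thus "s (lookup f j) (u j) \<in> gr d" by simp
  qed
  have img: "\<epsilon> ` free_module r = N"
  proof
    have "\<epsilon> f \<in> span H" for f
      unfolding \<epsilon>_def by (intro span_sum span_scale span_base) (use uH in auto)
    thus "\<epsilon> ` free_module r \<subseteq> N" using H(2) by auto
    have "x \<in> \<epsilon> ` free_module r" if x: "x \<in> H" for x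
    proof -
      obtain j where j: "j < r" "x = u j" using u x by (auto simp: bij_betw_def)
      have "\<epsilon> (single j 1) = (\<Sum>i<r. if i = j then u j else 0)"
        unfolding \<epsilon>_def by (rule sum.cong) (auto simp: lookup_single when_def)
      hence "\<epsilon> (single j 1) = x" using j by simp
      moreover have "single j 1 \<in> free_module r" using j(1) by (simp add: free_module_def)
      ultimately show ?thesis by blast
    qed
    thus "N \<subseteq> \<epsilon> ` free_module r"
      unfolding H(2)[symmetric] using \<epsilon>.subspace_image[OF subF] by (intro span_minimal) auto
  qed
  have min: "lookup f j \<in> irrelevant_ideal" if f: "f \<in> free_module r" "\<epsilon> f = 0" for f j
  proof (rule ccontr)
    assume "lookup f j \<notin> irrelevant_ideal"
    hence n0: "lookup (lookup f j) 0 \<noteq> 0" by (simp add: irrelevant_ideal_def)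
    hence "lookup f j \<noteq> 0" by auto
    hence j: "j < r" using f(1) by (auto simp: free_module_def in_keys_iff)
    \<comment> \<open>Passing to the degree of the j-th basis element turns the j-th coefficient
      into its constant term \<open>a\<close>, which is invertible.\<close>
    define f' where "f' = hcomp (free_grading c b) (b j) f"
    have "\<epsilon> f' = hcomp gr (b j) (\<epsilon> f)" unfolding f'_def
      by (rule hcomp_free_hom[OF graded_module_axioms hom _ f(1)]) (use deg in \<open>auto simp: free_part_eq\<close>)
    hence e0: "\<epsilon> f' = 0" by (simp add: f(2))
    define a where "a = lookup (lookup f' j) 0"
    have a: "a \<noteq> 0" using n0 by (simp add: a_def f'_def graded_module_free(2))
    have "f' \<in> free_grading c b (b j)" unfolding f'_def by (rule F.hcomp_in)
    hence "lookup f' j \<in> ring_part c (b j - b j)" unfolding free_grading_def by blast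
    hence lj: "lookup f' j = Const a"
      using ring_part_const_coeff a unfolding a_def by blast
    define t where "t = (\<Sum>i\<in>{..<r} - {j}. s (lookup f' i) (u i))"
    have "\<epsilon> f' = s (Const a) (u j) + t"
      unfolding \<epsilon>_def t_def using j lj by (subst sum.remove[of _ j]) auto
    hence "s (Const a) (u j) = - t" using e0 by (simp add: eq_neg_iff_add_eq_0)
    hence "s (Const (inverse a)) (s (Const a) (u j)) = s (Const (inverse a)) (- t)" by simp
    hence uj: "u j = s (Const (inverse a)) (- t)" using a by (simp flip: Const_mult)
    have "u i \<in> H - {u j}" if "i \<in> {..<r} - {j}" for i
      using that uH u j by (auto simp: bij_betw_def inj_on_def)
    hence "t \<in> span (H - {u j})" unfolding t_def by (intro span_sum span_scale span_base)
    hence "u j \<in> span (H - {u j})" by (subst uj) (intro span_scale span_neg)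
    hence "H \<subseteq> span (H - {u j})" using span_base[of _ "H - {u j}"] by blast
    hence "span H \<subseteq> span (H - {u j})" by (rule span_minimal) (rule subspace_span)
    moreover have "span (H - {u j}) \<subseteq> span H" by (rule span_mono) blast
    ultimately have "P (H - {u j})" using PH by (auto simp: P_def)
    hence "card H \<le> card (H - {u j})" by (rule least)
    moreover have "card (H - {u j}) < card H" using uH[OF j] H(1) by (intro card_Diff1_less)
    ultimately show False by simp
  qed
  have "\<epsilon> ` free_part c r b d \<subseteq> gr d" for d using deg by (auto simp: free_part_eq)
  thus ?thesis using hom img min by blast
qed

end

lemma free_module_finitely_generated:
  "\<exists>B. finite B \<and> (free_module r :: ('v, 'a::field) free set) \<subseteq> module.span free_scale B"
proof -
  interpret module "free_scale :: ('v, 'a) mpoly \<Rightarrow> _" by (rule module_free_scale)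
  define B where "B = (\<lambda>j. single j 1 :: ('v, 'a) free) ` {..<r}"
  have "f \<in> span B" if "f \<in> free_module r" for f
  proof -
    have "f = (\<Sum>j<r. free_scale (lookup f j) (single j 1))"
    proof (rule poly_mapping_eqI)
      fix i
      have "lookup (\<Sum>j<r. free_scale (lookup f j) (single j 1)) i =
          (\<Sum>j<r. if j = i then lookup f i else 0)"
        unfolding lookup_sum by (rule sum.cong) (auto simp: lookup_free_scale lookup_single when_def)
      also have "\<dots> = lookup f i"
        using that by (auto simp: free_module_def in_keys_iff subset_iff)
      finally show "lookup f i = lookup (\<Sum>j<r. free_scale (lookup f j) (single j 1)) i" ..
    qed
    also have "\<dots> \<in> span B" by (intro span_sum span_scale span_base) (auto simp: B_def)
    finally show ?thesis .
  qed
  thus ?thesis by (intro exI[of _ B]) (auto simp: B_def)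
qed

lemma graded_submodule_kernel:
  fixes s :: "('v::finite, 'a::field) mpoly \<Rightarrow> 'm::ab_group_add \<Rightarrow> 'm"
  assumes M: "graded_module s c gr" and hom: "module_hom free_scale s \<epsilon>"
    and deg: "\<And>d. \<epsilon> ` free_part c r b d \<subseteq> gr d"
  shows "graded_module.graded_submodule free_scale (free_grading c b) {f \<in> free_module r. \<epsilon> f = 0}"
proof -
  interpret M: graded_module s c gr by (rule M)
  interpret F: graded_module "free_scale :: ('v, 'a) mpoly \<Rightarrow> _" c "free_grading c b" by (rule graded_module_free(1))
  interpret \<epsilon>: module_hom free_scale s \<epsilon> by (rule hom)
  note subF = subspace_free_module[of r, where 'a = 'v and 'b = 'a]
  have "F.subspace {f \<in> free_module r. \<epsilon> f = 0}"
    using subF by (auto simp: F.subspace_def \<epsilon>.add \<epsilon>.scale \<epsilon>.zero)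
  moreover have "\<epsilon> (hcomp (free_grading c b) d f) = 0" if "f \<in> free_module r" "\<epsilon> f = 0" for f d
    using hcomp_free_hom[OF M hom deg that(1), of d] that(2) by simp
  ultimately show ?thesis by (simp add: F.graded_submodule_def hcomp_free_module)
qed

text \<open>Minimal covers of successive kernels are joined by dependent choice into an a priori
  infinite resolution; vanishing of Koszul homology bounds its length.\<close>

theorem minimal_graded_free_resolution_exists:
  fixes s :: "('v::finite, 'a::field) mpoly \<Rightarrow> 'm::ab_group_add \<Rightarrow> 'm" and c :: "'v \<Rightarrow> 'k::finite"
  assumes M: "graded_module s c gr" and N: "graded_module.graded_submodule s gr N"
    and fg: "finite B" "N \<subseteq> module.span s B"
  shows "\<exists>r b \<epsilon> \<delta>. minimal_graded_free_resolution s c gr N r b \<epsilon> \<delta>"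
proof -
  interpret M: graded_module s c gr by (rule M)
  obtain r0 b0 \<epsilon> where \<epsilon>: "module_hom free_scale s \<epsilon>" "\<And>d. \<epsilon> ` free_part c r0 b0 d \<subseteq> gr d"
    "\<epsilon> ` free_module r0 = N"
    "\<And>f j. f \<in> free_module r0 \<Longrightarrow> \<epsilon> f = 0 \<Longrightarrow> lookup f j \<in> irrelevant_ideal"
    using M.minimal_cover_exists[OF N fg] by metis
  \<comment> \<open>A state of the recursion holds the rank and shifts of the current free module,
    the map out of it, and the kernel still to be covered. In the initial state the map is a
    placeholder, as \<epsilon> has a different target type.\<close>
  define good where "good = (\<lambda>(r, b, \<delta> :: ('v, 'a) free \<Rightarrow> ('v, 'a) free, K :: ('v, 'a) free set).
     graded_module.graded_submodule free_scale (free_grading c b) K \<and> K \<subseteq> free_module r \<and>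
     (\<forall>f\<in>K. \<forall>j. lookup f j \<in> irrelevant_ideal))"
  define x0 where "x0 = (r0, b0, (\<lambda>f. 0) :: ('v, 'a) free \<Rightarrow> ('v, 'a) free, {f \<in> free_module r0. \<epsilon> f = 0})"
  define nxt where "nxt = (\<lambda>(r, b, \<delta> :: ('v, 'a) free \<Rightarrow> ('v, 'a) free, K :: ('v, 'a) free set) (r', b', \<delta>', K').
     module_hom free_scale free_scale \<delta>' \<and> (\<forall>d. \<delta>' ` free_part c r' b' d \<subseteq> free_part c r b d) \<and>
     \<delta>' ` free_module r' = K \<and> K' = {f \<in> free_module r'. \<delta>' f = 0})"
  have start: "\<exists>x. good x \<and> (0 = (0::nat) \<longrightarrow> x = x0)"
    using graded_submodule_kernel[OF M \<epsilon>(1,2)] \<epsilon>(4) by (intro exI[of _ x0]) (auto simp: good_def x0_def)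
  have step: "\<exists>y. (good y \<and> (Suc n = 0 \<longrightarrow> y = x0)) \<and> nxt x y" if x: "good x \<and> (n = 0 \<longrightarrow> x = x0)" for x n
  proof -
    obtain r b \<delta> K where xe: "x = (r, b, \<delta>, K)" by (metis prod_cases4)
    interpret F: graded_module "free_scale :: ('v, 'a) mpoly \<Rightarrow> _" c "free_grading c b" by (rule graded_module_free(1))
    have K: "F.graded_submodule K" "K \<subseteq> free_module r" using x by (auto simp: xe good_def)
    obtain B where B: "finite B" "(free_module r :: ('v, 'a) free set) \<subseteq> F.span B"
      using free_module_finitely_generated by blast
    have "K \<subseteq> F.span B" using K(2) B(2) by blast
    then obtain r' b' \<delta>' where \<delta>': "module_hom free_scale free_scale \<delta>'"
      "\<And>d. \<delta>' ` free_part c r' b' d \<subseteq> free_grading c b d" "\<delta>' ` free_module r' = K"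
      "\<And>f j. f \<in> free_module r' \<Longrightarrow> \<delta>' f = 0 \<Longrightarrow> lookup f j \<in> irrelevant_ideal"
      using F.minimal_cover_exists[OF K(1) B(1)] by metis
    have "\<delta>' ` free_part c r' b' d \<subseteq> free_part c r b d" for d
    proof -
      have "\<delta>' ` free_part c r' b' d \<subseteq> K" using \<delta>'(3) by (auto simp: free_part_eq)
      thus ?thesis using \<delta>'(2)[of d] K(2) unfolding free_part_eq[of c r b] by blast
    qed
    moreover have "good (r', b', \<delta>', {f \<in> free_module r'. \<delta>' f = 0})"
      using graded_submodule_kernel[OF graded_module_free(1) \<delta>'(1,2)] \<delta>'(4) by (auto simp: good_def)
    ultimately show ?thesis using \<delta>'(1,3)
      by (intro exI[of _ "(r', b', \<delta>', {f \<in> free_module r'. \<delta>' f = 0})"]) (simp add: nxt_def xe)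
  qed
  obtain X where X: "\<And>n. good (X n) \<and> (n = 0 \<longrightarrow> X n = x0)" "\<And>n. nxt (X n) (X (Suc n))"
    using dependent_nat_choice[of "\<lambda>n x. good x \<and> (n = 0 \<longrightarrow> x = x0)" "\<lambda>n. nxt", OF start step] by metis
  define r where "r n = fst (X n)" for n
  define b where "b n = fst (snd (X n))" for n
  \<comment> \<open>The map stored with the (n+1)-st module is the differential with index
    n.\<close>
  define \<delta> where "\<delta> n = fst (snd (snd (X (Suc n))))" for n
  define K where "K n = snd (snd (snd (X n)))" for n
  have Xe: "X (Suc n) = (r (Suc n), b (Suc n), \<delta> n, K (Suc n))" for n
    by (simp add: r_def b_def \<delta>_def K_def)
  have X0: "r 0 = r0" "b 0 = b0" "K 0 = {f \<in> free_module r0. \<epsilon> f = 0}"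
    using X(1)[of 0] by (simp_all add: r_def b_def K_def x0_def)
  define q where "q n = fst (snd (snd (X n)))" for n
  have Xe': "X n = (r n, b n, q n, K n)" for n
    by (simp add: r_def b_def q_def K_def)
  have nx: "module_hom free_scale free_scale (\<delta> n)"
    "\<delta> n ` free_part c (r (Suc n)) (b (Suc n)) d \<subseteq> free_part c (r n) (b n) d"
    "\<delta> n ` free_module (r (Suc n)) = K n" "K (Suc n) = {f \<in> free_module (r (Suc n)). \<delta> n f = 0}" for n d
    using X(2)[of n] unfolding Xe'[of n] Xe[of n] nxt_def by auto
  have Kmin: "lookup f j \<in> irrelevant_ideal" if "f \<in> K n" for f n j
    using X(1)[of n] that unfolding Xe'[of n] good_def by auto
  have min: "lookup (\<delta> n f) j \<in> irrelevant_ideal" if "f \<in> free_module (r (Suc n))" for n f j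
    using Kmin nx(3) that by blast
  have exact0: "\<delta> 0 ` free_module (r 1) = {f \<in> free_module (r 0). \<epsilon> f = 0}" using nx(3)[of 0] X0 by simp
  have exact: "\<delta> (Suc i) ` free_module (r (Suc (Suc i))) = {f \<in> free_module (r (Suc i)). \<delta> i f = 0}" for i
    using nx(3)[of "Suc i"] nx(4)[of i] by simp
  have HK: "koszul_homology_in_degree s c gr N i d \<longleftrightarrow> (\<exists>j<r i. b i j = d)" for i d
    by (rule koszul_homology_resolution[OF M \<epsilon>(1) nx(1) _ nx(2) _ exact0 exact min]) (use \<epsilon> X0 in auto)
  \<comment> \<open>A basis element of F_i would produce homology beyond the number of
    variables.\<close>
  have "r i = 0" if "i > CARD('v)" for i
  proof (rule ccontr)
    assume "r i \<noteq> 0"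
    hence "koszul_homology_in_degree s c gr N i (b i 0)" using HK by auto
    moreover have "M.subspace N" using N by (simp add: M.graded_submodule_def)
    ultimately show False using M.koszul_homology_vanishes[OF _ that] by blast
  qed
  hence "\<exists>p. \<forall>i>p. r i = 0" by blast
  hence "minimal_graded_free_resolution s c gr N r b \<epsilon> \<delta>"
    unfolding minimal_graded_free_resolution_def
    using \<epsilon>(1-3) X0 nx(1,2) exact0 exact min by auto
  thus ?thesis by blast
qed

section \<open>Filtrations by the powers of an ideal\<close>

lemma prod_pow_ring_part:
  fixes c :: "'v::finite \<Rightarrow> 'k::finite"
  assumes "finite A" "\<And>j. j \<in> A \<Longrightarrow> g j \<in> ring_part c (e j)"
  shows "(\<Prod>j\<in>A. g j ^ \<alpha> j) \<in> ring_part c (\<chi> l. \<Sum>j\<in>A. e j $ l * int (\<alpha> j))"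
  using assms
proof induct
  case empty
  have "(\<chi> l. 0) = (0 :: int ^ 'k)" by (simp add: vec_eq_iff)
  thus ?case using ring_part_Const[of 1 c] by simp
next
  case (insert i A)
  have pow: "g i ^ n \<in> ring_part c (\<chi> l. e i $ l * int n)" for n
  proof (induct n)
    case 0
    have "(\<chi> l. 0) = (0 :: int ^ 'k)" by (simp add: vec_eq_iff)
    thus ?case using ring_part_Const[of 1 c] by simp
  next
    case (Suc n)
    have "g i * g i ^ n \<in> ring_part c (e i + (\<chi> l. e i $ l * int n))"
      using insert(4) Suc by (intro ring_part_mult) auto
    moreover have "e i + (\<chi> l. e i $ l * int n) = (\<chi> l. e i $ l * int (Suc n))"
      by (simp add: vec_eq_iff algebra_simps)
    ultimately show ?case by simp
  qed
  have "g i ^ \<alpha> i * (\<Prod>j\<in>A. g j ^ \<alpha> j) \<in>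
      ring_part c ((\<chi> l. e i $ l * int (\<alpha> i)) + (\<chi> l. \<Sum>j\<in>A. e j $ l * int (\<alpha> j)))"
    using insert by (intro ring_part_mult pow) auto
  moreover have "(\<chi> l. e i $ l * int (\<alpha> i)) + (\<chi> l. \<Sum>j\<in>A. e j $ l * int (\<alpha> j)) =
      (\<chi> l. \<Sum>j\<in>insert i A. e j $ l * int (\<alpha> j))"
    using insert by (simp add: vec_eq_iff)
  ultimately show ?case using insert by simp
qed

context mpoly_module
begin

lemma scale_prod_pow_filtration:
  assumes "finite A" and T: "\<And>j n y. j \<in> A \<Longrightarrow> y \<in> T n \<Longrightarrow> s (g j) y \<in> T (Suc n)" and y: "y \<in> T n"
  shows "s (\<Prod>j\<in>A. g j ^ \<alpha> j) y \<in> T (n + sum \<alpha> A)"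
  using assms(1) T
proof induct
  case empty
  show ?case using y by simp
next
  case (insert i A)
  have pow: "s (g i ^ k) x \<in> T (m + k)" if "x \<in> T m" for x m k
  proof (induct k)
    case (Suc k)
    have "s (g i) (s (g i ^ k) x) \<in> T (Suc (m + k))" using Suc insert(4) by blast
    thus ?case by simp
  qed (simp add: that)
  have "s (\<Prod>j\<in>A. g j ^ \<alpha> j) y \<in> T (n + sum \<alpha> A)" using insert by blast
  from pow[OF this, of "\<alpha> i"] show ?case using insert(1,2) by (simp add: add_ac)
qed

lemma subspace_scale_vimage:
  assumes "subspace S" shows "subspace {x. s h x \<in> S}"
proof -
  have "s h (s p x) \<in> S" if "s h x \<in> S" for p x
    unfolding scale_swap[of h p] using assms that by (rule subspace_scale)
  thus ?thesis
    using assms by (intro subspaceI) (auto simp: subspace_0 subspace_add scale_right_distrib simp del: scale_scale)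
qed

section \<open>The submodules I^n M and the Rees module\<close>

lemma subspace_power_submodule: "subspace (power_submodule s I n)"
  by (simp add: power_submodule_def)

lemma power_submodule_0: "power_submodule s I 0 = UNIV"
proof -
  have "UNIV \<subseteq> {s f x | f x. f \<in> ideal_power I 0}"
  proof
    fix x
    have "x = s 1 x" by simp
    hence "\<exists>f y. x = s f y \<and> f \<in> ideal_power I 0" by (intro exI[of _ 1] exI[of _ x]) simp
    thus "x \<in> {s f x | f x. f \<in> ideal_power I 0}" by simp
  qed
  thus ?thesis unfolding power_submodule_def using span_superset by blast
qed

lemma module_mult: "module ((*) :: ('v, 'a) mpoly \<Rightarrow> _)"
  by unfold_locales (simp_all add: algebra_simps)

lemma power_submodule_Suc:
  assumes g: "h \<in> I" and x: "x \<in> power_submodule s I n"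
  shows "s h x \<in> power_submodule s I (Suc n)"
proof -
  interpret S: module "(*) :: ('v, 'a) mpoly \<Rightarrow> _" by (rule module_mult)
  have "{s f x | f x. f \<in> ideal_power I n} \<subseteq> {x. s h x \<in> power_submodule s I (Suc n)}"
  proof
    fix y assume "y \<in> {s f x | f x. f \<in> ideal_power I n}"
    then obtain f x where f: "y = s f x" "f \<in> ideal_power I n" by blast
    have "h * f \<in> ideal_power I (Suc n)"
      unfolding ideal_power.simps ideal_gen_def by (rule S.span_base) (use g f in blast)
    hence "s (h * f) x \<in> power_submodule s I (Suc n)"
      unfolding power_submodule_def by (intro span_base) blast
    thus "y \<in> {x. s h x \<in> power_submodule s I (Suc n)}" using f(1) by simp
  qed
  moreover have "subspace {x. s h x \<in> power_submodule s I (Suc n)}"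
    by (rule subspace_scale_vimage[OF subspace_power_submodule])
  ultimately show ?thesis using x span_minimal unfolding power_submodule_def by blast
qed

text \<open>Characterizes I^n M as the least family of submodules that starts with M and is raised
  by one index by the generators. Later inclusions for I^n M thus need checking on generators
  only.\<close>

lemma power_submodule_least:
  assumes I: "I = ideal_gen G" and Q: "\<And>n. subspace (Q n)" "Q 0 = UNIV"
    and step: "\<And>h n x. h \<in> G \<Longrightarrow> x \<in> Q n \<Longrightarrow> s h x \<in> Q (Suc n)"
  shows "power_submodule s I n \<subseteq> Q n"
proof -
  interpret S: module "(*) :: ('v, 'a) mpoly \<Rightarrow> _" by (rule module_mult)
  have stepI: "s h x \<in> Q (Suc n)" if h: "h \<in> I" and x: "x \<in> Q n" for h x n
  proof -
    have "G \<subseteq> {h. s h x \<in> Q (Suc n)}" using step x by blast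
    moreover have "S.subspace {h. s h x \<in> Q (Suc n)}"
      using Q(1)[of "Suc n"] by (intro S.subspaceI)
        (auto simp: subspace_0 subspace_add subspace_scale scale_left_distrib simp flip: scale_scale)
    ultimately have "ideal_gen G \<subseteq> {h. s h x \<in> Q (Suc n)}" unfolding ideal_gen_def by (rule S.span_minimal)
    thus ?thesis using h I by blast
  qed
  have "\<forall>f\<in>ideal_power I n. \<forall>x. s f x \<in> Q n"
  proof (induct n)
    case 0
    show ?case by (simp add: Q(2))
  next
    case (Suc n)
    let ?K = "{f. \<forall>x. s f x \<in> Q (Suc n)}"
    have "{f * h |f h. f \<in> I \<and> h \<in> ideal_power I n} \<subseteq> ?K"
    proof
      fix y assume "y \<in> {f * h |f h. f \<in> I \<and> h \<in> ideal_power I n}"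
      then obtain f h where "y = f * h" "f \<in> I" "h \<in> ideal_power I n" by blast
      thus "y \<in> ?K" using Suc stepI by (simp flip: scale_scale)
    qed
    moreover have "S.subspace ?K"
      using Q(1)[of "Suc n"] by (intro S.subspaceI)
        (auto simp: subspace_0 subspace_add subspace_scale scale_left_distrib simp flip: scale_scale)
    ultimately have "ideal_power I (Suc n) \<subseteq> ?K"
      unfolding ideal_power.simps ideal_gen_def by (rule S.span_minimal)
    thus ?case by blast
  qed
  hence "{s f x | f x. f \<in> ideal_power I n} \<subseteq> Q n" by blast
  thus ?thesis unfolding power_submodule_def by (rule span_minimal) (rule Q(1))
qed

text \<open>
  A sequence \<open>F\<close> with finitely many nonzero terms stands for the element \<open>\<Sum>\<^sub>n F n t\<^sup>n\<close> of
  \<open>M[t]\<close>, and \<open>rees_shift h\<close> for multiplication by \<open>h t\<close>.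
\<close>

definition rees_shift :: "('v, 'a) mpoly \<Rightarrow> (nat \<Rightarrow> 'n) \<Rightarrow> nat \<Rightarrow> 'n" where
  "rees_shift h F n = (case n of 0 \<Rightarrow> 0 | Suc m \<Rightarrow> s h (F m))"

definition rees_ops :: "('j \<Rightarrow> ('v, 'a) mpoly) \<Rightarrow> 'j set \<Rightarrow> ((nat \<Rightarrow> 'n) \<Rightarrow> nat \<Rightarrow> 'n) set" where
  "rees_ops g J = const_ops (\<lambda>p F n. s p (F n)) \<union> (var_ops (\<lambda>p F n. s p (F n)) \<union> (\<lambda>j. rees_shift (g j)) ` J)"

text \<open>The generators of M, placed in t-degree 0, span a Noetherian space over the constants.
  Adjoining the variables and the operators g_j t gives a Noetherian module that contains the Rees
  module, and the sum of the Z_n t^n is a closed subset of it.\<close>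

lemma rees_filtration_finitely_generated:
  assumes J: "finite J" and fg: "finite B" "span B = UNIV"
    and Z: "\<And>n. subspace (Z n)" "\<And>n. Z n \<subseteq> power_submodule s (ideal_gen (g ` J)) n"
    and ZS: "\<And>j n x. j \<in> J \<Longrightarrow> x \<in> Z n \<Longrightarrow> s (g j) x \<in> Z (Suc n)"
  shows "\<exists>G. finite G \<and> G \<subseteq> {F. (\<forall>n. F n \<in> Z n) \<and> finite {n. F n \<noteq> 0}} \<and>
    (\<forall>Y. op_closed (rees_ops g J) Y \<and> G \<subseteq> Y \<longrightarrow> {F. (\<forall>n. F n \<in> Z n) \<and> finite {n. F n \<noteq> 0}} \<subseteq> Y)"
proof -
  define sR where "sR = (\<lambda>p (F :: nat \<Rightarrow> 'n) n. s p (F n))"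
  interpret R: mpoly_module sR
    by (unfold_locales) (auto simp: sR_def fun_eq_iff scale_right_distrib scale_left_distrib)
  define ops where ops_eq: "ops = rees_ops g J"
  have ops_def: "ops = const_ops sR \<union> (var_ops sR \<union> (\<lambda>j. rees_shift (g j)) ` J)"
    by (simp add: ops_eq rees_ops_def sR_def)
  have shift_add: "additive (rees_shift h)" for h
    by (auto simp: additive_def rees_shift_def fun_eq_iff scale_right_distrib split: nat.split)
  have shift_sR: "sR p (rees_shift h F) = rees_shift h (sR p F)" for p h F
    by (auto simp: sR_def rees_shift_def fun_eq_iff mult.commute split: nat.split)
  have shift_shift: "rees_shift h (rees_shift h' F) = rees_shift h' (rees_shift h F)" for h h' F
    by (auto simp: rees_shift_def fun_eq_iff mult.commute split: nat.split)
  define in_degree where "in_degree k x = (\<lambda>n. if n = k then x else 0)" for k :: nat and x :: 'n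
  obtain N0 where N0: "in_degree 0 ` B \<subseteq> N0" "op_closed (const_ops sR) N0" "op_noetherian (const_ops sR) N0"
    using R.op_noetherian_const_span[of "in_degree 0 ` B"] fg(1) by blast
  have "\<exists>N'. N0 \<subseteq> N' \<and> op_closed ops N' \<and> op_noetherian ops N'"
    unfolding ops_def
  proof (rule op_noetherian_adjoin_finite[OF _ _ _ N0(2,3)])
    show "finite (var_ops sR \<union> (\<lambda>j. rees_shift (g j)) ` J)" using J by (simp add: var_ops_def)
    show "additive f" if "f \<in> const_ops sR \<union> (var_ops sR \<union> (\<lambda>j. rees_shift (g j)) ` J)" for f
      using that R.additive_scale shift_add by (auto simp: const_ops_def var_ops_def)
    show "f (y x) = y (f x)" if "f \<in> const_ops sR \<union> (var_ops sR \<union> (\<lambda>j. rees_shift (g j)) ` J)"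
      "y \<in> var_ops sR \<union> (\<lambda>j. rees_shift (g j)) ` J" for f y x
      using that R.scale_swap shift_sR shift_shift
      by (auto simp: const_ops_def var_ops_def mult.commute simp del: R.scale_scale)
  qed
  then obtain N1 where N1: "N0 \<subseteq> N1" "op_closed ops N1" "op_noetherian ops N1" by blast
  have N1m: "op_closed (const_ops sR \<union> var_ops sR) N1"
    by (rule op_closed_mono[OF N1(2)]) (auto simp: ops_def)
  hence N1s: "R.subspace N1" by (simp only: R.op_closed_iff_subspace)
  \<comment> \<open>\<open>Q n\<close> is the set of x with x t^n in \<open>N1\<close>; the
    minimality of I^n M shows that it contains I^n M.\<close>
  define Q where "Q n = {x. in_degree n x \<in> N1}" for n
  have in_degree_add: "in_degree n (x + y) = in_degree n x + in_degree n y" and in_degree_scale: "in_degree n (s p x) = sR p (in_degree n x)"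
    and in_degree_0: "in_degree n 0 = 0" for n x y p
    by (auto simp: in_degree_def sR_def fun_eq_iff)
  have Q: "subspace (Q n)" for n
    using N1s by (auto simp: Q_def subspace_def R.subspace_def in_degree_add in_degree_scale in_degree_0)
  have "B \<subseteq> Q 0" using N0(1) N1(1) by (auto simp: Q_def)
  hence "span B \<subseteq> Q 0" using Q by (rule span_minimal)
  hence Q0: "Q 0 = UNIV" using fg(2) by auto
  have QS: "s (g j) x \<in> Q (Suc n)" if "j \<in> J" "x \<in> Q n" for j n x
  proof -
    have "rees_shift (g j) (in_degree n x) = in_degree (Suc n) (s (g j) x)"
      by (auto simp: rees_shift_def in_degree_def fun_eq_iff split: nat.split)
    moreover have "rees_shift (g j) (in_degree n x) \<in> N1"
      using that op_closed_op[OF N1(2), of "rees_shift (g j)"] by (auto simp: Q_def ops_def)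
    ultimately show ?thesis by (simp add: Q_def)
  qed
  have "power_submodule s (ideal_gen (g ` J)) n \<subseteq> Q n" for n
    by (rule power_submodule_least[where Q = Q, OF refl Q Q0]) (use QS in blast)
  hence ZQ: "Z n \<subseteq> Q n" for n using Z(2) by blast
  define RZ where "RZ = {F. (\<forall>n. F n \<in> Z n) \<and> finite {n. F n \<noteq> 0}}"
  have RZ_N1: "RZ \<subseteq> N1"
  proof
    fix F assume F: "F \<in> RZ"
    have "F = (\<Sum>n | F n \<noteq> 0. in_degree n (F n))"
    proof
      fix m
      have "(\<Sum>n | F n \<noteq> 0. in_degree n (F n)) m = (\<Sum>n | F n \<noteq> 0. if n = m then F m else 0)"
        unfolding sum_fun_apply by (rule sum.cong) (auto simp: in_degree_def)
      also have "\<dots> = F m" using F by (simp add: RZ_def)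
      finally show "F m = (\<Sum>n | F n \<noteq> 0. in_degree n (F n)) m" ..
    qed
    moreover have "in_degree n (F n) \<in> N1" for n using F ZQ[of n] by (auto simp: RZ_def Q_def)
    hence "(\<Sum>n | F n \<noteq> 0. in_degree n (F n)) \<in> N1" by (intro op_closed_sum[OF N1(2)])
    ultimately show "F \<in> N1" by simp
  qed
  have fin_shift: "finite {n. rees_shift h F n \<noteq> 0}" if "finite {n. F n \<noteq> 0}" for h F
  proof -
    have "{n. rees_shift h F n \<noteq> 0} \<subseteq> Suc ` {n. F n \<noteq> 0}"
    proof
      fix n assume "n \<in> {n. rees_shift h F n \<noteq> 0}"
      thus "n \<in> Suc ` {n. F n \<noteq> 0}" by (cases n) (auto simp: rees_shift_def)
    qed
    thus ?thesis using that finite_subset by blast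
  qed
  have fin_sR: "finite {n. sR p F n \<noteq> 0}" if "finite {n. F n \<noteq> 0}" for p F
    by (rule finite_subset[OF _ that]) (auto simp: sR_def)
  have fin_diff: "finite {n. (F - F') n \<noteq> 0}" if "finite {n. F n \<noteq> 0}" "finite {n. F' n \<noteq> 0}" for F F' :: "nat \<Rightarrow> 'n"
    by (rule finite_subset[of _ "{n. F n \<noteq> 0} \<union> {n. F' n \<noteq> 0}"]) (use that in auto)
  have "op_closed ops RZ"
    unfolding op_closed_def
  proof (intro conjI ballI)
    show "0 \<in> RZ" using subspace_0[OF Z(1)] by (simp add: RZ_def)
    show "F - F' \<in> RZ" if "F \<in> RZ" "F' \<in> RZ" for F F'
      using that subspace_diff[OF Z(1)] fin_diff[of F F'] by (simp add: RZ_def)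
    show "f F \<in> RZ" if f: "f \<in> ops" and F: "F \<in> RZ" for f F
    proof -
      consider p where "f = sR p" | j where "j \<in> J" "f = rees_shift (g j)"
        using f by (auto simp: ops_def const_ops_def var_ops_def)
      thus ?thesis
      proof cases
        case 1
        thus ?thesis using F fin_sR[of F] subspace_scale[OF Z(1)] by (simp add: RZ_def) (simp add: sR_def)
      next
        case 2
        thus ?thesis using F fin_shift[of F] ZS subspace_0[OF Z(1)]
          by (simp add: RZ_def) (simp add: rees_shift_def split: nat.split)
      qed
    qed
  qed
  with N1(3) RZ_N1 have "\<exists>G. finite G \<and> G \<subseteq> RZ \<and> (\<forall>Y. op_closed ops Y \<and> G \<subseteq> Y \<longrightarrow> RZ \<subseteq> Y)"
    by (simp add: op_noetherian_def)
  thus ?thesis by (simp only: RZ_def ops_eq)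
qed

end

section \<open>Degrees in quotients of two filtrations\<close>

context graded_module
begin

text \<open>\<open>Z\<close> and \<open>W\<close> stand for cycles and boundaries. By
  \<open>ZW\<close> the variables kill Z_n / W_n, so the generators of \<Oplus> Z_n over the Rees
  operators give, with the monomials in the g_j, spanning classes over the field. The offset
  \<open>t\<close> makes room for the term -i of the regularity.\<close>

theorem max_degree_eventually_linear:
  fixes Z W :: "nat \<Rightarrow> 'm set" and e :: "'j \<Rightarrow> int ^ 'k"
  assumes J: "finite J" and fg: "finite B" "span B = UNIV"
    and g: "\<And>j. j \<in> J \<Longrightarrow> g j \<in> ring_part c (e j)"
    and Z: "\<And>n. graded_submodule (Z n)" "\<And>n. Z n \<subseteq> power_submodule s (ideal_gen (g ` J)) n"
    and ZS: "\<And>j n x. j \<in> J \<Longrightarrow> x \<in> Z n \<Longrightarrow> s (g j) x \<in> Z (Suc n)"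
    and W: "\<And>n. graded_submodule (W n)"
    and WS: "\<And>j n x. j \<in> J \<Longrightarrow> x \<in> W n \<Longrightarrow> s (g j) x \<in> W (Suc n)"
    and ZW: "\<And>v n x. x \<in> Z n \<Longrightarrow> s (Var v) x \<in> W n"
    and bound: "\<And>j. j \<in> J \<Longrightarrow> e j $ l \<le> D"
  shows "max_eventually_linear D (\<lambda>n. {d $ l + t | d. \<not> Z n \<inter> gr d \<subseteq> W n})"
proof -
  have Zs: "subspace (Z n)" and Zc: "\<And>x d. x \<in> Z n \<Longrightarrow> hcomp gr d x \<in> Z n" for n
    using Z(1)[of n] by (auto simp: graded_submodule_def)
  have Ws: "subspace (W n)" for n using W[of n] by (auto simp: graded_submodule_def)
  define RZ where "RZ = {F. (\<forall>n. F n \<in> Z n) \<and> finite {n. F n \<noteq> 0}}"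
  obtain G where G: "finite G" "G \<subseteq> RZ"
    "\<And>Y. op_closed (rees_ops g J) Y \<Longrightarrow> G \<subseteq> Y \<Longrightarrow> RZ \<subseteq> Y"
  proof -
    have "\<exists>G. finite G \<and> G \<subseteq> RZ \<and> (\<forall>Y. op_closed (rees_ops g J) Y \<and> G \<subseteq> Y \<longrightarrow> RZ \<subseteq> Y)"
      unfolding RZ_def by (rule rees_filtration_finitely_generated[OF J fg Zs Z(2)]) (rule ZS)
    thus ?thesis by (elim exE conjE) (rule that, assumption+, simp)
  qed
  define mon where "mon \<alpha> = (\<Prod>j\<in>J. g j ^ \<alpha> j)" for \<alpha>
  define dg where "dg \<alpha> = (\<chi> l. \<Sum>j\<in>J. e j $ l * int (\<alpha> j))" for \<alpha> :: "'j \<Rightarrow> nat"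
  have mon_part: "mon \<alpha> \<in> ring_part c (dg \<alpha>)" for \<alpha>
    unfolding mon_def dg_def by (rule prod_pow_ring_part[OF J g])
  have mon_add: "mon (\<alpha> + \<beta>) = mon \<alpha> * mon \<beta>" for \<alpha> \<beta>
    by (simp add: mon_def power_add prod.distrib)
  have mon_Z: "s (mon \<alpha>) y \<in> Z (n + sum \<alpha> J)" if "y \<in> Z n" for \<alpha> y n
    unfolding mon_def by (rule scale_prod_pow_filtration[OF J ZS that])
  have mon_W: "s (mon \<alpha>) y \<in> W (n + sum \<alpha> J)" if "y \<in> W n" for \<alpha> y n
    unfolding mon_def by (rule scale_prod_pow_filtration[OF J WS that])
  \<comment> \<open>Homogeneous components of the generators, each recorded with its t-degree and
    its degree.\<close>
  define U where "U = (\<Union>F\<in>G. \<Union>n\<in>{n. F n \<noteq> 0}. (\<lambda>d. (hcomp gr d (F n), n, d)) ` {d. hcomp gr d (F n) \<noteq> 0})"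
  have finU: "finite U"
    unfolding U_def using G(1,2) finite_hcomp by (intro finite_UN_I finite_imageI) (auto simp: RZ_def)
  have UZ: "x \<in> Z m" and Ugr: "x \<in> gr \<delta>" if "(x, m, \<delta>) \<in> U" for x m \<delta>
    using that G(2) Zc hcomp_in by (auto simp: U_def RZ_def)
  define gens where "gens n d = {s (mon \<alpha>) x | x m \<delta> \<alpha>. (x, m, \<delta>) \<in> U \<and> \<alpha> \<in> exps J \<and> m + sum \<alpha> J = n \<and> \<delta> + dg \<alpha> = d}" for n d
  \<comment> \<open>The monomial multiples of exact degree d, modulo \<open>W n\<close>. The set
    \<open>Y\<close> below shows that they account for all of \<open>Z n\<close> in degree
    d.\<close>
  define T where "T n d = span (W n \<union> gens n d)" for n d
  have T_step: "s (g j) y \<in> T (Suc n) (d + e j)" if j: "j \<in> J" and y: "y \<in> T n d" for j y n d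
  proof -
    have "W n \<union> gens n d \<subseteq> {y. s (g j) y \<in> T (Suc n) (d + e j)}"
    proof
      fix y assume "y \<in> W n \<union> gens n d"
      thus "y \<in> {y. s (g j) y \<in> T (Suc n) (d + e j)}"
      proof
        assume "y \<in> W n"
        thus ?thesis using WS[OF j] by (auto simp: T_def intro: span_base)
      next
        assume "y \<in> gens n d"
        then obtain x m \<delta> \<alpha> where u: "y = s (mon \<alpha>) x" "(x, m, \<delta>) \<in> U" "\<alpha> \<in> exps J" "m + sum \<alpha> J = n" "\<delta> + dg \<alpha> = d"
          unfolding gens_def by blast
        define \<epsilon> where "\<epsilon> i = (if i = j then 1 else 0 :: nat)" for i
        have "mon \<epsilon> = (\<Prod>i\<in>J. if i = j then g j else 1)"
          unfolding mon_def by (rule prod.cong) (auto simp: \<epsilon>_def)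
        hence "mon \<epsilon> = g j" using J j by simp
        hence m: "mon (\<epsilon> + \<alpha>) = g j * mon \<alpha>" by (simp add: mon_add)
        have "sum \<epsilon> J = 1" using J j by (simp add: \<epsilon>_def)
        hence 1: "m + sum (\<epsilon> + \<alpha>) J = Suc n" using u(4) by (simp add: sum.distrib)
        have 2: "\<delta> + dg (\<epsilon> + \<alpha>) = d + e j"
        proof -
          have "(\<Sum>i\<in>J. e i $ l * int (\<epsilon> i)) = (\<Sum>i\<in>J. if i = j then e j $ l else 0)" for l
            by (rule sum.cong) (auto simp: \<epsilon>_def)
          hence "(\<Sum>i\<in>J. e i $ l * int (\<epsilon> i)) = e j $ l" for l using J j by simp
          hence "dg (\<epsilon> + \<alpha>) = e j + dg \<alpha>" by (simp add: dg_def vec_eq_iff algebra_simps sum.distrib)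
          thus ?thesis using u(5) by (simp add: algebra_simps)
        qed
        have 3: "\<epsilon> + \<alpha> \<in> exps J" using u(3) j by (auto simp: exps_def \<epsilon>_def)
        have "s (mon (\<epsilon> + \<alpha>)) x \<in> gens (Suc n) (d + e j)" unfolding gens_def using u(2) 1 2 3 by blast
        hence "s (g j) y \<in> gens (Suc n) (d + e j)" using u(1) m by simp
        thus ?thesis by (auto simp: T_def intro: span_base)
      qed
    qed
    moreover have "subspace {y. s (g j) y \<in> T (Suc n) (d + e j)}"
      unfolding T_def by (rule subspace_scale_vimage[OF subspace_span])
    ultimately have "T n d \<subseteq> {y. s (g j) y \<in> T (Suc n) (d + e j)}" unfolding T_def[of n d] by (rule span_minimal)
    thus ?thesis using y by blast
  qed
  define Y where "Y = {F. \<forall>n. F n \<in> Z n \<and> (\<forall>d. hcomp gr d (F n) \<in> T n d)}"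
  have "RZ \<subseteq> Y"
  proof (rule G(3))
    have shift: "\<forall>j\<in>J. \<forall>F\<in>Y. rees_shift (g j) F \<in> Y"
    proof (intro ballI)
      fix j F assume j: "j \<in> J" and F: "F \<in> Y"
      have "rees_shift (g j) F n \<in> Z n \<and> (\<forall>d. hcomp gr d (rees_shift (g j) F n) \<in> T n d)" for n
      proof (cases n)
        case 0
        thus ?thesis by (simp add: rees_shift_def subspace_0[OF Zs] T_def span_zero)
      next
        case (Suc m)
        have "hcomp gr (d - e j) (F m) \<in> T m (d - e j)" for d using F by (simp add: Y_def)
        hence "s (g j) (hcomp gr (d - e j) (F m)) \<in> T (Suc m) (d - e j + e j)" for d by (rule T_step[OF j])
        moreover have "s (g j) (F m) \<in> Z (Suc m)" using F ZS[OF j] by (simp add: Y_def)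
        ultimately show ?thesis using Suc hcomp_scale[OF g[OF j]] by (simp add: rees_shift_def)
      qed
      thus "rees_shift (g j) F \<in> Y" by (simp add: Y_def)
    qed
    show "op_closed (rees_ops g J) Y"
      unfolding op_closed_def
    proof (intro conjI ballI)
      show "0 \<in> Y" by (simp add: Y_def subspace_0[OF Zs] T_def span_zero)
      show "F - F' \<in> Y" if "F \<in> Y" "F' \<in> Y" for F F'
        using that by (simp add: Y_def hcomp_diff subspace_diff[OF Zs] T_def span_diff)
      show "f F \<in> Y" if f: "f \<in> rees_ops g J" and F: "F \<in> Y" for f F
      proof -
        consider a where "f = (\<lambda>F n. s (Const a) (F n))" | w where "f = (\<lambda>F n. s (Var w) (F n))"
          | j where "j \<in> J" "f = rees_shift (g j)"
          using f by (auto simp: rees_ops_def const_ops_def var_ops_def)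
        thus ?thesis
        proof cases
          case 1
          thus ?thesis using F hcomp_scale[OF ring_part_Const]
            by (simp add: Y_def subspace_scale[OF Zs] T_def span_scale)
        next
          \<comment> \<open>A variable sends every component into \<open>W n\<close>, so it yields
            nothing new in any degree.\<close>
          case 2
          thus ?thesis using F hcomp_scale[OF ring_part_Var] ZW Zc
            by (simp add: Y_def subspace_scale[OF Zs] T_def span_base)
        next
          case 3
          thus ?thesis using F shift by simp
        qed
      qed
    qed
    show "G \<subseteq> Y"
    proof
      fix F assume F: "F \<in> G"
      have "hcomp gr d (F n) \<in> T n d" for n d
      proof (cases "hcomp gr d (F n) = 0")
        case False
        hence "F n \<noteq> 0" by auto
        hence "(hcomp gr d (F n), n, d) \<in> U" unfolding U_def using F False by blast
        moreover have "(\<lambda>_. 0) \<in> exps J" "sum (\<lambda>_. 0) J = (0::nat)" "dg (\<lambda>_. 0) = 0" "mon (\<lambda>_. 0) = 1"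
          by (simp_all add: exps_def dg_def mon_def vec_eq_iff)
        ultimately have "s (mon (\<lambda>_. 0)) (hcomp gr d (F n)) \<in> gens n d"
          unfolding gens_def by (metis (mono_tags, lifting) add.right_neutral mem_Collect_eq)
        thus ?thesis by (simp add: T_def span_base \<open>mon (\<lambda>_. 0) = 1\<close>)
      qed (simp add: T_def span_zero)
      thus "F \<in> Y" using F G(2) by (auto simp: Y_def RZ_def)
    qed
  qed
  hence ZT: "x \<in> T n d" if x: "x \<in> Z n" "x \<in> gr d" for x n d
  proof -
    define F where "F = (\<lambda>m. if m = n then x else 0)"
    have "F \<in> RZ" using x(1) by (simp add: F_def RZ_def subspace_0[OF Zs])
    hence "hcomp gr d (F n) \<in> T n d" using \<open>RZ \<subseteq> Y\<close> by (auto simp: Y_def)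
    thus ?thesis using x(2) by (simp add: F_def hcomp_homogeneous)
  qed
  \<comment> \<open>If all monomial multiples of degree d lay in \<open>W n\<close>, so would
    \<open>T n d\<close>; hence degrees are detected by single elements g^\<alpha> u.\<close>
  have key: "\<not> Z n \<inter> gr d \<subseteq> W n \<longleftrightarrow> (\<exists>x m \<delta> \<alpha>. (x, m, \<delta>) \<in> U \<and> \<alpha> \<in> exps J \<and> m + sum \<alpha> J = n \<and>
      \<delta> + dg \<alpha> = d \<and> s (mon \<alpha>) x \<notin> W n)" for n d
  proof
    assume "\<not> Z n \<inter> gr d \<subseteq> W n"
    then obtain x where x: "x \<in> Z n" "x \<in> gr d" "x \<notin> W n" by blast
    have "\<not> gens n d \<subseteq> W n"
    proof
      assume "gens n d \<subseteq> W n"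
      hence "T n d \<subseteq> W n" unfolding T_def by (intro span_minimal Ws) simp
      thus False using ZT[OF x(1,2)] x(3) by blast
    qed
    thus "\<exists>x m \<delta> \<alpha>. (x, m, \<delta>) \<in> U \<and> \<alpha> \<in> exps J \<and> m + sum \<alpha> J = n \<and> \<delta> + dg \<alpha> = d \<and> s (mon \<alpha>) x \<notin> W n"
      unfolding gens_def by blast
  next
    assume "\<exists>x m \<delta> \<alpha>. (x, m, \<delta>) \<in> U \<and> \<alpha> \<in> exps J \<and> m + sum \<alpha> J = n \<and> \<delta> + dg \<alpha> = d \<and> s (mon \<alpha>) x \<notin> W n"
    then obtain x m \<delta> \<alpha> where u: "(x, m, \<delta>) \<in> U" "m + sum \<alpha> J = n" "\<delta> + dg \<alpha> = d" "s (mon \<alpha>) x \<notin> W n"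
      by blast
    have "s (mon \<alpha>) x \<in> Z n" using mon_Z[OF UZ[OF u(1)], of \<alpha>] u(2) by simp
    moreover have "s (mon \<alpha>) x \<in> gr (dg \<alpha> + \<delta>)" by (rule gr_scale[OF mon_part Ugr[OF u(1)]])
    ultimately show "\<not> Z n \<inter> gr d \<subseteq> W n" using u(3,4) by (auto simp: add.commute)
  qed
  define V where "V = (\<lambda>(x, m, \<delta>) n. {(\<delta> $ l + t) + (\<Sum>j\<in>J. e j $ l * int (\<alpha> j)) | \<alpha>.
      \<alpha> \<in> {\<alpha> \<in> exps J. s (mon \<alpha>) x \<notin> W (m + sum \<alpha> J)} \<and> m + sum \<alpha> J = n})"
  have "max_eventually_linear D (V u)" for u
  proof -
    obtain x m \<delta> where u: "u = (x, m, \<delta>)" by (metis prod_cases3)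
    show ?thesis
      unfolding u V_def prod.case
    proof (rule max_eventually_linear_downclosed[OF J])
      show "\<beta> \<in> {\<alpha> \<in> exps J. s (mon \<alpha>) x \<notin> W (m + sum \<alpha> J)}"
        if a: "\<alpha> \<in> {\<alpha> \<in> exps J. s (mon \<alpha>) x \<notin> W (m + sum \<alpha> J)}" and le: "\<beta> \<le> \<alpha>" for \<alpha> \<beta>
      proof -
        have b: "\<beta> j \<le> \<alpha> j" for j using le by (simp add: le_fun_def)
        have "\<beta> \<in> exps J" using a b unfolding exps_def by (auto) (metis le_zero_eq)
        moreover have "s (mon \<beta>) x \<notin> W (m + sum \<beta> J)"
        proof
          assume w: "s (mon \<beta>) x \<in> W (m + sum \<beta> J)"
          \<comment> \<open>If g^\<beta> u is in \<open>W\<close>, then multiplying by the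
            complementary monomial puts g^\<alpha> u there as well.\<close>
          define \<gamma> where "\<gamma> = (\<lambda>j. \<alpha> j - \<beta> j)"
          have ab: "\<alpha> = \<gamma> + \<beta>" using b by (auto simp: \<gamma>_def fun_eq_iff)
          have "s (mon \<gamma>) (s (mon \<beta>) x) \<in> W (m + sum \<beta> J + sum \<gamma> J)" by (rule mon_W[OF w])
          moreover have "m + sum \<beta> J + sum \<gamma> J = m + sum \<alpha> J" by (simp add: ab sum.distrib)
          ultimately have "s (mon \<alpha>) x \<in> W (m + sum \<alpha> J)" by (simp add: ab mon_add)
          with a show False by blast
        qed
        ultimately show ?thesis by blast
      qed
    qed (use bound in auto)
  qed
  hence "max_eventually_linear D (\<lambda>n. \<Union>u\<in>U. V u n)" by (intro max_eventually_linear_UN finU)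
  moreover have "{d $ l + t | d. \<not> Z n \<inter> gr d \<subseteq> W n} = (\<Union>u\<in>U. V u n)" for n
  proof (intro set_eqI iffI)
    fix k assume "k \<in> {d $ l + t | d. \<not> Z n \<inter> gr d \<subseteq> W n}"
    then obtain d x m \<delta> \<alpha> where u: "k = d $ l + t" "(x, m, \<delta>) \<in> U" "\<alpha> \<in> exps J" "m + sum \<alpha> J = n"
      "\<delta> + dg \<alpha> = d" "s (mon \<alpha>) x \<notin> W n" unfolding key by blast
    have "k = (\<delta> $ l + t) + (\<Sum>j\<in>J. e j $ l * int (\<alpha> j))" using u(1) u(5)[symmetric] by (simp add: dg_def)
    hence "k \<in> V (x, m, \<delta>) n" unfolding V_def using u by auto
    thus "k \<in> (\<Union>u\<in>U. V u n)" using u(2) by blast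
  next
    fix k assume "k \<in> (\<Union>u\<in>U. V u n)"
    then obtain x m \<delta> \<alpha> where u: "(x, m, \<delta>) \<in> U" "\<alpha> \<in> exps J" "m + sum \<alpha> J = n" "s (mon \<alpha>) x \<notin> W n"
      "k = (\<delta> $ l + t) + (\<Sum>j\<in>J. e j $ l * int (\<alpha> j))" unfolding V_def by auto
    have "k = (\<delta> + dg \<alpha>) $ l + t" using u(5) by (simp add: dg_def)
    thus "k \<in> {d $ l + t | d. \<not> Z n \<inter> gr d \<subseteq> W n}" unfolding key using u(1-4) by blast
  qed
  ultimately show ?thesis by simp
qed

end

section \<open>Regularity in terms of Koszul homology\<close>

text \<open>The right-hand side does not mention a resolution, so all minimal resolutions give the
  same vector and the definite description in \<open>res_reg\<close> is justified.\<close>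

lemma res_reg_eq_Max:
  fixes s :: "('v::finite, 'a::field) mpoly \<Rightarrow> 'm::ab_group_add \<Rightarrow> 'm" and c :: "'v \<Rightarrow> 'k::finite"
  assumes M: "graded_module s c gr" and N: "graded_module.graded_submodule s gr N"
    and fg: "finite B" "N \<subseteq> module.span s B" and nz: "N \<noteq> {0}"
  shows "res_reg s c gr N $ l = Max {d $ l - int i | i d. koszul_homology_in_degree s c gr N i d}"
    and "{d $ l - int i | i d. koszul_homology_in_degree s c gr N i d} \<noteq> {}"
proof -
  define S where "S l = {d $ l - int i | i d. koszul_homology_in_degree s c gr N i d}" for l
  have res: "shift_regularity r b = (\<chi> l. Max (S l)) \<and> (\<forall>l. S l \<noteq> {})"
    if R: "minimal_graded_free_resolution s c gr N r b \<epsilon> \<delta>" for r b \<epsilon> \<delta>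
  proof -
    note D = R[unfolded minimal_graded_free_resolution_def]
    have HK: "koszul_homology_in_degree s c gr N i d \<longleftrightarrow> (\<exists>j<r i. b i j = d)" for i d
      by (rule koszul_homology_resolution[OF M, where \<epsilon> = \<epsilon> and \<delta> = \<delta>]) (use D in auto)
    have Se: "S l = (\<lambda>(i,j). b i j $ l - int i) ` (SIGMA i:{i. r i > 0}. {..<r i})" for l
      unfolding S_def HK by (fastforce simp: image_iff)
    obtain p where p: "\<forall>i>p. r i = 0" using conjunct1[OF D] ..
    have "{i. r i > 0} \<subseteq> {..p}"
    proof
      fix i assume "i \<in> {i. r i > 0}"
      hence "\<not> p < i" using p by auto
      thus "i \<in> {..p}" by simp
    qed
    hence fr: "finite {i. r i > 0}" by (rule finite_subset) simp
    hence finS: "finite (S l)" for l unfolding Se by simp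
    \<comment> \<open>Since N is nonzero, its cover has a basis element, so neither maximum runs
      over the empty set.\<close>
    have "r 0 > 0"
    proof (rule ccontr)
      assume "\<not> r 0 > 0"
      hence "free_module (r 0) = ({0} :: ('v, 'a) free set)" by (auto simp: free_module_def)
      moreover have "\<epsilon> ` free_module (r 0) = N" using D by (elim conjE)
      moreover have "\<epsilon> 0 = 0" using module_hom.zero[of free_scale s \<epsilon>] D by (elim conjE)
      ultimately have "N = {0}" by simp
      with nz show False ..
    qed
    hence ne: "S l \<noteq> {}" for l unfolding Se by auto
    have "Max {max_shift r b i l - int i | i. r i > 0} = Max (S l)" for l
    proof (rule Max_eqI)
      have sh: "max_shift r b i l \<in> {b i j $ l | j. j < r i}" if "r i > 0" for i
        unfolding max_shift_def by (rule Max_in) (use that in auto)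
      have ge: "b i j $ l \<le> max_shift r b i l" if "j < r i" for i j
        unfolding max_shift_def by (rule Max_ge) (use that in auto)
      have inS: "max_shift r b i l - int i \<in> S l" if pos: "r i > 0" for i
      proof -
        obtain j where "j < r i" "max_shift r b i l = b i j $ l" using sh[OF pos] by blast
        thus ?thesis unfolding S_def HK by (intro CollectI exI[of _ i] exI[of _ "b i j"]) auto
      qed
      show "finite {max_shift r b i l - int i | i. r i > 0}" using fr by simp
      show "y \<le> Max (S l)" if "y \<in> {max_shift r b i l - int i | i. r i > 0}" for y
        using that inS finS by auto
      have "Max (S l) \<in> S l" using finS ne by (rule Max_in)
      then obtain i j where ij: "j < r i" "Max (S l) = b i j $ l - int i" unfolding S_def HK by blast
      hence "r i > 0" by simp
      hence "max_shift r b i l - int i \<le> Max (S l)" using inS finS by simp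
      hence "Max (S l) = max_shift r b i l - int i" using ge[OF ij(1)] ij(2) by simp
      thus "Max (S l) \<in> {max_shift r b i l - int i | i. r i > 0}" using \<open>r i > 0\<close> by blast
    qed
    thus ?thesis using ne by (simp add: shift_regularity_def)
  qed
  obtain r b \<epsilon> \<delta> where R: "minimal_graded_free_resolution s c gr N r b \<epsilon> \<delta>"
    using minimal_graded_free_resolution_exists[OF M N fg] by blast
  have "res_reg s c gr N = (\<chi> l. Max (S l))"
    unfolding res_reg_def
  proof (rule the_equality)
    show "\<exists>r b \<epsilon> \<delta>. minimal_graded_free_resolution s c gr N r b \<epsilon> \<delta> \<and> (\<chi> l. Max (S l)) = shift_regularity r b"
      using R res[OF R] by metis
    show "\<rho> = (\<chi> l. Max (S l))"
      if "\<exists>r b \<epsilon> \<delta>. minimal_graded_free_resolution s c gr N r b \<epsilon> \<delta> \<and> \<rho> = shift_regularity r b" for \<rho>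
      using that res by metis
  qed
  thus "res_reg s c gr N $ l = Max {d $ l - int i | i d. koszul_homology_in_degree s c gr N i d}"
    by (simp add: S_def)
  show "{d $ l - int i | i d. koszul_homology_in_degree s c gr N i d} \<noteq> {}"
    using res[OF R] unfolding S_def by blast
qed

context graded_module
begin

text \<open>Minimality of I^n M is applied to the family of elements all of whose components lie in
  I^n M; homogeneous generators of I respect it.\<close>

lemma graded_submodule_power_submodule:
  assumes I: "I = ideal_gen (g ` J)" and g: "\<And>j. j \<in> J \<Longrightarrow> g j \<in> I \<and> g j \<in> ring_part c (e j)"
  shows "graded_submodule (power_submodule s I n)"
proof -
  define Q where "Q n = {x. \<forall>d. hcomp gr d x \<in> power_submodule s I n}" for n
  note P = subspace_power_submodule[of I]
  have "op_closed (const_ops s \<union> var_ops s) (Q n)" for n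
    using hcomp_scale[OF ring_part_Const] hcomp_scale[OF ring_part_Var]
    by (auto simp: op_closed_def const_ops_def var_ops_def Q_def hcomp_diff
        subspace_0[OF P] subspace_diff[OF P] subspace_scale[OF P])
  hence Qs: "subspace (Q n)" for n by (simp only: op_closed_iff_subspace)
  have "power_submodule s I n \<subseteq> Q n"
  proof (rule power_submodule_least[where Q = Q, OF I Qs])
    show "Q 0 = UNIV" by (simp add: Q_def power_submodule_0)
    show "s h x \<in> Q (Suc n)" if "h \<in> g ` J" "x \<in> Q n" for h n x
    proof -
      from that(1) obtain j where j: "j \<in> J" "h = g j" by blast
      have gj: "g j \<in> I" "g j \<in> ring_part c (e j)" using g[OF j(1)] by auto
      have "s (g j) (hcomp gr (d - e j) x) \<in> power_submodule s I (Suc n)" for d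
        using that(2) by (intro power_submodule_Suc[OF gj(1)]) (simp add: Q_def)
      thus ?thesis by (simp add: Q_def j(2) hcomp_scale[OF gj(2)])
    qed
  qed
  thus ?thesis using P unfolding graded_submodule_def Q_def by blast
qed

end

section \<open>Powers of the ideal on modules of functions, and the conclusion\<close>

context mpoly_module
begin

lemma function_eq_sum_singles:
  fixes f :: "'b::finite \<Rightarrow> 'n"
  shows "f = (\<Sum>A\<in>UNIV. (\<lambda>A'. if A' = A then f A else 0))"
  by (rule ext) (simp add: sum_fun_apply)

lemma subspace_single_vimage:
  fixes S :: "('b \<Rightarrow> 'n) set"
  assumes "module.subspace (\<lambda>p f A. s p (f A)) S"
  shows "subspace {x. (\<lambda>A'. if A' = A then x else 0) \<in> S}"
proof -
  interpret K: mpoly_module "\<lambda>p (f :: 'b \<Rightarrow> 'n) A. s p (f A)" by (rule mpoly_module_functions)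
  define \<iota> where "\<iota> x = (\<lambda>A'. if A' = A then x else 0)" for x :: 'n
  have "\<iota> 0 = 0" "\<iota> (x + y) = \<iota> x + \<iota> y" "\<iota> (s p x) = (\<lambda>A'. s p (\<iota> x A'))" for x y p
    by (auto simp: \<iota>_def fun_eq_iff)
  hence "subspace {x. \<iota> x \<in> S}"
    using assms by (simp add: subspace_def K.subspace_def)
  thus ?thesis by (simp only: \<iota>_def)
qed

lemma finitely_generated_functions:
  assumes "finite B" "span B = UNIV"
  shows "\<exists>B' :: ('b::finite \<Rightarrow> 'n) set. finite B' \<and> module.span (\<lambda>p f A. s p (f A)) B' = UNIV"
proof -
  interpret K: mpoly_module "\<lambda>p (f :: 'b \<Rightarrow> 'n) A. s p (f A)" by (rule mpoly_module_functions)
  define \<iota> where "\<iota> A x = (\<lambda>A'. if A' = A then x else 0)" for A :: 'b and x :: 'n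
  define B' where "B' = (\<Union>A. \<iota> A ` B)"
  have "\<iota> A x \<in> K.span B'" for A x
  proof -
    have "\<iota> A ` B \<subseteq> K.span B'" by (rule order_trans[OF _ K.span_superset]) (auto simp: B'_def)
    hence "B \<subseteq> {x. \<iota> A x \<in> K.span B'}" by blast
    moreover have "subspace {x. \<iota> A x \<in> K.span B'}"
      unfolding \<iota>_def by (rule subspace_single_vimage[OF K.subspace_span])
    ultimately have "span B \<subseteq> {x. \<iota> A x \<in> K.span B'}" by (rule span_minimal)
    thus ?thesis using assms(2) by blast
  qed
  hence sums: "(\<Sum>A\<in>UNIV. \<iota> A (f A)) \<in> K.span B'" for f by (intro K.span_sum)
  have "f \<in> K.span B'" for f
    using sums[of f] unfolding \<iota>_def function_eq_sum_singles[symmetric] .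
  moreover have "finite B'" using assms(1) by (simp add: B'_def)
  ultimately show ?thesis by blast
qed

text \<open>A finite direct sum of copies of I^n M lies in I^n times the direct sum of copies of M.
  This places the Koszul cycles of I^n M in the Rees module of the module of chains.\<close>

lemma functions_in_power_submodule:
  fixes f :: "'b::finite \<Rightarrow> 'n"
  assumes I: "I = ideal_gen G" "G \<subseteq> I" and f: "\<And>A. f A \<in> power_submodule s I n"
  shows "f \<in> power_submodule (\<lambda>p f A. s p (f A)) I n"
proof -
  interpret K: mpoly_module "\<lambda>p (f :: 'b \<Rightarrow> 'n) A. s p (f A)" by (rule mpoly_module_functions)
  define \<iota> where "\<iota> A x = (\<lambda>A'. if A' = A then x else 0)" for A :: 'b and x :: 'n
  let ?P = "power_submodule (\<lambda>p (f :: 'b \<Rightarrow> 'n) A. s p (f A)) I"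
  note P = K.subspace_power_submodule[of I]
  have scale: "(\<lambda>A'. s p (\<iota> A x A')) = \<iota> A (s p x)" for p A x by (auto simp: \<iota>_def fun_eq_iff)
  have "power_submodule s I n \<subseteq> {x. \<iota> A x \<in> ?P n}" for A
  proof (rule power_submodule_least[where Q = "\<lambda>n. {x. \<iota> A x \<in> ?P n}", OF I(1)])
    show "subspace {x. \<iota> A x \<in> ?P n}" for n
      unfolding \<iota>_def by (rule subspace_single_vimage[OF P])
    show "{x. \<iota> A x \<in> ?P 0} = UNIV" by (simp add: K.power_submodule_0)
    show "s h x \<in> {x. \<iota> A x \<in> ?P (Suc n)}" if "h \<in> G" "x \<in> {x. \<iota> A x \<in> ?P n}" for h n x
      using that K.power_submodule_Suc[of h I "\<iota> A x" n] I(2) by (auto simp: scale)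
  qed
  hence "\<iota> A (f A) \<in> ?P n" for A using f by blast
  hence "(\<Sum>A\<in>UNIV. \<iota> A (f A)) \<in> ?P n" by (intro K.subspace_sum[OF P])
  thus ?thesis unfolding \<iota>_def function_eq_sum_singles[symmetric] .
qed

end

theorem theorem1p4:
  fixes s :: "('v::finite, 'a::field) mpoly \<Rightarrow> 'm::ab_group_add \<Rightarrow> 'm"
    and c :: "'v \<Rightarrow> 'k::finite"
    and gr :: "int ^ 'k \<Rightarrow> 'm set"
    and I :: "('v, 'a) mpoly set"
    and v :: nat
    and d :: "nat \<Rightarrow> int ^ 'k"
  assumes "graded_module s c gr"
    and "finitely_generated s"
    and "minimally_generated_in_degrees c I v d"
  shows "(\<forall>\<^sub>F n in sequentially. power_submodule s I n = {0}) \<or>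
         (\<exists>a b :: int ^ 'k.
            (\<forall>l. a $ l \<le> max_gen_degree v d l) \<and>
            (\<forall>\<^sub>F n in sequentially. \<forall>l.
               res_reg s c gr (power_submodule s I n) $ l = a $ l * int n + b $ l))"
proof -
  interpret M: graded_module s c gr by (rule assms(1))
  interpret K: graded_module "\<lambda>p (f :: 'v set \<Rightarrow> 'm) A. s p (f A)" c "koszul_grading c gr"
    by (rule M.graded_module_koszul)
  define N where "N = power_submodule s I"
  obtain g where gd: "\<And>i. i \<in> {1..v} \<Longrightarrow> g i \<in> ring_part c (d i)" and I: "I = ideal_gen (g ` {1..v})"
    using assms(3) unfolding minimally_generated_in_degrees_def by blast
  have GI: "g ` {1..v} \<subseteq> I"
    unfolding I ideal_gen_def by (rule module.span_superset[OF M.module_mult])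
  hence gI: "g i \<in> I" if "i \<in> {1..v}" for i using that by blast
  obtain B where B: "finite B" "M.span B = UNIV" using assms(2) unfolding finitely_generated_def by blast
  have fgN: "N n \<subseteq> M.span B" for n using B(2) by simp
  have grN: "M.graded_submodule (N n)" for n
    unfolding N_def by (rule M.graded_submodule_power_submodule[OF I]) (use gI gd in blast)
  hence sN: "M.subspace (N n)" for n by (simp add: M.graded_submodule_def)
  have NS: "s (g j) x \<in> N (Suc n)" if "j \<in> {1..v}" "x \<in> N n" for j n x
    using M.power_submodule_Suc[OF gI] that by (simp add: N_def)
  obtain BK :: "('v set \<Rightarrow> 'm) set" where BK: "finite BK" "K.span BK = UNIV"
    using M.finitely_generated_functions[OF B] by blast
  have chainsS: "(\<lambda>A. s (g j) (f A)) \<in> koszul_chains (N (Suc n)) i"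
    if "j \<in> {1..v}" "f \<in> koszul_chains (N n) i" for j n i and f :: "'v set \<Rightarrow> 'm"
    using that NS by (simp add: koszul_chains_def)
  \<comment> \<open>For one homological degree i, the chain module carries the filtrations by cycles
    and by boundaries of I^n M, with offset -i.\<close>
  have piece: "max_eventually_linear (max_gen_degree v d l)
      (\<lambda>n. {e $ l + - int i | e. koszul_homology_in_degree s c gr (N n) i e})" for i l
    unfolding koszul_homology_in_degree_def
  proof (rule K.max_degree_eventually_linear[OF _ BK gd])
    fix n
    show "K.graded_submodule (koszul_cycles s (N n) i)" by (rule M.graded_submodule_koszul_cycles[OF grN])
    show "K.graded_submodule (koszul_boundaries s (N n) i)" by (rule M.graded_submodule_koszul_boundaries[OF grN])
    show "koszul_cycles s (N n) i \<subseteq> power_submodule (\<lambda>p f A. s p (f A)) (ideal_gen (g ` {1..v})) n"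
    proof
      fix f assume f: "f \<in> koszul_cycles s (N n) i"
      show "f \<in> power_submodule (\<lambda>p f A. s p (f A)) (ideal_gen (g ` {1..v})) n"
        unfolding I[symmetric]
        by (rule M.functions_in_power_submodule[OF I GI])
          (use f in \<open>simp add: koszul_cycles_def koszul_chains_def N_def\<close>)
    qed
    fix j assume j: "j \<in> {1..v}"
    show "(\<lambda>A. s (g j) (f A)) \<in> koszul_cycles s (N (Suc n)) i" if "f \<in> koszul_cycles s (N n) i" for f
      using that chainsS[OF j] by (simp add: koszul_cycles_def M.koszul_scale fun_eq_iff)
    show "(\<lambda>A. s (g j) (f A)) \<in> koszul_boundaries s (N (Suc n)) i" if "f \<in> koszul_boundaries s (N n) i" for f
    proof -
      from that obtain h where h: "f = koszul s h" "h \<in> koszul_chains (N n) (Suc i)"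
        unfolding koszul_boundaries_def by blast
      show ?thesis unfolding h(1) M.koszul_scale[symmetric] koszul_boundaries_def
        by (rule imageI[OF chainsS[OF j h(2)]])
    qed
  next
    show "(\<lambda>A. s (Var w) (f A)) \<in> koszul_boundaries s (N n) i" if "f \<in> koszul_cycles s (N n) i" for w n f
      by (rule M.Var_koszul_cycles_boundaries[OF sN that])
    show "d j $ l \<le> max_gen_degree v d l" if "j \<in> {1..v}" for j
      unfolding max_gen_degree_def by (rule Max_ge) (use that in auto)
  qed simp
  define V where "V l n = {e $ l - int i | i e. koszul_homology_in_degree s c gr (N n) i e}" for l n
  have V: "V l n = (\<Union>i\<in>{..CARD('v)}. {e $ l + - int i | e. koszul_homology_in_degree s c gr (N n) i e})" for l n
  proof (intro set_eqI iffI)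
    fix k assume "k \<in> V l n"
    then obtain i e where ie: "k = e $ l - int i" "koszul_homology_in_degree s c gr (N n) i e"
      unfolding V_def by blast
    have "\<not> CARD('v) < i" using M.koszul_homology_vanishes[OF sN] ie(2) by blast
    thus "k \<in> (\<Union>i\<in>{..CARD('v)}. {e $ l + - int i | e. koszul_homology_in_degree s c gr (N n) i e})"
      using ie by (intro UN_I[of i]) auto
  qed (auto simp: V_def)
  have linear: "max_eventually_linear (max_gen_degree v d l) (V l)" for l
    unfolding ext[of "V l", OF V] by (intro max_eventually_linear_UN piece) simp
  \<comment> \<open>Emptiness is thus the same condition for every coordinate l.\<close>
  have V_empty: "V l n = {} \<longleftrightarrow> N n = {0}" for l n
    using res_reg_eq_Max(2)[OF assms(1) grN B(1) fgN] M.koszul_homology_zero_module unfolding V_def by fastforce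
  have reg: "res_reg s c gr (N n) $ l = Max (V l n)" if "V l n \<noteq> {}" for l n
    unfolding V_def by (rule res_reg_eq_Max(1)[OF assms(1) grN B(1) fgN]) (use that V_empty in blast)
  show ?thesis
  proof (cases "\<forall>\<^sub>F n in sequentially. N n = {0}")
    case True
    thus ?thesis by (simp add: N_def)
  next
    case False
    define P where "P l a b \<longleftrightarrow> a \<le> max_gen_degree v d l \<and>
      (\<forall>\<^sub>F n in sequentially. V l n \<noteq> {} \<and> Max (V l n) = a * int n + b)" for l a b
    \<comment> \<open>As I^n M is not eventually zero, the case of eventual emptiness is excluded
      for each l, which leaves the linear one.\<close>
    have "\<exists>a b. P l a b" for l
      using linear[of l] False unfolding max_eventually_linear_def V_empty P_def by blast
    then obtain a b where "\<And>l. P l (a l) (b l)" by metis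
    hence ab: "a l \<le> max_gen_degree v d l \<and>
      (\<forall>\<^sub>F n in sequentially. V l n \<noteq> {} \<and> Max (V l n) = a l * int n + b l)" for l
      unfolding P_def .
    have "\<forall>\<^sub>F n in sequentially. \<forall>l. res_reg s c gr (N n) $ l = a l * int n + b l"
    \<comment> \<open>There are finitely many coordinates, so one threshold works for all of
      them.\<close>
    proof (rule eventually_all_finite)
      fix l
      show "\<forall>\<^sub>F n in sequentially. res_reg s c gr (N n) $ l = a l * int n + b l"
        using conjunct2[OF ab[of l]] by eventually_elim (simp add: reg)
    qed
    hence "\<exists>a b :: int ^ 'k. (\<forall>l. a $ l \<le> max_gen_degree v d l) \<and>
        (\<forall>\<^sub>F n in sequentially. \<forall>l. res_reg s c gr (N n) $ l = a $ l * int n + b $ l)"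
      using conjunct1[OF ab] by (intro exI[of _ "\<chi> l. a l"] exI[of _ "\<chi> l. b l"]) simp
    thus ?thesis by (simp add: N_def)
  qed
qed

end
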